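(* Let $\xi$ be a Lévy process with $\psi(1)=\log\mathbb{E}e^{\xi(1)}<\infty$, let $\theta_+,\theta_-\ge 0$ satisfy $\psi(1)=\theta_--\theta_+$, and let $q_t^+$, $V_i,\tilde V_i^+,\tilde V_i^-$ be the associated kernel and particle trajectories (constructed in the context). Then the law of the following Poisson point process on $\bar D$ is invariant with respect to the time shifts $T_t$, $t\in\mathbb{R}$: $$\Pi:=\sum_{i}\delta_{V_i}+\sum_{i}\delta_{\tilde V_i^+}+\sum_{i}\delta_{\tilde V_i^-},$$ and its (infinite) intensity measure $\mu_\Pi$ is given by $$\mu_\Pi\{f\in\bar D\colon f(t_1)\in dx_1,\ldots,f(t_n)\in dx_n\}=e^{-x_1}dx_1\cdot q^+_{t_2-t_1}(x_1,dx_2)\cdots q^+_{t_n-t_{n-1}}(x_{n-1},dx_n)$$ for all $t_1<\ldots<t_n$ and $x_1,\ldots,x_n\in\mathbb{R}$. As a consequence, the process $$\eta(t):=\max\{V_i(t),\tilde V_i^+(t),\tilde V_i^-(t)\colon i\in\mathbb{N}\},\qquad t\in\mathbb{R},$$ is max-stable and stationary.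
   Context: Construction. Let $\{\xi(t)\colon t\ge0\}$ be a real-valued Lévy process with $\psi(1):=\log\mathbb{E}e^{\xi(1)}<\infty$ and transition kernel $p_t(x,dy)$ (law of $x+\xi(t)$). Let $\theta_+\ge0$, $\theta_-\ge0$ satisfy $\psi(1)=\theta_--\theta_+$. Let $L^+$ be $\xi$ killed at rate $\theta_-$ (killed means set to $-\infty$ from an independent exponential time with rate $\theta_-$ on; no killing if $\theta_-=0$), with subprobability transition kernel $q_t^+(x,dy)=e^{-\theta_-t}p_t(x,dy)$ on $\mathbb{R}$. Let $L^-$ be the (killed) Lévy process started at $0$ whose subprobability transition kernel $q_t^-$ is given by $e^{-x}dx\,q_t^-(x,dy)=e^{-y}dy\,q_t^+(y,dx)$; its killing rate is $\theta_+$, and after killing it equals $-\infty$. $L^+$ is taken càdlàg and $L^-$ left-continuous with right limits. With $L^+,L^-$ independent, put $L(t)=L^+(t)$ for $t\ge0$ and $L(t)=L^-(-t)$ for $t<0$. Let $\pi_0=\sum_i\delta_{U_i}$ be a Poisson point process (PPP) on $\mathbb{R}$ with intensity $e^{-u}du$; $\pi_+=\sum_i\delta_{(\tilde T_i^+,\tilde U_i^+)}$ a PPP on $(0,\infty)\times\mathbb{R}$ with intensity $\theta_+dt\times e^{-u}du$; $\pi_-=\sum_i\delta_{(\tilde T_i^-,\tilde U_i^-)}$ a PPP on $(-\infty,0)\times\mathbb{R}$ with intensity $\theta_-dt\times e^{-u}du$ (a PPP with zero intensity is empty). Let $L_1,L_2,\ldots$ be copies of $L$, $\tilde L_1^+,\tilde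 L_2^+,\ldots$ copies of $L^+$, $\tilde L_1^-,\tilde L_2^-,\ldots$ copies of $L^-$, with $\pi_0,\pi_+,\pi_-,L_i,\tilde L_i^+,\tilde L_i^-$ ($i\in\mathbb{N}$) all independent. Define, for $t\in\mathbb{R}$: $V_i(t)=U_i+L_i(t)$; $\tilde V_i^+(t)=-\infty$ for $t<\tilde T_i^+$ and $\tilde V_i^+(t)=\tilde U_i^++\tilde L_i^+(t-\tilde T_i^+)$ for $t\ge\tilde T_i^+$; $\tilde V_i^-(t)=\tilde U_i^-+\tilde L_i^-(\tilde T_i^--t)$ for $t<\tilde T_i^-$ and $\tilde V_i^-(t)=-\infty$ for $t\ge\tilde T_i^-$. $\bar D$ is the Skorokhod space of càdlàg functions $f:\mathbb{R}\to\mathbb{R}\cup\{-\infty\}$, and $T_tf(s)=f(s-t)$. A process $\{\eta(t)\colon t\in\mathbb{R}\}$ is max-stable (with standard Gumbel margins) if for every $n$ the process $\max_{i=1,\ldots,n}\eta_i(t)-\log n$, with $\eta_i$ i.i.d. copies of $\eta$, has the same finite-dimensional distributions as $\eta$. *)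

theory Defs
  imports "HOL-Probability.Probability"
begin

section \<open>Path spaces\<close>

text \<open>
  Paths with values in \<open>\<real> \<union> {-\<infinity>}\<close> are functions into \<^typ>\<open>ereal\<close> that avoid \<open>\<infinity>\<close>;
  the one-sided limits must avoid \<open>\<infinity>\<close> as well.
\<close>

definition cadlag_on :: "real set \<Rightarrow> (real \<Rightarrow> ereal) \<Rightarrow> bool" where
  "cadlag_on I f \<longleftrightarrow> (\<forall>t\<in>I. f t \<noteq> \<infinity> \<and>
      (f \<longlongrightarrow> f t) (at t within (I \<inter> {t<..})) \<and>
      (\<exists>l. l \<noteq> \<infinity> \<and> (f \<longlongrightarrow> l) (at t within (I \<inter> {..<t}))))"

definition caglad_on :: "real set \<Rightarrow> (real \<Rightarrow> ereal) \<Rightarrow> bool" where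
  "caglad_on I f \<longleftrightarrow> (\<forall>t\<in>I. f t \<noteq> \<infinity> \<and>
      (f \<longlongrightarrow> f t) (at t within (I \<inter> {..<t})) \<and>
      (\<exists>l. l \<noteq> \<infinity> \<and> (f \<longlongrightarrow> l) (at t within (I \<inter> {t<..}))))"

text \<open>
  The path spaces carry the \<open>\<sigma>\<close>-algebra generated by the evaluation maps; on the Skorokhod
  space this is the Borel \<open>\<sigma>\<close>-algebra of the Skorokhod topology.
\<close>

abbreviation path_alg :: "real set \<Rightarrow> (real \<Rightarrow> ereal) measure" where
  "path_alg I \<equiv> Pi\<^sub>M I (\<lambda>_. borel)"

definition cadlag_space :: "real set \<Rightarrow> (real \<Rightarrow> ereal) measure" where
  "cadlag_space I = restrict_space (path_alg I) {f. cadlag_on I f}"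

definition caglad_space :: "real set \<Rightarrow> (real \<Rightarrow> ereal) measure" where
  "caglad_space I = restrict_space (path_alg I) {f. caglad_on I f}"

definition Dbar :: "(real \<Rightarrow> ereal) measure" where
  "Dbar = cadlag_space UNIV"

definition time_shift :: "real \<Rightarrow> (real \<Rightarrow> ereal) \<Rightarrow> real \<Rightarrow> ereal" where
  "time_shift t f = (\<lambda>s. f (s - t))"

section \<open>Levy processes and killing\<close>

text \<open>
  Path regularity is not part of this definition (stochastic continuity replaces it), because
  one and the same law is needed below both in a cadlag and in a caglad version.
\<close>

definition levy_process :: "'a measure \<Rightarrow> (real \<Rightarrow> 'a \<Rightarrow> real) \<Rightarrow> bool" where
  "levy_process M X \<longleftrightarrow> prob_space M \<and>
     (\<forall>t\<ge>0. X t \<in> borel_measurable M) \<and>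
     (AE \<omega> in M. X 0 \<omega> = 0) \<and>
     (\<forall>(t :: nat \<Rightarrow> real) n. 0 \<le> t 0 \<and> (\<forall>i<n. t i \<le> t (Suc i)) \<longrightarrow>
        prob_space.indep_vars M (\<lambda>_. borel) (\<lambda>i \<omega>. X (t (Suc i)) \<omega> - X (t i) \<omega>) {..<n}) \<and>
     (\<forall>s\<ge>0. \<forall>t\<ge>0. distr M borel (\<lambda>\<omega>. X (s + t) \<omega> - X s \<omega>) = distr M borel (X t)) \<and>
     (\<forall>\<epsilon>>0. ((\<lambda>t. measure M {\<omega>\<in>space M. \<bar>X t \<omega>\<bar> > \<epsilon>}) \<longlongrightarrow> 0) (at_right 0))"

definition levy_kernel :: "'a measure \<Rightarrow> (real \<Rightarrow> 'a \<Rightarrow> real) \<Rightarrow> real \<Rightarrow> real \<Rightarrow> real measure" where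
  "levy_kernel M X t x = distr M borel (\<lambda>\<omega>. x + X t \<omega>)"

definition killed_kernel ::
    "'a measure \<Rightarrow> (real \<Rightarrow> 'a \<Rightarrow> real) \<Rightarrow> real \<Rightarrow> real \<Rightarrow> real \<Rightarrow> real measure" where
  "killed_kernel M X \<theta> t x = scale_measure (ennreal (exp (- \<theta> * t))) (levy_kernel M X t x)"

text \<open>The relation \<open>e\<^sup>-\<^sup>x dx q(x, dy) = e\<^sup>-\<^sup>y dy q'(y, dx)\<close>, tested on rectangles.\<close>

definition exp_dual :: "(real \<Rightarrow> real measure) \<Rightarrow> (real \<Rightarrow> real measure) \<Rightarrow> bool" where
  "exp_dual q q' \<longleftrightarrow> (\<forall>A\<in>sets borel. \<forall>B\<in>sets borel.
     (\<integral>\<^sup>+x\<in>A. ennreal (exp (- x)) * emeasure (q x) B \<partial>lborel) =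
     (\<integral>\<^sup>+y\<in>B. ennreal (exp (- y)) * emeasure (q' y) A \<partial>lborel))"

text \<open>The exponential distribution; rate 0 means that the time is infinite.\<close>

definition exp_time :: "real \<Rightarrow> ereal measure" where
  "exp_time \<theta> = (if \<theta> = 0 then return borel \<infinity>
                  else distr (density lborel (exponential_density \<theta>)) borel ereal)"

text \<open>
  The law on \<open>[0,\<infinity>)\<close> of \<open>X\<close> killed at an independent exponential time. Whether
  the path is killed at or just after this time does not affect the law.
\<close>

definition killed_law ::
    "'a measure \<Rightarrow> (real \<Rightarrow> 'a \<Rightarrow> real) \<Rightarrow> real \<Rightarrow> (real \<Rightarrow> ereal) measure" where
  "killed_law M X \<theta> = distr (M \<Otimes>\<^sub>M exp_time \<theta>) (path_alg {0..})
     (\<lambda>(\<omega>, \<tau>). \<lambda>t\<in>{0..}. if ereal t < \<tau> then ereal (X t \<omega>) else -\<infinity>)"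

definition two_sided_law ::
    "(real \<Rightarrow> ereal) measure \<Rightarrow> (real \<Rightarrow> ereal) measure \<Rightarrow> (real \<Rightarrow> ereal) measure" where
  "two_sided_law P Q = distr (P \<Otimes>\<^sub>M Q) (path_alg UNIV)
     (\<lambda>(f, g). \<lambda>t. if t \<ge> 0 then f t else g (- t))"

section \<open>Point processes\<close>

definition measure_algebra :: "'a measure \<Rightarrow> 'a measure measure" where
  "measure_algebra S =
     (SUP A\<in>sets S. vimage_algebra {\<mu>. sets \<mu> = sets S} (\<lambda>\<mu>. emeasure \<mu> A) borel)"

text \<open>The measure \<open>\<Sum>\<^sub>i \<delta>\<^bsub>x i\<^esub>\<close> on \<open>S\<close>, with \<open>i\<close> ranging over \<open>I\<close>.\<close>

definition dirac_sum :: "'s measure \<Rightarrow> 'i set \<Rightarrow> ('i \<Rightarrow> 's) \<Rightarrow> 's measure" where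
  "dirac_sum S I x = distr (count_space I) S x"

text \<open>\<open>N\<close> is a Poisson point process with intensity \<open>\<mu>\<close>, on the measurable space underlying \<open>\<mu>\<close>.\<close>

definition poisson_point_process ::
    "'w measure \<Rightarrow> 's measure \<Rightarrow> ('w \<Rightarrow> 's measure) \<Rightarrow> bool" where
  "poisson_point_process \<Omega> \<mu> N \<longleftrightarrow> sigma_finite_measure \<mu> \<and>
     N \<in> \<Omega> \<rightarrow>\<^sub>M measure_algebra \<mu> \<and>
     (\<forall>B\<in>sets \<mu>. \<forall>k::nat. measure \<Omega> {\<omega>\<in>space \<Omega>. emeasure (N \<omega>) B = of_nat k} =
        (if emeasure \<mu> B = \<infinity> then 0
         else exp (- measure \<mu> B) * measure \<mu> B ^ k / fact k)) \<and>
     (\<forall>(B :: nat \<Rightarrow> 's set) n. (\<forall>j<n. B j \<in> sets \<mu>) \<and> disjoint_family_on B {..<n} \<longrightarrow>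
        prob_space.indep_vars \<Omega> (\<lambda>_. borel) (\<lambda>j \<omega>. emeasure (N \<omega>) (B j)) {..<n})"

definition poisson_points ::
    "'w measure \<Rightarrow> 's measure \<Rightarrow> 'i set \<Rightarrow> ('i \<Rightarrow> 'w \<Rightarrow> 's) \<Rightarrow> bool" where
  "poisson_points \<Omega> \<mu> I X \<longleftrightarrow> (\<forall>i\<in>I. X i \<in> \<Omega> \<rightarrow>\<^sub>M \<mu>) \<and>
     poisson_point_process \<Omega> \<mu> (\<lambda>\<omega>. dirac_sum \<mu> I (\<lambda>i. X i \<omega>))"

definition intensity_measure ::
    "'w measure \<Rightarrow> 's measure \<Rightarrow> ('w \<Rightarrow> 's measure) \<Rightarrow> 's measure" where
  "intensity_measure \<Omega> S N =
     measure_of (space S) (sets S) (\<lambda>B. \<integral>\<^sup>+\<omega>. emeasure (N \<omega>) B \<partial>\<Omega>)"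

definition exp_intensity :: "real measure" where
  "exp_intensity = density lborel (\<lambda>u. ennreal (exp (- u)))"

definition rate_intensity :: "real set \<Rightarrow> real \<Rightarrow> (real \<times> real) measure" where
  "rate_intensity I \<theta> =
     scale_measure (ennreal \<theta>) (restrict_space lborel I) \<Otimes>\<^sub>M exp_intensity"

section \<open>The particle system\<close>

datatype particle = Central nat | Plus nat | Minus nat

text \<open>
  For positive rate the Poisson process has almost surely infinitely many points, enumerated by
  all natural numbers; for rate 0 it is empty and the corresponding particles are absent.
\<close>

definition point_indices :: "real \<Rightarrow> nat set" where
  "point_indices \<theta> = (if \<theta> = 0 then {} else UNIV)"

definition particles :: "real \<Rightarrow> real \<Rightarrow> particle set" where
  "particles \<theta>p \<theta>m = range Central \<union> Plus ` point_indices \<theta>p \<union> Minus ` point_indices \<theta>m"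

definition central_path :: "real \<Rightarrow> (real \<Rightarrow> ereal) \<Rightarrow> real \<Rightarrow> ereal" where
  "central_path u f t = ereal u + f t"

definition plus_path :: "real \<Rightarrow> real \<Rightarrow> (real \<Rightarrow> ereal) \<Rightarrow> real \<Rightarrow> ereal" where
  "plus_path s u f t = (if t < s then -\<infinity> else ereal u + f (t - s))"

definition minus_path :: "real \<Rightarrow> real \<Rightarrow> (real \<Rightarrow> ereal) \<Rightarrow> real \<Rightarrow> ereal" where
  "minus_path s u f t = (if t < s then ereal u + f (s - t) else -\<infinity>)"

text \<open>The mutually independent inputs: three sequences of points, and one driving path per particle.\<close>

datatype input = Points0 | PointsPlus | PointsMinus | Driver particle

definition generated :: "'w measure \<Rightarrow> 's measure \<Rightarrow> ('w \<Rightarrow> 's) \<Rightarrow> 'w set set" where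
  "generated \<Omega> S X = sets (vimage_algebra (space \<Omega>) X S)"

section \<open>Finite-dimensional distributions\<close>

text \<open>
  \<open>\<integral>\<^bsub>B (i+1)\<^esub> q\<^bsub>t (i+1) - t i\<^esub>(x, dx\<^sub>i\<^sub>+\<^sub>1) \<dots> \<integral>\<^bsub>B (i+k)\<^esub> q\<^bsub>t (i+k) - t (i+k-1)\<^esub>(x\<^sub>i\<^sub>+\<^sub>k\<^sub>-\<^sub>1, dx\<^sub>i\<^sub>+\<^sub>k)\<close>,
  a function of the position \<open>x\<close> at time \<open>t i\<close>.
\<close>

primrec kernel_chain ::
    "(real \<Rightarrow> real \<Rightarrow> real measure) \<Rightarrow> (nat \<Rightarrow> real) \<Rightarrow> (nat \<Rightarrow> real set) \<Rightarrow>
     nat \<Rightarrow> nat \<Rightarrow> real \<Rightarrow> ennreal" where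
  "kernel_chain q t B 0 i x = 1"
| "kernel_chain q t B (Suc k) i x =
     (\<integral>\<^sup>+y\<in>B (Suc i). kernel_chain q t B k (Suc i) y \<partial>(q (t (Suc i) - t i) x))"

definition same_fdd ::
    "'v measure \<Rightarrow> (real \<Rightarrow> 'v \<Rightarrow> ereal) \<Rightarrow> 'w measure \<Rightarrow> (real \<Rightarrow> 'w \<Rightarrow> ereal) \<Rightarrow> bool" where
  "same_fdd M X N Y \<longleftrightarrow>
     (\<forall>t. X t \<in> borel_measurable M) \<and> (\<forall>t. Y t \<in> borel_measurable N) \<and>
     (\<forall>J. finite J \<longrightarrow> distr M (path_alg J) (\<lambda>\<omega>. \<lambda>t\<in>J. X t \<omega>) =
                          distr N (path_alg J) (\<lambda>\<omega>. \<lambda>t\<in>J. Y t \<omega>))"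

definition stationary :: "'w measure \<Rightarrow> (real \<Rightarrow> 'w \<Rightarrow> ereal) \<Rightarrow> bool" where
  "stationary \<Omega> X \<longleftrightarrow> (\<forall>h. same_fdd \<Omega> (\<lambda>t. X (t + h)) \<Omega> X)"

text \<open>
  Max-stability with standard Gumbel margins. The \<open>n\<close> independent copies are realised on the
  \<open>n\<close>-fold product of the underlying probability space.
\<close>

definition max_stable :: "'w measure \<Rightarrow> (real \<Rightarrow> 'w \<Rightarrow> ereal) \<Rightarrow> bool" where
  "max_stable \<Omega> X \<longleftrightarrow>
     (\<forall>t x. measure \<Omega> {\<omega>\<in>space \<Omega>. X t \<omega> \<le> ereal x} = exp (- exp (- x))) \<and>
     (\<forall>n\<ge>1. same_fdd (Pi\<^sub>M {..<n} (\<lambda>_. \<Omega>))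
                (\<lambda>t w. (MAX i\<in>{..<n}. X t (w i)) - ereal (ln (real n))) \<Omega> X)"

end

theory Submission
  imports Defs
begin

text \<open>
  A random counting measure is Poisson with intensity \<open>\<mu>\<close> exactly when its Laplace functional is
  \<open>exp (- \<integral> (1 - e\<^sup>-\<^sup>f) d\<mu>)\<close>, and this functional determines its law. The driving paths are
  independent of the starting points, so conditioning on the points replaces the factor
  \<open>e\<^sup>-\<^sup>f\<close> of each particle by its average over the driving path; the Laplace functional of the
  particle system is then read off from those of the three Poisson processes of starting points.

  The intensity is computed by duality. Since \<open>q\<^sup>+\<close> and \<open>q\<^sup>-\<close> are dual with respect to
  \<open>e\<^sup>-\<^sup>x dx\<close>, starting at time \<open>s\<close> from \<open>e\<^sup>-\<^sup>u du\<close> and running \<open>L\<^sup>+\<close> forwards and \<open>L\<^sup>-\<close>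
  backwards gives, on the event that the path is alive at all of \<open>t\<^sub>0 \<le> \<dots> \<le> t\<^sub>n\<close>, the same measure
  up to a survival factor: \<open>e\<close> to the power \<open>- \<theta>\<^sub>+ (t\<^sub>0 - s)\<close> if \<open>s \<le> t\<^sub>0\<close>, and to the power
  \<open>- \<theta>\<^sub>- (s - t\<^sub>n)\<close> if \<open>t\<^sub>n \<le> s\<close>. If \<open>t\<^sub>0 \<ge> 0\<close>, the particles present at time 0 lose the fraction
  \<open>1 - exp (- \<theta>\<^sub>+ t\<^sub>0)\<close>, and this is exactly what the births during \<open>(0, t\<^sub>0]\<close> restore; the case
  \<open>t\<^sub>n < 0\<close> is symmetric.

  The marginals obtained in this way determine the intensity, because the path that is constantly
  \<open>-\<infinity>\<close> carries no mass. They are invariant under time shifts, and translating the paths by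
  \<open>c\<close> multiplies them by \<open>e\<^sup>c\<close>. Through the void probabilities, the first fact makes \<open>\<eta>\<close>
  stationary and the second makes it max-stable.
\<close>

section \<open>Laplace transforms of counting variables\<close>

text \<open>The points of each Poisson process come with an arbitrary measurable enumeration, which
  may depend on the whole configuration; only the random measure they form is prescribed. The
  trajectories are therefore not an independent family, and what can be used is that the drivers are
  independent of the entire sequences of points. Averaging e^(-f) over a driver gives a function of
  the starting point, and its negative logarithm is a new test function for the points. It is
  infinite where the average vanishes, so test functions take values in [0,\<infinity>]; the same
  convention admits \<infinity> times an indicator, which yields void probabilities.

  Time 0 is special in the construction, so invariance shows only in the marginals, where the
  starting times have cancelled and differences of times remain. The survival factors have a common
  origin: by duality the forward kernel preserves e^(-x) dx up to the total mass of the backward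
  kernel, which is e^(-\<open>\<theta>p\<close> t), and conversely. Hence the rate at which the
  backward process is killed is the rate at which forward particles must be born.\<close>

text \<open>\<open>e\<^sup>-\<^sup>x\<close> and \<open>- ln p\<close>, with the values \<open>0\<close> and \<open>\<infinity>\<close> at the ends.\<close>

definition lexp :: "ennreal \<Rightarrow> ennreal" where
  "lexp x = (if x = \<top> then 0 else ennreal (exp (- enn2real x)))"

definition nlog :: "ennreal \<Rightarrow> ennreal" where
  "nlog p = (if p = 0 then \<top> else ennreal (- ln (enn2real p)))"

lemma lexp_0 [simp]: "lexp 0 = 1"
  by (simp add: lexp_def)

lemma lexp_top [simp]: "lexp \<top> = 0"
  by (simp add: lexp_def)

lemma lexp_ennreal: "x \<ge> 0 \<Longrightarrow> lexp (ennreal x) = ennreal (exp (- x))"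
  by (simp add: lexp_def)

lemma lexp_le_1: "lexp x \<le> 1"
  by (simp add: lexp_def)

lemma lexp_add: "lexp (x + y) = lexp x * lexp y"
  by (cases x; cases y)
     (auto simp: lexp_ennreal exp_add exp_diff exp_minus divide_inverse simp flip: ennreal_plus ennreal_mult)

lemma lexp_sum: "finite A \<Longrightarrow> lexp (\<Sum>i\<in>A. f i) = (\<Prod>i\<in>A. lexp (f i))"
  by (induction A rule: finite_induct) (auto simp: lexp_add)

lemma lexp_antimono: "x \<le> y \<Longrightarrow> lexp y \<le> lexp x"
  by (cases x; cases y) (auto simp: lexp_ennreal top_unique)

lemma lexp_measurable [measurable]: "lexp \<in> borel_measurable borel"
  unfolding lexp_def[abs_def] by measurable

lemma nlog_measurable [measurable]: "nlog \<in> borel_measurable borel"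
  unfolding nlog_def[abs_def] by measurable

text \<open>The bound keeps the logarithm from being positive; otherwise \<open>ennreal\<close>
  would truncate its negative to 0.\<close>

lemma lexp_nlog: "p \<le> 1 \<Longrightarrow> lexp (nlog p) = p"
  by (cases p) (auto simp: nlog_def lexp_def ennreal_eq_0_iff top_unique)

lemma lexp_power: "lexp (ennreal c * of_nat k) = ennreal (exp (- c) ^ k)" if "c \<ge> 0"
  using that
  by (auto simp: ennreal_of_nat_eq_real_of_nat lexp_ennreal mult.commute simp flip: ennreal_mult exp_of_nat_mult)

text \<open>Continuity up to and including \<infinity>, where the definition by cases needs a
  separate argument. It lets finite truncations of infinite sums pass to the limit.\<close>

lemma tendsto_lexp:
  assumes f: "(f \<longlongrightarrow> x) F"
  shows "((\<lambda>n. lexp (f n)) \<longlongrightarrow> lexp x) F"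
proof (cases "x = \<top>")
  case False
  have "((\<lambda>n. ennreal (exp (- enn2real (f n)))) \<longlongrightarrow> ennreal (exp (- enn2real x))) F"
    using False by (intro tendsto_ennrealI tendsto_exp tendsto_minus tendsto_enn2real f) (auto simp: less_top f)
  moreover have "\<forall>\<^sub>F n in F. f n < \<top>"
    using order_tendstoD(2)[OF f] False by (auto simp: less_top)
  then have "\<forall>\<^sub>F n in F. ennreal (exp (- enn2real (f n))) = lexp (f n)"
    by eventually_elim (auto simp: lexp_def)
  ultimately show ?thesis
    using False by (auto simp: lexp_def[of x] intro: Lim_transform_eventually)
next
  case True
  show ?thesis unfolding True lexp_top
  proof (rule order_tendstoI)
    fix a :: ennreal assume "0 < a"
    then obtain r where r: "0 < r" "ennreal r < a"
      by (metis dense ennreal_cases ennreal_less_zero_iff less_top_ennreal order_less_irrefl order.strict_trans2 top_greatest)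
    \<comment> \<open>Chosen so that e^(-K) \<le> r; the maximum keeps K nonnegative, as
      \<open>lexp_ennreal\<close> requires.\<close>
    define K where "K = max 0 (- ln r)"
    have "\<forall>\<^sub>F n in F. ennreal K < f n"
      using order_tendstoD(1)[OF f, of "ennreal K"] True by simp
    then show "\<forall>\<^sub>F n in F. lexp (f n) < a"
    proof eventually_elim
      case (elim n)
      have "lexp (f n) \<le> lexp (ennreal K)" using elim by (intro lexp_antimono) simp
      also have "\<dots> = ennreal (exp (- K))" by (rule lexp_ennreal) (simp add: K_def)
      also have "exp (- K) \<le> exp (ln r)" by (simp add: K_def)
      also have "exp (ln r) = r" using r by simp
      finally show ?case using r by (simp add: ennreal_leI order.strict_trans1)
    qed
  qed (simp)
qed

text \<open>At each point at most one indicator is nonzero, so 1 - e^(-f) is linear in the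
  indicators. This turns the Laplace exponent of a simple function into a sum over its level
  sets.\<close>

lemma one_minus_lexp_disjoint:
  assumes "finite J" "disjoint_family_on B J"
  shows "1 - lexp (\<Sum>j\<in>J. c j * indicator (B j) x) = (\<Sum>j\<in>J. (1 - lexp (c j)) * indicator (B j) x)"
proof (cases "\<exists>j\<in>J. x \<in> B j")
  case True
  then obtain i where i: "i \<in> J" "x \<in> B i" by auto
  then have *: "indicator (B j) x = (if j = i then 1 else 0 :: ennreal)" if "j \<in> J" for j
    using assms(2) that by (fastforce simp: disjoint_family_on_def indicator_def)
  show ?thesis using assms(1) i(1)
    by (simp add: * sum.delta if_distrib[of "\<lambda>y. _ * y"] cong: if_cong)
next
  case False
  then have *: "indicator (B j) x = (0 :: ennreal)" if "j \<in> J" for j using that by auto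
  show ?thesis by (simp add: *)
qed

section \<open>Uniqueness of the transforms of count-valued variables\<close>

text \<open>Strong induction: once the coefficients below m vanish, dividing by s^m leaves a power
  series with constant term d m that is 0 on (0,1). It is continuous at 0, so letting s decrease to
  0 gives d m = 0. Bounded coefficients give convergence for |s| < 1.\<close>

lemma powser_unique_01:
  fixes d :: "nat \<Rightarrow> real"
  assumes bd: "\<And>n. \<bar>d n\<bar> \<le> C" and z: "\<And>s. 0 < s \<Longrightarrow> s < 1 \<Longrightarrow> (\<lambda>n. d n * s ^ n) sums 0"
  shows "d m = 0"
proof (induction m rule: less_induct)
  case (less m)
  define e where "e n = d (n + m)" for n
  have bd': "summable (\<lambda>n. e n * s ^ n)" if "\<bar>s\<bar> < 1" for s
  proof (rule summable_comparison_test)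
    show "\<exists>N. \<forall>n\<ge>N. norm (e n * s ^ n) \<le> C * \<bar>s\<bar> ^ n"
      by (auto simp: e_def abs_mult power_abs intro!: mult_mono bd order_trans[OF abs_ge_zero bd])
    show "summable (\<lambda>n. C * \<bar>s\<bar> ^ n)" using that by (intro summable_mult summable_geometric) auto
  qed
  have z': "(\<Sum>n. e n * s ^ n) = 0" if s: "0 < s" "s < 1" for s
  proof -
    have "(\<lambda>n. d (n + m) * s ^ (n + m)) sums (0 - (\<Sum>i<m. d i * s ^ i))"
      using sums_split_initial_segment[OF z[OF s]] by simp
    moreover have "(\<Sum>i<m. d i * s ^ i) = 0" using less by (intro sum.neutral) auto
    ultimately have "(\<lambda>n. (e n * s ^ n) * s ^ m) sums 0" by (simp add: e_def power_add mult.assoc)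
    then have "(\<lambda>n. (e n * s ^ n) * s ^ m / s ^ m) sums (0 / s ^ m)" by (rule sums_divide)
    then show ?thesis using s by (simp add: sums_iff)
  qed
  have "isCont (\<lambda>x. \<Sum>n. e n * x ^ n) 0"
    by (rule isCont_powser[of _ "1/2"]) (auto intro!: bd')
  then have "((\<lambda>x. \<Sum>n. e n * x ^ n) \<longlongrightarrow> (\<Sum>n. e n * 0 ^ n)) (at_right 0)"
    by (auto simp: isCont_def intro: filterlim_mono[OF _ order_refl at_le])
  moreover have "((\<lambda>x. \<Sum>n. e n * x ^ n) \<longlongrightarrow> 0) (at_right (0::real))"
    using z' by (intro tendsto_eventually) (auto simp: eventually_at_right[of 0 "1::real"] intro!: exI[of _ 1])
  ultimately have "(\<Sum>n. e n * 0 ^ n) = 0"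
    by (rule tendsto_unique[rotated]) simp
  then show ?case by (simp add: e_def)
qed

definition count_valued :: "ennreal \<Rightarrow> bool" where
  "count_valued x \<longleftrightarrow> x = \<top> \<or> x \<in> range of_nat"

text \<open>As c > 0, the value \<infinity> gives 0 on the left and matches no term on the right.
  The transform is thus a power series in e^(-c) whose coefficients see the finite values
  only.\<close>

lemma lexp_count_valued:
  assumes "count_valued x" "c > 0"
  shows "lexp (ennreal c * x) = (\<Sum>k. ennreal (exp (- c) ^ k) * indicator {of_nat k} x)"
proof (cases "x = \<top>")
  case True
  then show ?thesis using assms by (simp add: ennreal_mult_top indicator_def)
next
  case False
  then obtain m where m: "x = of_nat m" using assms by (auto simp: count_valued_def)
  have "(\<Sum>k. ennreal (exp (- c) ^ k) * indicator {of_nat k} x) =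
    (\<Sum>k. ennreal (exp (- c) ^ k) * (if k = m then 1 else 0))"
    by (intro arg_cong[of _ _ suminf] ext) (auto simp: m indicator_def)
  also have "\<dots> = (\<Sum>k\<in>{m}. ennreal (exp (- c) ^ k) * (if k = m then 1 else 0))"
    by (rule suminf_finite) auto
  also have "\<dots> = lexp (ennreal c * x)" using assms(2) by (simp add: m lexp_power)
  finally show ?thesis by simp
qed

text \<open>The weight W will hold the remaining coordinates when several counts are treated one at
  a time.\<close>

lemma nn_integral_lexp_count:
  assumes [measurable]: "W \<in> borel_measurable M" "Y \<in> borel_measurable M"
    and Y: "\<And>\<omega>. \<omega> \<in> space M \<Longrightarrow> count_valued (Y \<omega>)" and c: "c > 0"
  shows "(\<integral>\<^sup>+\<omega>. W \<omega> * lexp (ennreal c * Y \<omega>) \<partial>M) =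
    (\<Sum>k. ennreal (exp (- c) ^ k) * (\<integral>\<^sup>+\<omega>. W \<omega> * indicator {of_nat k} (Y \<omega>) \<partial>M))"
proof -
  have "(\<integral>\<^sup>+\<omega>. W \<omega> * lexp (ennreal c * Y \<omega>) \<partial>M) =
    (\<integral>\<^sup>+\<omega>. (\<Sum>k. ennreal (exp (- c) ^ k) * (W \<omega> * indicator {of_nat k} (Y \<omega>))) \<partial>M)"
    by (intro nn_integral_cong) (simp add: lexp_count_valued Y c mult.left_commute flip: ennreal_suminf_cmult)
  also have "\<dots> = (\<Sum>k. \<integral>\<^sup>+\<omega>. ennreal (exp (- c) ^ k) * (W \<omega> * indicator {of_nat k} (Y \<omega>)) \<partial>M)"
    by (intro nn_integral_suminf) measurable
  finally show ?thesis by (simp add: nn_integral_cmult)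
qed

text \<open>With s = e^(-c) both transforms are power series in s on (0,1) with coefficients in
  [0,1], so \<open>powser_unique_01\<close> applies to their difference.\<close>

lemma count_transform_unique:
  assumes "prob_space M1" "prob_space M2"
    and [measurable]: "W1 \<in> borel_measurable M1" "Y1 \<in> borel_measurable M1"
    "W2 \<in> borel_measurable M2" "Y2 \<in> borel_measurable M2"
    and W: "\<And>\<omega>. W1 \<omega> \<le> 1" "\<And>\<omega>. W2 \<omega> \<le> 1"
    and Y: "\<And>\<omega>. \<omega> \<in> space M1 \<Longrightarrow> count_valued (Y1 \<omega>)" "\<And>\<omega>. \<omega> \<in> space M2 \<Longrightarrow> count_valued (Y2 \<omega>)"
    and eq: "\<And>c. c > 0 \<Longrightarrow> (\<integral>\<^sup>+\<omega>. W1 \<omega> * lexp (ennreal c * Y1 \<omega>) \<partial>M1) =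
      (\<integral>\<^sup>+\<omega>. W2 \<omega> * lexp (ennreal c * Y2 \<omega>) \<partial>M2)"
  shows "(\<integral>\<^sup>+\<omega>. W1 \<omega> * indicator {of_nat k} (Y1 \<omega>) \<partial>M1) =
    (\<integral>\<^sup>+\<omega>. W2 \<omega> * indicator {of_nat k} (Y2 \<omega>) \<partial>M2)"
proof -
  interpret M1: prob_space M1 by fact
  interpret M2: prob_space M2 by fact
  define a where "a k = (\<integral>\<^sup>+\<omega>. W1 \<omega> * indicator {of_nat k} (Y1 \<omega>) \<partial>M1)" for k :: nat
  define b where "b k = (\<integral>\<^sup>+\<omega>. W2 \<omega> * indicator {of_nat k} (Y2 \<omega>) \<partial>M2)" for k :: nat
  have "a k \<le> (\<integral>\<^sup>+\<omega>. 1 \<partial>M1)" "b k \<le> (\<integral>\<^sup>+\<omega>. 1 \<partial>M2)" for k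
    using W unfolding a_def b_def by (intro nn_integral_mono; force simp: indicator_def)+
  then have ab1: "a k \<le> 1" "b k \<le> 1" for k
    by (simp_all add: M1.emeasure_space_1 M2.emeasure_space_1)
  define a' b' where "a' k = enn2real (a k)" and "b' k = enn2real (b k)" for k
  have a': "a k = ennreal (a' k)" and b': "b k = ennreal (b' k)" for k
    using ab1[of k] by (auto simp: a'_def b'_def intro!: ennreal_enn2real[symmetric] elim: order.strict_trans1)
  have nn: "a' k \<ge> 0" "a' k \<le> 1" "b' k \<ge> 0" "b' k \<le> 1" for k
    using ab1[of k] by (auto simp: a'_def b'_def enn2real_leI)
  have "a' m - b' m = 0" for m
  proof (rule powser_unique_01[where C=1])
    show "\<bar>a' n - b' n\<bar> \<le> 1" for n using nn[of n] by linarith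
    fix s :: real assume s: "0 < s" "s < 1"
    have sm: "summable (\<lambda>n. a' n * s ^ n)" "summable (\<lambda>n. b' n * s ^ n)"
      using s nn by (auto intro!: summable_comparison_test[of _ "\<lambda>n. s ^ n"] summable_geometric
        exI[of _ 0] mult_left_le_one_le simp: abs_mult power_abs)
    define c where "c = - ln s"
    have c: "c > 0" "exp (- c) = s" using s by (auto simp: c_def)
    have "(\<Sum>k. ennreal (s ^ k) * a k) = (\<Sum>k. ennreal (s ^ k) * b k)"
      using eq[OF c(1)] Y c by (simp add: nn_integral_lexp_count a_def b_def)
    then have "(\<Sum>k. ennreal (a' k * s ^ k)) = (\<Sum>k. ennreal (b' k * s ^ k))"
      using s nn by (simp add: a' b' mult.commute flip: ennreal_mult)
    then have "(\<Sum>k. a' k * s ^ k) = (\<Sum>k. b' k * s ^ k)"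
      using s nn sm by (simp add: suminf_ennreal2 suminf_nonneg)
    then show "(\<lambda>n. (a' n - b' n) * s ^ n) sums 0"
      using sums_diff[OF summable_sums[OF sm(1)] summable_sums[OF sm(2)]]
      by (simp add: algebra_simps)
  qed
  then show ?thesis using a'[of k] b'[of k] by (simp add: a_def b_def)
qed

text \<open>Counts are separated one coordinate at a time. In the mixed statement
  \<open>main\<close> the coordinates in A already appear as indicators of a value, the others still
  as exponentials; a coordinate changes group by \<open>count_transform_unique\<close>, with all
  remaining factors as weight.\<close>

lemma joint_count_unique:
  assumes M: "prob_space M1" "prob_space M2"
    and J: "finite J"
    and Y1 [measurable]: "\<And>j. j \<in> J \<Longrightarrow> Y1 j \<in> borel_measurable M1"
    and Y2 [measurable]: "\<And>j. j \<in> J \<Longrightarrow> Y2 j \<in> borel_measurable M2"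
    and Y: "\<And>j \<omega>. j \<in> J \<Longrightarrow> \<omega> \<in> space M1 \<Longrightarrow> count_valued (Y1 j \<omega>)"
      "\<And>j \<omega>. j \<in> J \<Longrightarrow> \<omega> \<in> space M2 \<Longrightarrow> count_valued (Y2 j \<omega>)"
    and eq: "\<And>c. (\<And>j. j \<in> J \<Longrightarrow> c j > 0) \<Longrightarrow> (\<integral>\<^sup>+\<omega>. lexp (\<Sum>j\<in>J. ennreal (c j) * Y1 j \<omega>) \<partial>M1) =
      (\<integral>\<^sup>+\<omega>. lexp (\<Sum>j\<in>J. ennreal (c j) * Y2 j \<omega>) \<partial>M2)"
  shows "measure M1 {\<omega>\<in>space M1. \<forall>j\<in>J. Y1 j \<omega> = of_nat (k j)} =
    measure M2 {\<omega>\<in>space M2. \<forall>j\<in>J. Y2 j \<omega> = of_nat (k j)}"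
proof -
  have main: "(\<integral>\<^sup>+\<omega>. (\<Prod>j\<in>A. indicator {of_nat (k j)} (Y1 j \<omega>)) * (\<Prod>j\<in>J-A. lexp (ennreal (c j) * Y1 j \<omega>)) \<partial>M1) =
     (\<integral>\<^sup>+\<omega>. (\<Prod>j\<in>A. indicator {of_nat (k j)} (Y2 j \<omega>)) * (\<Prod>j\<in>J-A. lexp (ennreal (c j) * Y2 j \<omega>)) \<partial>M2)"
    if "finite A" "A \<subseteq> J" and c: "\<And>j. j \<in> J \<Longrightarrow> c j > 0" for A c
    using that
  proof (induction A arbitrary: c rule: finite_induct)
    case empty
    then show ?case using eq[of c] J by (simp add: lexp_sum)
  next
    case (insert a A)
    have a: "a \<in> J" "a \<notin> A" and A: "A \<subseteq> J" using insert by auto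
    define W1 where "W1 \<omega> = (\<Prod>j\<in>A. indicator {of_nat (k j)} (Y1 j \<omega>)) * (\<Prod>j\<in>J - insert a A. lexp (ennreal (c j) * Y1 j \<omega>))" for \<omega>
    define W2 where "W2 \<omega> = (\<Prod>j\<in>A. indicator {of_nat (k j)} (Y2 j \<omega>)) * (\<Prod>j\<in>J - insert a A. lexp (ennreal (c j) * Y2 j \<omega>))" for \<omega>
    have mA: "j \<in> J" if "j \<in> A" for j using that A by auto
    have [measurable]: "W1 \<in> borel_measurable M1" "W2 \<in> borel_measurable M2"
      unfolding W1_def[abs_def] W2_def[abs_def]
      by (intro borel_measurable_times_ennreal borel_measurable_prod_ennreal
          measurable_compose[OF _ lexp_measurable] borel_measurable_const
          measurable_compose[OF Y1 borel_measurable_indicator]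
          measurable_compose[OF Y2 borel_measurable_indicator]; use Y1 Y2 mA in auto)+
    have W1: "W1 \<omega> \<le> 1" and W2: "W2 \<omega>' \<le> 1" for \<omega> \<omega>'
      unfolding W1_def W2_def
      by (intro mult_le_one prod_le_1; auto simp: lexp_le_1 indicator_def)+
    have step: "(\<integral>\<^sup>+\<omega>. W1 \<omega> * lexp (ennreal c0 * Y1 a \<omega>) \<partial>M1) = (\<integral>\<^sup>+\<omega>. W2 \<omega> * lexp (ennreal c0 * Y2 a \<omega>) \<partial>M2)"
      if "c0 > 0" for c0
    proof -
      have J': "J - A = insert a (J - insert a A)" using a by auto
      have "(\<Prod>j\<in>J - insert a A. lexp (ennreal ((c(a := c0)) j) * Z j)) = (\<Prod>j\<in>J - insert a A. lexp (ennreal (c j) * Z j))" for Z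
        by (intro prod.cong) auto
      then have *: "(\<Prod>j\<in>J - A. lexp (ennreal ((c(a := c0)) j) * Z j)) =
          lexp (ennreal c0 * Z a) * (\<Prod>j\<in>J - insert a A. lexp (ennreal (c j) * Z j))" for Z
        unfolding J' using J by (subst prod.insert) auto
      \<comment> \<open>The other parameters stay fixed while c0 runs through all positive reals;
        this is why the induction is general in c.\<close>
      have "0 < (c(a := c0)) j" if "j \<in> J" for j using insert.prems that \<open>c0 > 0\<close> by auto
      note insert.IH[OF A, where c="c(a := c0)", OF this, unfolded *]
      then show ?thesis
        unfolding W1_def W2_def by (simp only: mult.assoc mult.commute[of "lexp _"] mult.left_commute[of "lexp _"])
    qed
    have "(\<integral>\<^sup>+\<omega>. W1 \<omega> * indicator {of_nat (k a)} (Y1 a \<omega>) \<partial>M1) = (\<integral>\<^sup>+\<omega>. W2 \<omega> * indicator {of_nat (k a)} (Y2 a \<omega>) \<partial>M2)"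
      by (rule count_transform_unique) (use M a W1 W2 Y step in auto)
    then show ?case
      using insert.hyps by (simp add: W1_def W2_def mult_ac)
  qed
  have e: "(\<integral>\<^sup>+\<omega>. (\<Prod>j\<in>J. indicator {of_nat (k j)} (Z j \<omega>)) \<partial>M) = emeasure M {\<omega>\<in>space M. \<forall>j\<in>J. Z j \<omega> = of_nat (k j)}"
    if [measurable]: "\<And>j. j \<in> J \<Longrightarrow> Z j \<in> borel_measurable M" for M :: "'z measure" and Z :: "_ \<Rightarrow> _ \<Rightarrow> ennreal"
  proof -
    have [measurable]: "{\<omega>\<in>space M. \<forall>j\<in>J. Z j \<omega> = of_nat (k j)} \<in> sets M"
      using J by measurable
    have "(\<integral>\<^sup>+\<omega>. (\<Prod>j\<in>J. indicator {of_nat (k j)} (Z j \<omega>)) \<partial>M) =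
      (\<integral>\<^sup>+\<omega>. indicator {\<omega>\<in>space M. \<forall>j\<in>J. Z j \<omega> = of_nat (k j)} \<omega> \<partial>M)"
      using J by (intro nn_integral_cong) (auto simp: indicator_def prod_zero_iff intro!: prod_zero)
    then show ?thesis by simp
  qed
  show ?thesis
    using main[of J "\<lambda>_. 1"] J e[OF Y1] e[OF Y2] by (simp add: measure_def)
qed

section \<open>Laplace functionals of point processes\<close>

text \<open>The test functions may take the value \<infinity>; for f equal to \<infinity> on a set
  and 0 off it, the identity is a void probability.\<close>

definition laplace_functional :: "'w measure \<Rightarrow> 's measure \<Rightarrow> ('w \<Rightarrow> 's measure) \<Rightarrow> bool" where
  "laplace_functional \<Omega> \<mu> N \<longleftrightarrow> (\<forall>f\<in>borel_measurable \<mu>.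
     (\<integral>\<^sup>+\<omega>. lexp (\<integral>\<^sup>+x. f x \<partial>N \<omega>) \<partial>\<Omega>) = lexp (\<integral>\<^sup>+x. 1 - lexp (f x) \<partial>\<mu>))"

text \<open>For a set of infinite intensity, \<open>poisson_point_process\<close> says that each
  finite count has probability 0; being count-valued turns this into the count \<infinity>.\<close>

definition counting :: "'w measure \<Rightarrow> 's measure \<Rightarrow> ('w \<Rightarrow> 's measure) \<Rightarrow> bool" where
  "counting \<Omega> \<mu> N \<longleftrightarrow> (\<forall>\<omega>\<in>space \<Omega>. \<forall>B\<in>sets \<mu>. count_valued (emeasure (N \<omega>) B))"

lemma space_measure_algebra: "space (measure_algebra S) = {\<nu>. sets \<nu> = sets S}"
  by (auto simp: measure_algebra_def space_Sup_eq_UN)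

lemma measure_algebra_cong: "sets S = sets T \<Longrightarrow> measure_algebra S = measure_algebra T"
  by (simp add: measure_algebra_def)

lemma measurable_measure_algebraI:
  assumes "\<And>\<omega>. \<omega> \<in> space \<Omega> \<Longrightarrow> sets (N \<omega>) = sets S"
    and "\<And>B. B \<in> sets S \<Longrightarrow> (\<lambda>\<omega>. emeasure (N \<omega>) B) \<in> borel_measurable \<Omega>"
  shows "N \<in> \<Omega> \<rightarrow>\<^sub>M measure_algebra S"
  unfolding measure_algebra_def
  by (intro measurable_SUP2 measurable_vimage_algebra2) (use assms in auto)

text \<open>All the algebras in the supremum have the same carrier, so the supremum is generated by
  the union of their sets, among which are the preimages under this evaluation.\<close>

lemma emeasure_measurable_measure_algebra:
  assumes B: "B \<in> sets S"
  shows "(\<lambda>\<nu>. emeasure \<nu> B) \<in> borel_measurable (measure_algebra S)"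
proof (rule measurableI)
  fix A :: "ennreal set" assume A: "A \<in> sets borel"
  let ?V = "\<lambda>B. vimage_algebra {\<nu>. sets \<nu> = sets S} (\<lambda>\<nu>. emeasure \<nu> B) borel"
  have *: "sets (measure_algebra S) = sigma_sets {\<nu>. sets \<nu> = sets S} (\<Union>B\<in>sets S. sets (?V B))"
    unfolding measure_algebra_def by (subst sets_Sup_eq[where X="{\<nu>. sets \<nu> = sets S}"]) auto
  have "(\<lambda>\<nu>. emeasure \<nu> B) -` A \<inter> {\<nu>. sets \<nu> = sets S} \<in> sets (?V B)"
    using A by (rule in_vimage_algebra)
  then show "(\<lambda>\<nu>. emeasure \<nu> B) -` A \<inter> space (measure_algebra S) \<in> sets (measure_algebra S)"
    using B unfolding * space_measure_algebra by (intro sigma_sets.Basic) auto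
qed auto

lemma measure_algebra_sets_eq:
  "N \<in> \<Omega> \<rightarrow>\<^sub>M measure_algebra S \<Longrightarrow> \<omega> \<in> space \<Omega> \<Longrightarrow> sets (N \<omega>) = sets S"
  using measurable_space[of N \<Omega> "measure_algebra S" \<omega>] by (simp add: space_measure_algebra)

lemma measurable_emeasure_point_process:
  "N \<in> \<Omega> \<rightarrow>\<^sub>M measure_algebra S \<Longrightarrow> B \<in> sets S \<Longrightarrow> (\<lambda>\<omega>. emeasure (N \<omega>) B) \<in> borel_measurable \<Omega>"
  by (rule measurable_compose[OF _ emeasure_measurable_measure_algebra])

lemma borel_measurable_point_process:
  "N \<in> \<Omega> \<rightarrow>\<^sub>M measure_algebra S \<Longrightarrow> \<omega> \<in> space \<Omega> \<Longrightarrow> f \<in> S \<rightarrow>\<^sub>M T \<Longrightarrow> f \<in> N \<omega> \<rightarrow>\<^sub>M T"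
  by (subst measurable_cong_sets[OF measure_algebra_sets_eq refl])

lemma measurable_nn_integral_point_process:
  assumes N: "N \<in> \<Omega> \<rightarrow>\<^sub>M measure_algebra S" and f: "f \<in> borel_measurable S"
  shows "(\<lambda>\<omega>. \<integral>\<^sup>+x. f x \<partial>N \<omega>) \<in> borel_measurable \<Omega>"
  using f
proof induction
  case (cong f g)
  have "(\<integral>\<^sup>+x. f x \<partial>N \<omega>) = (\<integral>\<^sup>+x. g x \<partial>N \<omega>)" if "\<omega> \<in> space \<Omega>" for \<omega>
    using cong sets_eq_imp_space_eq[OF measure_algebra_sets_eq[OF N that]] by (intro nn_integral_cong) auto
  then show ?case using cong by (simp cong: measurable_cong)
next
  case (set A)
  then have "(\<integral>\<^sup>+x. indicator A x \<partial>N \<omega>) = emeasure (N \<omega>) A" if "\<omega> \<in> space \<Omega>" for \<omega>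
    using measure_algebra_sets_eq[OF N that] by simp
  then show ?case using set measurable_emeasure_point_process[OF N] by (simp cong: measurable_cong)
next
  case (mult u c)
  then have "(\<integral>\<^sup>+x. c * u x \<partial>N \<omega>) = c * (\<integral>\<^sup>+x. u x \<partial>N \<omega>)" if "\<omega> \<in> space \<Omega>" for \<omega>
    by (intro nn_integral_cmult borel_measurable_point_process[OF N that])
  then show ?case using mult by (simp cong: measurable_cong)
next
  case (add u v)
  then have "(\<integral>\<^sup>+x. v x + u x \<partial>N \<omega>) = (\<integral>\<^sup>+x. v x \<partial>N \<omega>) + (\<integral>\<^sup>+x. u x \<partial>N \<omega>)" if "\<omega> \<in> space \<Omega>" for \<omega>
    by (intro nn_integral_add borel_measurable_point_process[OF N that])
  then show ?case using add by (simp cong: measurable_cong)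
next
  case (seq U)
  have "(\<integral>\<^sup>+x. (SUP i. U i) x \<partial>N \<omega>) = (SUP i. \<integral>\<^sup>+x. U i x \<partial>N \<omega>)" if "\<omega> \<in> space \<Omega>" for \<omega>
    unfolding SUP_apply
    using seq by (intro nn_integral_monotone_convergence_SUP borel_measurable_point_process[OF N that])
  then show ?case using seq by (simp cong: measurable_cong)
qed

lemma nn_integral_simple_point_process:
  assumes "sets \<nu> = sets \<mu>" "\<And>j. j \<in> J \<Longrightarrow> B j \<in> sets \<mu>"
  shows "(\<integral>\<^sup>+x. (\<Sum>j\<in>J. c j * indicator (B j) x) \<partial>\<nu>) = (\<Sum>j\<in>J. c j * emeasure \<nu> (B j))"
  using assms by (subst nn_integral_sum) (auto simp: nn_integral_cmult_indicator)

section \<open>From Poisson counts to the Laplace functional\<close>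

text \<open>The exponential series at r e^(-c). If the mean is infinite both sides are 0, since 1 -
  e^(-c) is positive.\<close>

lemma poisson_lexp:
  assumes M: "prob_space M" and [measurable]: "Y \<in> borel_measurable M"
    and Y: "\<And>\<omega>. \<omega> \<in> space M \<Longrightarrow> count_valued (Y \<omega>)"
    and P: "\<And>k::nat. measure M {\<omega>\<in>space M. Y \<omega> = of_nat k} =
        (if l = \<infinity> then 0 else exp (- enn2real l) * enn2real l ^ k / fact k)"
    and c: "c > 0"
  shows "(\<integral>\<^sup>+\<omega>. lexp (ennreal c * Y \<omega>) \<partial>M) = lexp ((1 - lexp (ennreal c)) * l)"
proof -
  interpret prob_space M by fact
  have ind: "(\<integral>\<^sup>+\<omega>. indicator {of_nat k} (Y \<omega>) \<partial>M) = ennreal (if l = \<infinity> then 0 else exp (- enn2real l) * enn2real l ^ k / fact k)" for k :: nat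
  proof -
    have "(\<integral>\<^sup>+\<omega>. indicator {of_nat k} (Y \<omega>) \<partial>M) = (\<integral>\<^sup>+\<omega>. indicator {\<omega>\<in>space M. Y \<omega> = of_nat k} \<omega> \<partial>M)"
      by (intro nn_integral_cong) (auto simp: indicator_def)
    also have "\<dots> = emeasure M {\<omega>\<in>space M. Y \<omega> = of_nat k}" by simp
    finally show ?thesis by (simp only: emeasure_eq_measure P)
  qed
  have c1: "1 - lexp (ennreal c) = ennreal (1 - exp (- c))" "1 - exp (- c) > 0"
    using c by (auto simp: lexp_ennreal ennreal_minus simp flip: ennreal_1)
  have "(\<integral>\<^sup>+\<omega>. lexp (ennreal c * Y \<omega>) \<partial>M) = (\<Sum>k. ennreal (exp (- c) ^ k) * ennreal (if l = \<infinity> then 0 else exp (- enn2real l) * enn2real l ^ k / fact k))"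
    using nn_integral_lexp_count[of "\<lambda>_. 1" M Y c] Y c by (simp add: ind)
  also have "\<dots> = lexp ((1 - lexp (ennreal c)) * l)"
  proof (cases l)
    case top
    then show ?thesis using c1 by (simp add: ennreal_mult_top)
  next
    case (real r)
    have "(\<lambda>k. exp (- r) * ((r * exp (- c)) ^ k /\<^sub>R fact k)) sums (exp (- r) * exp (r * exp (- c)))"
      by (intro sums_mult exp_converges)
    then have s: "(\<lambda>k. exp (- c) ^ k * (exp (- r) * r ^ k / fact k)) sums (exp (- ((1 - exp (- c)) * r)))"
      by (simp add: power_mult_distrib field_simps scaleR_conv_of_real flip: exp_add)
    have "(\<Sum>k. ennreal (exp (- c) ^ k * (exp (- r) * r ^ k / fact k))) = ennreal (exp (- ((1 - exp (- c)) * r)))"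
      using real s by (intro suminf_ennreal_eq) auto
    then show ?thesis
      using real c1 by (simp add: lexp_ennreal flip: ennreal_mult)
  qed
  finally show ?thesis .
qed

text \<open>For infinite mean all finite values have probability 0, so the variable is almost surely
  \<infinity>. For finite mean the finite values exhaust the probability, and the expectation is the
  Poisson series.\<close>

lemma poisson_mean:
  assumes M: "prob_space M" and [measurable]: "Y \<in> borel_measurable M"
    and Y: "\<And>\<omega>. \<omega> \<in> space M \<Longrightarrow> count_valued (Y \<omega>)"
    and P: "\<And>k::nat. measure M {\<omega>\<in>space M. Y \<omega> = of_nat k} =
        (if l = \<infinity> then 0 else exp (- enn2real l) * enn2real l ^ k / fact k)"
  shows "(\<integral>\<^sup>+\<omega>. Y \<omega> \<partial>M) = l"
proof -
  interpret prob_space M by fact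
  have em: "emeasure M {\<omega>\<in>space M. Y \<omega> = of_nat k} = ennreal (if l = \<infinity> then 0 else exp (- enn2real l) * enn2real l ^ k / fact k)" for k :: nat
    by (simp only: emeasure_eq_measure P)
  have split: "emeasure M (space M) = emeasure M {\<omega>\<in>space M. Y \<omega> = \<top>} + (\<Sum>k. emeasure M {\<omega>\<in>space M. Y \<omega> = of_nat k})"
  proof -
    have "(\<Sum>k. emeasure M {\<omega>\<in>space M. Y \<omega> = of_nat k}) = emeasure M (\<Union>k. {\<omega>\<in>space M. Y \<omega> = of_nat k})"
      by (intro suminf_emeasure) (auto simp: disjoint_family_on_def)
    moreover have "space M = {\<omega>\<in>space M. Y \<omega> = \<top>} \<union> (\<Union>k. {\<omega>\<in>space M. Y \<omega> = of_nat k})"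
      using Y by (auto simp: count_valued_def)
    moreover have "emeasure M ({\<omega>\<in>space M. Y \<omega> = \<top>} \<union> (\<Union>k. {\<omega>\<in>space M. Y \<omega> = of_nat k})) =
      emeasure M {\<omega>\<in>space M. Y \<omega> = \<top>} + emeasure M (\<Union>k. {\<omega>\<in>space M. Y \<omega> = of_nat k})"
      by (intro plus_emeasure[symmetric]) auto
    ultimately show ?thesis by simp
  qed
  show ?thesis
  proof (cases l)
    case top
    then have "emeasure M {\<omega>\<in>space M. Y \<omega> = \<top>} = 1"
      using split by (simp add: em emeasure_space_1)
    moreover have "(\<integral>\<^sup>+\<omega>. \<top> * indicator {\<omega>\<in>space M. Y \<omega> = \<top>} \<omega> \<partial>M) \<le> (\<integral>\<^sup>+\<omega>. Y \<omega> \<partial>M)"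
      by (intro nn_integral_mono) (auto simp: indicator_def)
    ultimately show ?thesis using top by (simp add: nn_integral_cmult_indicator top_unique)
  next
    case (real r)
    have s0: "(\<lambda>k. exp (- r) * (r ^ k /\<^sub>R fact k)) sums (exp (- r) * exp r)"
      by (intro sums_mult exp_converges)
    then have s1: "(\<lambda>k. exp (- r) * r ^ k / fact k) sums 1"
      by (simp add: field_simps scaleR_conv_of_real flip: exp_add)
    have em': "emeasure M {\<omega>\<in>space M. Y \<omega> = of_nat k} = ennreal (exp (- r) * r ^ k / fact k)" for k
      using em[of k] real by simp
    have "(\<Sum>k. emeasure M {\<omega>\<in>space M. Y \<omega> = of_nat k}) = ennreal 1"
      unfolding em' using real by (intro suminf_ennreal_eq s1) auto
    then have "emeasure M {\<omega>\<in>space M. Y \<omega> = \<top>} + 1 = 0 + 1"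
      using split by (simp add: emeasure_space_1)
    then have "emeasure M {\<omega>\<in>space M. Y \<omega> = \<top>} = 0"
      by (metis ennreal_add_diff_cancel_right ennreal_one_neq_top infinity_ennreal_def)
    then have "AE \<omega> in M. Y \<omega> \<noteq> \<top>"
      by (subst AE_iff_measurable[of "{\<omega>\<in>space M. Y \<omega> = \<top>}"]) auto
    then have "AE \<omega> in M. Y \<omega> = (\<Sum>k. of_nat k * indicator {\<omega>\<in>space M. Y \<omega> = of_nat k} \<omega>)"
      using AE_space
    proof eventually_elim
      case (elim \<omega>)
      then obtain m where m: "Y \<omega> = of_nat m" using Y[of \<omega>] by (auto simp: count_valued_def)
      have "(\<Sum>k. of_nat k * indicator {\<omega>\<in>space M. Y \<omega> = of_nat k} \<omega>) =
        (\<Sum>k\<in>{m}. of_nat k * indicator {\<omega>\<in>space M. Y \<omega> = of_nat k} \<omega> :: ennreal)"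
        by (rule suminf_finite) (auto simp: m indicator_def)
      then show ?case using elim m by simp
    qed
    then have "(\<integral>\<^sup>+\<omega>. Y \<omega> \<partial>M) = (\<integral>\<^sup>+\<omega>. (\<Sum>k. of_nat k * indicator {\<omega>\<in>space M. Y \<omega> = of_nat k} \<omega>) \<partial>M)"
      by (rule nn_integral_cong_AE)
    also have "\<dots> = (\<Sum>k. of_nat k * emeasure M {\<omega>\<in>space M. Y \<omega> = of_nat k})"
      by (subst nn_integral_suminf) (auto simp: nn_integral_cmult_indicator)
    also have "\<dots> = (\<Sum>k. ennreal (of_nat k * (exp (- r) * r ^ k / fact k)))"
      unfolding em' using real by (intro arg_cong[of _ _ suminf] ext) (simp add: ennreal_of_nat_eq_real_of_nat flip: ennreal_mult)
    also have "\<dots> = ennreal r"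
    proof (rule suminf_ennreal_eq)
      have "(\<lambda>k. r * (exp (- r) * r ^ k / fact k)) sums (r * 1)"
        by (intro sums_mult s1)
      \<comment> \<open>r times the k-th Poisson weight is k + 1 times the next one; after this
        shift of the index only the term at 0 is missing from the series of the mean, and it
        vanishes.\<close>
      moreover have "r * (exp (- r) * r ^ k / fact k) = of_nat (Suc k) * (exp (- r) * r ^ Suc k / fact (Suc k))" for k
        unfolding fact_Suc[of k] by (simp add: divide_simps del: of_nat_Suc fact_Suc)
      ultimately have "(\<lambda>k. of_nat (Suc k) * (exp (- r) * r ^ Suc k / fact (Suc k))) sums r" by (simp only: mult_1_right)
      then show "(\<lambda>k. of_nat k * (exp (- r) * r ^ k / fact k)) sums r"
        by (subst (asm) sums_Suc_iff) simp
    qed (use real in auto)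
    finally show ?thesis using real by simp
  qed
qed

lemma poisson_point_processD:
  assumes "poisson_point_process \<Omega> \<mu> N"
  shows "sigma_finite_measure \<mu>" "N \<in> \<Omega> \<rightarrow>\<^sub>M measure_algebra \<mu>"
    "B \<in> sets \<mu> \<Longrightarrow> measure \<Omega> {\<omega>\<in>space \<Omega>. emeasure (N \<omega>) B = of_nat k} =
        (if emeasure \<mu> B = \<infinity> then 0
         else exp (- enn2real (emeasure \<mu> B)) * enn2real (emeasure \<mu> B) ^ k / fact k)"
    "\<lbrakk>\<And>j. j < n \<Longrightarrow> B' j \<in> sets \<mu>; disjoint_family_on B' {..<n::nat}\<rbrakk> \<Longrightarrow>
        prob_space.indep_vars \<Omega> (\<lambda>_. borel) (\<lambda>j \<omega>. emeasure (N \<omega>) (B' j)) {..<n}"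
  using assms unfolding poisson_point_process_def measure_def by auto

lemma poisson_mean_measure:
  assumes "prob_space \<Omega>" "poisson_point_process \<Omega> \<mu> N" "counting \<Omega> \<mu> N" "B \<in> sets \<mu>"
  shows "(\<integral>\<^sup>+\<omega>. emeasure (N \<omega>) B \<partial>\<Omega>) = emeasure \<mu> B"
  using assms poisson_point_processD[OF assms(2)]
  by (intro poisson_mean measurable_emeasure_point_process[of N \<Omega> \<mu>]) (auto simp: counting_def)

text \<open>The level sets of f are disjoint, so their counts are independent Poisson variables and
  the transform factorises.\<close>

lemma poisson_imp_laplace_simple:
  assumes \<Omega>: "prob_space \<Omega>" and N: "poisson_point_process \<Omega> \<mu> N" and cnt: "counting \<Omega> \<mu> N"
    and f: "simple_function \<mu> f" "\<And>x. f x < \<top>"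
  shows "(\<integral>\<^sup>+\<omega>. lexp (\<integral>\<^sup>+x. f x \<partial>N \<omega>) \<partial>\<Omega>) = lexp (\<integral>\<^sup>+x. 1 - lexp (f x) \<partial>\<mu>)"
proof -
  interpret prob_space \<Omega> by fact
  note D = poisson_point_processD[OF N]
  \<comment> \<open>The value 0 contributes nothing to the integral and is left out, because
    transforms of single counts are available for positive parameters.\<close>
  define Y where "Y = f ` space \<mu> - {0}"
  have "finite Y" using f by (auto simp: Y_def simple_function_def)
  then obtain y where y: "bij_betw y {0..<card Y} Y" using ex_bij_betw_nat_finite by blast
  define n where "n = card Y"
  define B where "B j = f -` {y j} \<inter> space \<mu>" for j
  have inj: "inj_on y {..<n}" and im: "y ` {..<n} = Y"
    using y by (auto simp: bij_betw_def n_def lessThan_atLeast0)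
  have B: "B j \<in> sets \<mu>" if "j < n" for j
    unfolding B_def by (rule simple_functionD(2)[OF f(1)])
  have dis: "disjoint_family_on B {..<n}"
    using inj by (auto simp: disjoint_family_on_def B_def inj_on_def)
  have yY: "y j \<in> Y" if "j < n" for j using im that by auto
  then have ynz: "y j \<noteq> 0" "y j < \<top>" if "j < n" for j using that f(2) by (force simp: Y_def)+
  define c where "c j = enn2real (y j)" for j
  have c: "y j = ennreal (c j)" "c j > 0" if "j < n" for j
    using ynz[OF that] by (auto simp: c_def enn2real_positive_iff zero_less_iff_neq_zero)
  have feq: "f x = (\<Sum>j<n. ennreal (c j) * indicator (B j) x)" if x: "x \<in> space \<mu>" for x
  proof (cases "f x = 0")
    case True
    then have "\<forall>j<n. x \<notin> B j" using ynz(1) by (auto simp: B_def)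
    then show ?thesis using True by (simp add: indicator_def)
  next
    case False
    then have "f x \<in> Y" using x by (auto simp: Y_def)
    then obtain i where i: "i < n" "f x = y i" using im by auto
    have "indicator (B j) x = (if j = i then 1 else 0 :: ennreal)" if "j < n" for j
      using inj i that x by (auto simp: B_def indicator_def inj_on_def)
    then have "(\<Sum>j<n. ennreal (c j) * indicator (B j) x) = (\<Sum>j<n. if j = i then ennreal (c j) else 0)"
      by (intro sum.cong) auto
    then show ?thesis using i c by simp
  qed
  have "(\<integral>\<^sup>+\<omega>. lexp (\<integral>\<^sup>+x. f x \<partial>N \<omega>) \<partial>\<Omega>) = (\<integral>\<^sup>+\<omega>. (\<Prod>j<n. lexp (ennreal (c j) * emeasure (N \<omega>) (B j))) \<partial>\<Omega>)"
  proof (rule nn_integral_cong)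
    fix \<omega> assume "\<omega> \<in> space \<Omega>"
    then have sN: "sets (N \<omega>) = sets \<mu>" by (rule measure_algebra_sets_eq[OF D(2)])
    have "(\<integral>\<^sup>+x. f x \<partial>N \<omega>) = (\<integral>\<^sup>+x. (\<Sum>j<n. ennreal (c j) * indicator (B j) x) \<partial>N \<omega>)"
      using feq sets_eq_imp_space_eq[OF sN] by (intro nn_integral_cong) auto
    also have "\<dots> = (\<Sum>j<n. ennreal (c j) * emeasure (N \<omega>) (B j))"
      using sN B by (intro nn_integral_simple_point_process) auto
    finally show "lexp (\<integral>\<^sup>+x. f x \<partial>N \<omega>) = (\<Prod>j<n. lexp (ennreal (c j) * emeasure (N \<omega>) (B j)))"
      by (simp add: lexp_sum)
  qed
  also have "\<dots> = (\<Prod>j<n. \<integral>\<^sup>+\<omega>. lexp (ennreal (c j) * emeasure (N \<omega>) (B j)) \<partial>\<Omega>)"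
    by (intro indep_vars_nn_integral indep_vars_compose2[OF D(4)[of n B]]) (use B dis in auto)
  also have "\<dots> = (\<Prod>j<n. lexp ((1 - lexp (ennreal (c j))) * emeasure \<mu> (B j)))"
    using B c cnt D(3)
    by (intro prod.cong refl poisson_lexp measurable_emeasure_point_process[OF D(2)] \<Omega>) (auto simp: counting_def)
  also have "\<dots> = lexp (\<integral>\<^sup>+x. (\<Sum>j<n. (1 - lexp (ennreal (c j))) * indicator (B j) x) \<partial>\<mu>)"
    using B by (subst nn_integral_simple_point_process) (auto simp: lexp_sum)
  also have "(\<integral>\<^sup>+x. (\<Sum>j<n. (1 - lexp (ennreal (c j))) * indicator (B j) x) \<partial>\<mu>) = (\<integral>\<^sup>+x. 1 - lexp (f x) \<partial>\<mu>)"
    by (intro nn_integral_cong) (simp only: feq one_minus_lexp_disjoint[OF finite_lessThan dis])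
  finally show ?thesis .
qed

text \<open>The bound by 1 makes dominated convergence applicable even where the limit is
  \<infinity>.\<close>

lemma (in prob_space) tendsto_nn_integral_lexp:
  assumes [measurable]: "\<And>i. F i \<in> borel_measurable M"
    and lim: "\<And>\<omega>. \<omega> \<in> space M \<Longrightarrow> (\<lambda>i. F i \<omega>) \<longlonglongrightarrow> G \<omega>"
  shows "(\<lambda>i. \<integral>\<^sup>+\<omega>. lexp (F i \<omega>) \<partial>M) \<longlonglongrightarrow> (\<integral>\<^sup>+\<omega>. lexp (G \<omega>) \<partial>M)"
proof (rule nn_integral_dominated_convergence[where w="\<lambda>_. 1"])
  have [measurable]: "G \<in> borel_measurable M"
    by (rule borel_measurable_LIMSEQ_order[OF lim]) auto
  show "(\<lambda>\<omega>. lexp (G \<omega>)) \<in> borel_measurable M" by measurable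
  show "AE x in M. (\<lambda>i. lexp (F i x)) \<longlonglongrightarrow> lexp (G x)"
    using lim by (intro AE_I2 tendsto_lexp)
qed (auto simp: lexp_le_1 emeasure_space_1)

text \<open>Finite-valued simple functions increase to f. On the left \<open>lexp\<close> is
  bounded; on the right 1 - e^(-f) increases with f, so the convergence is monotone although \<mu>
  may be infinite.\<close>

lemma poisson_imp_laplace:
  assumes \<Omega>: "prob_space \<Omega>" and N: "poisson_point_process \<Omega> \<mu> N" and cnt: "counting \<Omega> \<mu> N"
  shows "laplace_functional \<Omega> \<mu> N"
  unfolding laplace_functional_def
proof
  fix f :: "_ \<Rightarrow> ennreal" assume f[measurable]: "f \<in> borel_measurable \<mu>"
  interpret prob_space \<Omega> by fact
  note D = poisson_point_processD[OF N]
  obtain F where F: "\<And>i. simple_function \<mu> (F i)" "incseq F" "\<And>i x. F i x < \<top>" "\<And>x. (SUP i. F i x) = f x"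
    using borel_measurable_implies_simple_function_sequence'[OF f] by blast
  have Fm[measurable]: "F i \<in> borel_measurable \<mu>" for i
    using F(1) by (rule borel_measurable_simple_function)
  have inc: "incseq (\<lambda>i. F i x)" for x using F(2) by (auto simp: incseq_def le_fun_def)
  have lim: "(\<lambda>i. F i x) \<longlonglongrightarrow> f x" for x
    using LIMSEQ_SUP[OF inc[of x]] F(4)[of x] by simp
  have "(\<lambda>i. \<integral>\<^sup>+\<omega>. lexp (\<integral>\<^sup>+x. F i x \<partial>N \<omega>) \<partial>\<Omega>) \<longlonglongrightarrow> (\<integral>\<^sup>+\<omega>. lexp (\<integral>\<^sup>+x. f x \<partial>N \<omega>) \<partial>\<Omega>)"
  proof (rule tendsto_nn_integral_lexp)
    fix \<omega> assume w: "\<omega> \<in> space \<Omega>"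
    show "(\<lambda>i. \<integral>\<^sup>+x. F i x \<partial>N \<omega>) \<longlonglongrightarrow> (\<integral>\<^sup>+x. f x \<partial>N \<omega>)"
      by (intro nn_integral_LIMSEQ F(2) lim borel_measurable_point_process[OF D(2) w] Fm)
  qed (rule measurable_nn_integral_point_process[OF D(2) Fm])
  moreover have "(\<lambda>i. \<integral>\<^sup>+\<omega>. lexp (\<integral>\<^sup>+x. F i x \<partial>N \<omega>) \<partial>\<Omega>) \<longlonglongrightarrow> lexp (\<integral>\<^sup>+x. 1 - lexp (f x) \<partial>\<mu>)"
  proof (simp only: poisson_imp_laplace_simple[OF \<Omega> N cnt F(1) F(3)], intro tendsto_lexp nn_integral_LIMSEQ)
    show "incseq (\<lambda>i x. 1 - lexp (F i x))"
      using inc by (auto simp: incseq_def le_fun_def intro!: ennreal_minus_mono lexp_antimono)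
    show "(\<lambda>i. 1 - lexp (F i x)) \<longlonglongrightarrow> 1 - lexp (f x)" for x
      by (intro tendsto_diff_ennreal_general tendsto_lexp lim tendsto_const) auto
  qed measurable
  ultimately show "(\<integral>\<^sup>+\<omega>. lexp (\<integral>\<^sup>+x. f x \<partial>N \<omega>) \<partial>\<Omega>) = lexp (\<integral>\<^sup>+x. 1 - lexp (f x) \<partial>\<mu>)"
    by (rule LIMSEQ_unique)
qed

section \<open>From the Laplace functional back to the law\<close>

text \<open>A combination of the indicators of the B p is a legitimate test function even if the
  sets overlap, so the functional controls the counts on arbitrary finite families.\<close>

lemma counting_joint_unique:
  assumes \<Omega>: "prob_space \<Omega>1" "prob_space \<Omega>2"
    and N: "N1 \<in> \<Omega>1 \<rightarrow>\<^sub>M measure_algebra \<mu>" "N2 \<in> \<Omega>2 \<rightarrow>\<^sub>M measure_algebra \<mu>"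
    and cnt: "counting \<Omega>1 \<mu> N1" "counting \<Omega>2 \<mu> N2"
    and L: "laplace_functional \<Omega>1 \<mu> N1" "laplace_functional \<Omega>2 \<mu> N2"
    and F: "finite F" "\<And>p. p \<in> F \<Longrightarrow> B p \<in> sets \<mu>"
  shows "measure \<Omega>1 {\<omega>\<in>space \<Omega>1. \<forall>p\<in>F. emeasure (N1 \<omega>) (B p) = of_nat (k p)} =
    measure \<Omega>2 {\<omega>\<in>space \<Omega>2. \<forall>p\<in>F. emeasure (N2 \<omega>) (B p) = of_nat (k p)}"
proof (rule joint_count_unique[OF \<Omega> F(1)])
  fix c :: "_ \<Rightarrow> real"
  let ?f = "\<lambda>x. \<Sum>p\<in>F. ennreal (c p) * indicator (B p) x"
  have f: "?f \<in> borel_measurable \<mu>" using F by measurable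
  have "(\<integral>\<^sup>+\<omega>. lexp (\<Sum>p\<in>F. ennreal (c p) * emeasure (N \<omega>) (B p)) \<partial>\<Omega>) = (\<integral>\<^sup>+\<omega>. lexp (\<integral>\<^sup>+x. ?f x \<partial>N \<omega>) \<partial>\<Omega>)"
    if "N \<in> \<Omega> \<rightarrow>\<^sub>M measure_algebra \<mu>" for N and \<Omega> :: "'z measure"
    using F measure_algebra_sets_eq[OF that]
    by (intro nn_integral_cong) (subst nn_integral_simple_point_process[where \<mu>=\<mu>], auto)
  note * = this
  show "(\<integral>\<^sup>+\<omega>. lexp (\<Sum>p\<in>F. ennreal (c p) * emeasure (N1 \<omega>) (B p)) \<partial>\<Omega>1) =
     (\<integral>\<^sup>+\<omega>. lexp (\<Sum>p\<in>F. ennreal (c p) * emeasure (N2 \<omega>) (B p)) \<partial>\<Omega>2)"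
    unfolding *[OF N(1)] *[OF N(2)] using L f by (simp add: laplace_functional_def)
qed (use F cnt N in \<open>auto simp: counting_def intro: measurable_emeasure_point_process\<close>)

text \<open>On the set Z of count-valued measures, the events fixing finitely many finite counts are
  closed under intersections, and they generate every evaluation map because a count has only
  countably many values. The laws are compared on this smaller space and then carried over to
  \<open>measure_algebra\<close>.\<close>

theorem laplace_law_unique:
  assumes \<Omega>: "prob_space \<Omega>1" "prob_space \<Omega>2"
    and N: "N1 \<in> \<Omega>1 \<rightarrow>\<^sub>M measure_algebra \<mu>" "N2 \<in> \<Omega>2 \<rightarrow>\<^sub>M measure_algebra \<mu>"
    and cnt: "counting \<Omega>1 \<mu> N1" "counting \<Omega>2 \<mu> N2"
    and L: "laplace_functional \<Omega>1 \<mu> N1" "laplace_functional \<Omega>2 \<mu> N2"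
  shows "distr \<Omega>1 (measure_algebra \<mu>) N1 = distr \<Omega>2 (measure_algebra \<mu>) N2"
proof -
  interpret O1: prob_space \<Omega>1 by fact
  interpret O2: prob_space \<Omega>2 by fact
  define Z where "Z = {\<nu>. sets \<nu> = sets \<mu> \<and> (\<forall>B\<in>sets \<mu>. count_valued (emeasure \<nu> B))}"
  define G where "G F = {\<nu>\<in>Z. \<forall>(B, k)\<in>F. emeasure \<nu> B = of_nat k}" for F :: "(_ set \<times> nat) set"
  define E where "E = G ` {F. finite F \<and> F \<subseteq> sets \<mu> \<times> UNIV}"
  define S where "S = sigma Z E"
  have E_sub: "E \<subseteq> Pow Z" by (auto simp: E_def G_def)
  have NZ: "N1 \<omega> \<in> Z" if "\<omega> \<in> space \<Omega>1" for \<omega>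
    using that cnt measure_algebra_sets_eq[OF N(1) that] by (auto simp: Z_def counting_def)
  have NZ2: "N2 \<omega> \<in> Z" if "\<omega> \<in> space \<Omega>2" for \<omega>
    using that cnt measure_algebra_sets_eq[OF N(2) that] by (auto simp: Z_def counting_def)
  have vim: "M -` G F \<inter> space \<Omega> = {\<omega>\<in>space \<Omega>. \<forall>p\<in>F. emeasure (M \<omega>) (fst p) = of_nat (snd p)}"
    if "\<And>\<omega>. \<omega> \<in> space \<Omega> \<Longrightarrow> M \<omega> \<in> Z" for M F and \<Omega> :: "'z measure"
    using that by (auto simp: G_def)
  have meas: "M \<in> \<Omega> \<rightarrow>\<^sub>M S" if Mz: "\<And>\<omega>. \<omega> \<in> space \<Omega> \<Longrightarrow> M \<omega> \<in> Z" and M: "M \<in> \<Omega> \<rightarrow>\<^sub>M measure_algebra \<mu>"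
    for M and \<Omega> :: "'z measure"
    unfolding S_def
  proof (rule measurable_measure_of[OF E_sub])
    fix y assume "y \<in> E"
    then obtain F where F: "finite F" "F \<subseteq> sets \<mu> \<times> UNIV" "y = G F" by (auto simp: E_def)
    have "Measurable.pred \<Omega> (\<lambda>\<omega>. emeasure (M \<omega>) (fst p) = of_nat (snd p))" if "p \<in> F" for p
      using F that measurable_emeasure_point_process[OF M, of "fst p"] by (auto intro!: borel_measurable_eq)
    then show "M -` y \<inter> space \<Omega> \<in> sets \<Omega>"
      unfolding F(3) using F(1) by (subst vim[OF Mz]) (auto simp: pred_def intro!: sets.sets_Collect_finite_All)
  qed (use Mz in auto)
  note m1 = meas[OF NZ N(1)] and m2 = meas[OF NZ2 N(2)]
  have eqS: "distr \<Omega>1 S N1 = distr \<Omega>2 S N2"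
  proof (rule measure_eqI_generator_eq[where E=E and \<Omega>=Z and A="\<lambda>_. Z"])
    show "Int_stable E"
    proof (rule Int_stableI)
      fix a b assume "a \<in> E" "b \<in> E"
      then obtain F F' where "finite F" "F \<subseteq> sets \<mu> \<times> UNIV" "a = G F" "finite F'" "F' \<subseteq> sets \<mu> \<times> UNIV" "b = G F'"
        by (auto simp: E_def)
      then show "a \<inter> b \<in> E" unfolding E_def by (intro image_eqI[of _ _ "F \<union> F'"]) (auto simp: G_def)
    qed
    have "Z = G {}" by (auto simp: G_def)
    then show "range (\<lambda>_. Z) \<subseteq> E" by (auto simp: E_def)
    fix X assume X: "X \<in> E"
    then obtain F where F: "finite F" "F \<subseteq> sets \<mu> \<times> UNIV" "X = G F" by (auto simp: E_def)
    have XS: "X \<in> sets S" using X E_sub by (simp add: S_def)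
    have "measure \<Omega>1 {\<omega>\<in>space \<Omega>1. \<forall>p\<in>F. emeasure (N1 \<omega>) (fst p) = of_nat (snd p)} =
      measure \<Omega>2 {\<omega>\<in>space \<Omega>2. \<forall>p\<in>F. emeasure (N2 \<omega>) (fst p) = of_nat (snd p)}"
      using F by (intro counting_joint_unique[OF \<Omega> N cnt L]) auto
    then show "emeasure (distr \<Omega>1 S N1) X = emeasure (distr \<Omega>2 S N2) X"
      using XS m1 m2 by (simp add: emeasure_distr F(3) vim NZ NZ2 O1.emeasure_eq_measure O2.emeasure_eq_measure)
  next
    show "emeasure (distr \<Omega>1 S N1) Z \<noteq> \<infinity>" for i :: nat
      using prob_space.emeasure_le_1[OF O1.prob_space_distr[OF m1], of Z] by (auto simp: top_unique)
  qed (use E_sub in \<open>auto simp: S_def\<close>)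
  have "id \<in> S \<rightarrow>\<^sub>M measure_algebra \<mu>"
  proof (rule measurable_measure_algebraI)
    have sp: "space S = Z" using E_sub by (simp add: S_def space_measure_of)
    then show "sets (id \<nu>) = sets \<mu>" if "\<nu> \<in> space S" for \<nu> using that by (simp add: Z_def)
    fix B assume B: "B \<in> sets \<mu>"
    have k: "{\<nu>\<in>Z. emeasure \<nu> B = of_nat k} \<in> sets S" for k
    proof -
      have "{\<nu>\<in>Z. emeasure \<nu> B = of_nat k} = G {(B, k)}" by (auto simp: G_def)
      also have "\<dots> \<in> E" using B by (auto simp: E_def)
      finally show ?thesis using E_sub by (simp add: S_def)
    qed
    have K: "(\<Union>k\<in>K. {\<nu>\<in>Z. emeasure \<nu> B = of_nat k}) \<in> sets S" for K :: "nat set"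
      using k by (intro sets.countable_UN') auto
    show "(\<lambda>\<nu>. emeasure (id \<nu>) B) \<in> borel_measurable S"
    proof (rule measurableI)
      fix A :: "ennreal set"
      \<comment> \<open>Each finite value in A contributes one generating event; the value
        \<infinity> is the complement of all of them.\<close>
      have "(\<lambda>\<nu>. emeasure (id \<nu>) B) -` A \<inter> space S = (\<Union>k\<in>{k. of_nat k \<in> A}. {\<nu>\<in>Z. emeasure \<nu> B = of_nat k}) \<union>
        (if \<top> \<in> A then space S - (\<Union>k\<in>UNIV. {\<nu>\<in>Z. emeasure \<nu> B = of_nat k}) else {})"
      proof (intro set_eqI)
        fix \<nu>
        have "\<nu> \<in> Z \<Longrightarrow> emeasure \<nu> B = \<top> \<or> (\<exists>k. emeasure \<nu> B = of_nat k)"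
          using B by (auto simp: Z_def count_valued_def)
        then show "\<nu> \<in> (\<lambda>\<nu>. emeasure (id \<nu>) B) -` A \<inter> space S \<longleftrightarrow> \<nu> \<in> (\<Union>k\<in>{k. of_nat k \<in> A}. {\<nu>\<in>Z. emeasure \<nu> B = of_nat k}) \<union>
          (if \<top> \<in> A then space S - (\<Union>k\<in>UNIV. {\<nu>\<in>Z. emeasure \<nu> B = of_nat k}) else {})"
          by (auto simp: sp)
      qed
      also have "\<dots> \<in> sets S" using K by (auto simp del: UN_iff)
      finally show "(\<lambda>\<nu>. emeasure (id \<nu>) B) -` A \<inter> space S \<in> sets S" .
    qed simp
  qed
  then have "distr (distr \<Omega>1 S N1) (measure_algebra \<mu>) id = distr \<Omega>1 (measure_algebra \<mu>) N1"
    "distr (distr \<Omega>2 S N2) (measure_algebra \<mu>) id = distr \<Omega>2 (measure_algebra \<mu>) N2"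
    using m1 m2 by (simp_all add: distr_distr)
  then show ?thesis using eqS by simp
qed

text \<open>Independence is obtained by comparing the counts with independent copies of themselves.\<close>
theorem laplace_imp_poisson:
  assumes \<Omega>: "prob_space \<Omega>" and sf: "sigma_finite_measure \<mu>"
    and N: "N \<in> \<Omega> \<rightarrow>\<^sub>M measure_algebra \<mu>" and cnt: "counting \<Omega> \<mu> N"
    and L: "laplace_functional \<Omega> \<mu> N"
  shows "poisson_point_process \<Omega> \<mu> N"
  unfolding poisson_point_process_def
proof (intro conjI sf N allI ballI impI)
  interpret prob_space \<Omega> by fact
  note [measurable] = measurable_emeasure_point_process[OF N]
  have cv: "count_valued (emeasure (N \<omega>) B)" if "\<omega> \<in> space \<Omega>" "B \<in> sets \<mu>" for \<omega> B
    using cnt that by (auto simp: counting_def)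
  have simple_lap: "(\<integral>\<^sup>+\<omega>. lexp (\<Sum>j\<in>J. ennreal (c j) * emeasure (N \<omega>) (B j)) \<partial>\<Omega>) =
      (\<Prod>j\<in>J. lexp ((1 - lexp (ennreal (c j))) * emeasure \<mu> (B j)))"
    if J: "finite J" "\<And>j. j \<in> J \<Longrightarrow> B j \<in> sets \<mu>" "disjoint_family_on B J" for J :: "nat set" and B c
  proof -
    let ?f = "\<lambda>x. \<Sum>j\<in>J. ennreal (c j) * indicator (B j) x"
    have f: "?f \<in> borel_measurable \<mu>" using J by measurable
    have "(\<integral>\<^sup>+\<omega>. lexp (\<Sum>j\<in>J. ennreal (c j) * emeasure (N \<omega>) (B j)) \<partial>\<Omega>) = (\<integral>\<^sup>+\<omega>. lexp (\<integral>\<^sup>+x. ?f x \<partial>N \<omega>) \<partial>\<Omega>)"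
      using J measure_algebra_sets_eq[OF N]
      by (intro nn_integral_cong) (subst nn_integral_simple_point_process[where \<mu>=\<mu>], auto)
    also have "\<dots> = lexp (\<integral>\<^sup>+x. 1 - lexp (?f x) \<partial>\<mu>)"
      using L f by (simp add: laplace_functional_def)
    also have "(\<integral>\<^sup>+x. 1 - lexp (?f x) \<partial>\<mu>) = (\<Sum>j\<in>J. (1 - lexp (ennreal (c j))) * emeasure \<mu> (B j))"
      unfolding one_minus_lexp_disjoint[OF J(1,3)] using J by (intro nn_integral_simple_point_process) auto
    finally show ?thesis using J by (simp add: lexp_sum)
  qed
  have one: "(\<integral>\<^sup>+\<omega>. lexp (ennreal c * emeasure (N \<omega>) B) \<partial>\<Omega>) = lexp ((1 - lexp (ennreal c)) * emeasure \<mu> B)"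
    if "B \<in> sets \<mu>" for B c
    using simple_lap[of "{0}" "\<lambda>_. B" "\<lambda>_. c"] that by (simp add: disjoint_family_on_def)
  show "measure \<Omega> {\<omega>\<in>space \<Omega>. emeasure (N \<omega>) B = of_nat k} =
        (if emeasure \<mu> B = \<infinity> then 0 else exp (- measure \<mu> B) * measure \<mu> B ^ k / fact k)"
    if B: "B \<in> sets \<mu>" for B k
  proof (cases "emeasure \<mu> B = \<infinity>")
    case True
    \<comment> \<open>With infinite intensity the transform at parameter 1 vanishes, so e^(-count) =
      0 almost surely and the count is \<infinity>.\<close>
    have "lexp (ennreal 1) = ennreal (exp (- 1))" by (rule lexp_ennreal) simp
    then have "1 - lexp (ennreal 1) = ennreal (1 - exp (- 1))" by (simp add: ennreal_minus flip: ennreal_1)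
    then have "(\<integral>\<^sup>+\<omega>. lexp (ennreal 1 * emeasure (N \<omega>) B) \<partial>\<Omega>) = 0"
      unfolding one[OF B] using True by (simp add: ennreal_mult_top)
    then have "AE \<omega> in \<Omega>. lexp (emeasure (N \<omega>) B) = 0"
      using B by (subst (asm) nn_integral_0_iff_AE) auto
    then have "AE \<omega> in \<Omega>. emeasure (N \<omega>) B \<noteq> of_nat k"
      by eventually_elim (auto simp: lexp_def ennreal_eq_0_iff)
    then have "measure \<Omega> {\<omega>\<in>space \<Omega>. emeasure (N \<omega>) B = of_nat k} = 0"
      using B by (subst prob_eq_0) auto
    then show ?thesis using True by simp
  next
    case False
    define r where "r = measure \<mu> B"
    have r: "emeasure \<mu> B = ennreal r" "r \<ge> 0" using False by (auto simp: r_def emeasure_eq_ennreal_measure)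
    \<comment> \<open>A genuine Poisson variable for comparison; \<open>poisson_pmf\<close> asks for
      a positive rate, so rate 0 is the point mass at 0.\<close>
    obtain p where p: "pmf p k = exp (- r) * r ^ k / fact k" for k
    proof (cases "r = 0")
      case True
      then show ?thesis by (intro that[of "return_pmf 0"]) (auto simp: pmf_return power_0_left)
    next
      case False
      then show ?thesis using r by (intro that[of "poisson_pmf r"]) simp
    qed
    have P: "measure p {n\<in>space p. of_nat n = (of_nat k :: ennreal)} = exp (- r) * r ^ k / fact k" for k :: nat
    proof -
      have "{n\<in>space (measure_pmf p). of_nat n = (of_nat k :: ennreal)} = {k}" by auto
      then show ?thesis by (simp add: measure_pmf_single p)
    qed
    have "measure \<Omega> {\<omega>\<in>space \<Omega>. \<forall>j\<in>{0::nat}. emeasure (N \<omega>) B = of_nat k} =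
      measure p {n\<in>space p. \<forall>j\<in>{0::nat}. of_nat n = (of_nat k :: ennreal)}"
    proof (rule joint_count_unique[where k="\<lambda>_. k" and J="{0}"])
      fix c :: "nat \<Rightarrow> real" assume c: "\<And>j. j \<in> {0} \<Longrightarrow> 0 < c j"
      have "(\<integral>\<^sup>+n. lexp (ennreal (c 0) * of_nat n) \<partial>p) = lexp ((1 - lexp (ennreal (c 0))) * ennreal r)"
        using c r P by (intro poisson_lexp) (auto simp: count_valued_def measure_pmf.prob_space_axioms)
      then show "(\<integral>\<^sup>+\<omega>. lexp (\<Sum>j\<in>{0}. ennreal (c j) * emeasure (N \<omega>) B) \<partial>\<Omega>) =
        (\<integral>\<^sup>+n. lexp (\<Sum>j\<in>{0}. ennreal (c j) * of_nat n) \<partial>p)"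
        using one[OF B, of "c 0"] r by simp
    qed (use B cv in \<open>auto simp: count_valued_def measure_pmf.prob_space_axioms \<Omega>\<close>)
    then show ?thesis using False P[of k] by (simp add: r_def)
  qed
  show "indep_vars (\<lambda>_. borel) (\<lambda>j \<omega>. emeasure (N \<omega>) (B j)) {..<n}"
    if "(\<forall>j<n. B j \<in> sets \<mu>) \<and> disjoint_family_on B {..<n}" for B :: "nat \<Rightarrow> _" and n
  proof -
    have B: "\<And>j. j < n \<Longrightarrow> B j \<in> sets \<mu>" and dis: "disjoint_family_on B {..<n}" using that by auto
    define ev where "ev j k = {\<omega>\<in>space \<Omega>. emeasure (N \<omega>) (B j) = of_nat k}" for j and k :: nat
    have ev[measurable]: "j < n \<Longrightarrow> ev j k \<in> events" for j k unfolding ev_def using B by measurable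
    \<comment> \<open>Two different values of the same count exclude each other; adding the empty
      set makes the class closed under intersections.\<close>
    define F where "F j = insert {} (range (ev j))" for j
    have joint: "prob (\<Inter>j\<in>J. ev j (k j)) = (\<Prod>j\<in>J. prob (ev j (k j)))"
      if J: "finite J" "J \<noteq> {}" "J \<subseteq> {..<n}" for J k
    proof -
      let ?M = "\<Pi>\<^sub>M j\<in>J. \<Omega>"
      interpret P: product_prob_space "\<lambda>_. \<Omega>" J by unfold_locales
      interpret PF: finite_product_prob_space "\<lambda>_. \<Omega>" J using J by unfold_locales auto
      have Bj: "B j \<in> sets \<mu>" if "j \<in> J" for j using that J B by auto
      have "prob {\<omega>\<in>space \<Omega>. \<forall>j\<in>J. emeasure (N \<omega>) (B j) = of_nat (k j)} =
        measure ?M {w\<in>space ?M. \<forall>j\<in>J. emeasure (N (w j)) (B j) = of_nat (k j)}"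
      proof (rule joint_count_unique[OF \<Omega> P.prob_space_axioms J(1)])
        fix c :: "nat \<Rightarrow> real"
        have "(\<integral>\<^sup>+w. lexp (\<Sum>j\<in>J. ennreal (c j) * emeasure (N (w j)) (B j)) \<partial>?M) =
          (\<integral>\<^sup>+w. (\<Prod>j\<in>J. lexp (ennreal (c j) * emeasure (N (w j)) (B j))) \<partial>?M)"
          using J by (simp add: lexp_sum)
        also have "\<dots> = (\<Prod>j\<in>J. \<integral>\<^sup>+\<omega>. lexp (ennreal (c j) * emeasure (N \<omega>) (B j)) \<partial>\<Omega>)"
          using J Bj by (intro P.product_nn_integral_prod) auto
        also have "\<dots> = (\<Prod>j\<in>J. lexp ((1 - lexp (ennreal (c j))) * emeasure \<mu> (B j)))"
          using Bj by (intro prod.cong refl one) auto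
        finally show "(\<integral>\<^sup>+\<omega>. lexp (\<Sum>j\<in>J. ennreal (c j) * emeasure (N \<omega>) (B j)) \<partial>\<Omega>) =
          (\<integral>\<^sup>+w. lexp (\<Sum>j\<in>J. ennreal (c j) * emeasure (N (w j)) (B j)) \<partial>?M)"
          using simple_lap[of J B c, OF J(1) Bj] J dis by (simp add: disjoint_family_on_mono)
      next
        show "(\<lambda>w. emeasure (N (w j)) (B j)) \<in> borel_measurable ?M" if "j \<in> J" for j
          using that Bj[OF that] by measurable
        show "count_valued (emeasure (N (w j)) (B j))" if "j \<in> J" "w \<in> space ?M" for j w
          using that Bj by (intro cv) (auto simp: space_PiM PiE_def)
      qed (use Bj cv in auto)
      also have "{w\<in>space ?M. \<forall>j\<in>J. emeasure (N (w j)) (B j) = of_nat (k j)} = (\<Pi>\<^sub>E j\<in>J. ev j (k j))"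
        by (auto simp: ev_def space_PiM PiE_def Pi_def)
      also have "measure ?M (\<Pi>\<^sub>E j\<in>J. ev j (k j)) = (\<Prod>j\<in>J. prob (ev j (k j)))"
        using J by (intro PF.finite_measure_PiM_emb) auto
      also have "{\<omega>\<in>space \<Omega>. \<forall>j\<in>J. emeasure (N \<omega>) (B j) = of_nat (k j)} = (\<Inter>j\<in>J. ev j (k j))"
        using J by (auto simp: ev_def)
      finally show ?thesis .
    qed
    have "indep_sets F {..<n}"
    proof (rule indep_setsI)
      show "F j \<subseteq> events" if "j \<in> {..<n}" for j using that by (auto simp: F_def)
      fix A J assume J: "J \<noteq> {}" "J \<subseteq> {..<n}" "finite J" and A: "\<forall>j\<in>J. A j \<in> F j"
      show "prob (\<Inter>j\<in>J. A j) = (\<Prod>j\<in>J. prob (A j))"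
      proof (cases "\<exists>j\<in>J. A j = {}")
        case True
        then have "(\<Inter>j\<in>J. A j) = {}" by blast
        moreover have "(\<Prod>j\<in>J. prob (A j)) = 0" proof (intro prod_zero)
          show "\<exists>a\<in>J. prob (A a) = 0" using True measure_empty by metis
        qed fact
        ultimately show ?thesis by simp
      next
        case False
        then have "\<forall>j\<in>J. \<exists>k. A j = ev j k" using A by (fastforce simp: F_def)
        then obtain k where "\<forall>j\<in>J. A j = ev j (k j)" by metis
        then show ?thesis using joint[of J k] J by simp
      qed
    qed
    moreover have "Int_stable (F j)" for j
      by (auto simp: Int_stable_def F_def ev_def)
    ultimately have ind: "indep_sets (\<lambda>j. sigma_sets (space \<Omega>) (F j)) {..<n}"
      by (intro indep_sets_sigma)
    show ?thesis
      unfolding indep_vars_def2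
    proof (intro conjI ballI)
      show "random_variable borel (\<lambda>\<omega>. emeasure (N \<omega>) (B j))" if "j \<in> {..<n}" for j
        using that B measurable_emeasure_point_process[OF N] by auto
      show "indep_sets (\<lambda>j. {(\<lambda>\<omega>. emeasure (N \<omega>) (B j)) -` A \<inter> space \<Omega> |A. A \<in> sets borel}) {..<n}"
      proof (rule indep_sets_mono_sets[OF ind], clarify)
        fix j A assume j: "j < n" and "A \<in> sets (borel :: ennreal measure)"
        interpret S: sigma_algebra "space \<Omega>" "sigma_sets (space \<Omega>) (F j)"
          by (rule sigma_algebra_sigma_sets) (auto simp: F_def ev_def)
        have k: "ev j k \<in> sigma_sets (space \<Omega>) (F j)" for k by (auto simp: F_def)
        have K: "(\<Union>k\<in>K. ev j k) \<in> sigma_sets (space \<Omega>) (F j)" for K :: "nat set"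
          using k by (intro S.countable_UN') auto
        have "(\<lambda>\<omega>. emeasure (N \<omega>) (B j)) -` A \<inter> space \<Omega> = (\<Union>k\<in>{k. of_nat k \<in> A}. ev j k) \<union>
          (if \<top> \<in> A then space \<Omega> - (\<Union>k\<in>UNIV. ev j k) else {})"
        proof (intro set_eqI)
          fix \<omega>
          have "\<omega> \<in> space \<Omega> \<Longrightarrow> emeasure (N \<omega>) (B j) = \<top> \<or> (\<exists>k. emeasure (N \<omega>) (B j) = of_nat k)"
            using cv[of \<omega> "B j"] B j by (auto simp: count_valued_def)
          then show "\<omega> \<in> (\<lambda>\<omega>. emeasure (N \<omega>) (B j)) -` A \<inter> space \<Omega> \<longleftrightarrow> \<omega> \<in> (\<Union>k\<in>{k. of_nat k \<in> A}. ev j k) \<union>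
            (if \<top> \<in> A then space \<Omega> - (\<Union>k\<in>UNIV. ev j k) else {})"
            by (auto simp: ev_def)
        qed
        also have "\<dots> \<in> sigma_sets (space \<Omega>) (F j)" using K by (auto simp del: UN_iff)
        finally show "(\<lambda>\<omega>. emeasure (N \<omega>) (B j)) -` A \<inter> space \<Omega> \<in> sigma_sets (space \<Omega>) (F j)" .
      qed
    qed
  qed
qed

section \<open>Measurability on path spaces\<close>

lemma space_cadlag_space: "space (cadlag_space I) = {f \<in> extensional I. cadlag_on I f}"
  by (auto simp: cadlag_space_def space_restrict_space space_PiM PiE_def)

lemma space_caglad_space: "space (caglad_space I) = {f \<in> extensional I. caglad_on I f}"
  by (auto simp: caglad_space_def space_restrict_space space_PiM PiE_def)

lemma space_Dbar: "space Dbar = {f. cadlag_on UNIV f}"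
  by (simp add: Dbar_def space_cadlag_space)

lemma measurable_cadlag_eval: "t \<in> I \<Longrightarrow> (\<lambda>f. f t) \<in> borel_measurable (cadlag_space I)"
  unfolding cadlag_space_def by (intro measurable_restrict_space1 measurable_component_singleton)

lemma measurable_caglad_eval: "t \<in> I \<Longrightarrow> (\<lambda>f. f t) \<in> borel_measurable (caglad_space I)"
  unfolding caglad_space_def by (intro measurable_restrict_space1 measurable_component_singleton)

lemma measurable_Dbar_eval [measurable]: "(\<lambda>f. f t) \<in> borel_measurable Dbar"
  unfolding Dbar_def by (intro measurable_cadlag_eval) simp

lemma measurable_DbarI:
  assumes "\<And>x. x \<in> space M \<Longrightarrow> cadlag_on UNIV (X x)" "\<And>t. (\<lambda>x. X x t) \<in> borel_measurable M"
  shows "X \<in> M \<rightarrow>\<^sub>M Dbar"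
  unfolding Dbar_def cadlag_space_def
  by (intro measurable_restrict_space2 measurable_PiM_single') (use assms in auto)

text \<open>Right-continuity writes the value at \<open>x\<close> as the limit of the values at
  \<open>(\<lfloor>nx\<rfloor> + 1)/n\<close>, which takes only countably many values.\<close>
lemma measurable_cadlag_eval_joint:
  "(\<lambda>(r, f). f (max 0 r)) \<in> borel_measurable (borel \<Otimes>\<^sub>M cadlag_space {0..})"
proof -
  \<comment> \<open>Adding 1 makes a n r strictly larger than its limit, as a limit from the right
    requires.\<close>
  define a where "a n r = (real_of_int \<lfloor>real (Suc n) * max 0 r\<rfloor> + 1) / real (Suc n)" for n :: nat and r :: real
  have a_gt: "a n r > max 0 r" for n and r :: real
  proof -
    have "max 0 r * real (Suc n) < real_of_int \<lfloor>real (Suc n) * max 0 r\<rfloor> + 1"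
      by (simp only: mult.commute) linarith
    then show ?thesis unfolding a_def by (subst pos_less_divide_eq) auto
  qed
  have a_le: "a n r \<le> max 0 r + 1 / real (Suc n)" for n and r :: real
  proof -
    have "a n r \<le> (real (Suc n) * max 0 r + 1) / real (Suc n)"
      unfolding a_def by (intro divide_right_mono) auto
    then show ?thesis by (simp add: add_divide_distrib del: of_nat_Suc)
  qed
  have a_lim: "(\<lambda>n. a n r) \<longlonglongrightarrow> max 0 r" for r :: real
  proof -
    have "(\<lambda>n. max 0 r + 1 / real (Suc n)) \<longlonglongrightarrow> max 0 r"
      using tendsto_add[OF tendsto_const LIMSEQ_inverse_real_of_nat, of "max 0 r"] by (simp add: inverse_eq_divide)
    from tendsto_sandwich[OF _ _ tendsto_const this] show ?thesis
      using less_imp_le[OF a_gt] a_le by auto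
  qed
  have meas: "(\<lambda>(r, f). f (a n r)) \<in> borel_measurable (borel \<Otimes>\<^sub>M cadlag_space {0..})" for n
  proof -
    define b where "b k = (real k + 1) / real (Suc n)" for k
    have "(\<lambda>p. snd p (b (nat \<lfloor>real (Suc n) * max 0 (fst p)\<rfloor>))) \<in> borel_measurable (borel \<Otimes>\<^sub>M cadlag_space {0..})"
    proof (rule measurable_compose_countable[where g="\<lambda>p. nat \<lfloor>real (Suc n) * max 0 (fst p)\<rfloor>" and f="\<lambda>k p. snd p (b k)"])
      show "(\<lambda>p. snd p (b k)) \<in> borel_measurable (borel \<Otimes>\<^sub>M cadlag_space {0..})" for k
        by (rule measurable_compose[OF measurable_snd measurable_cadlag_eval]) (simp add: b_def)
      show "(\<lambda>p. nat \<lfloor>real (Suc n) * max 0 (fst p)\<rfloor>) \<in> borel \<Otimes>\<^sub>M cadlag_space {0..} \<rightarrow>\<^sub>M count_space UNIV"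
        by measurable
    qed
    moreover have "b (nat \<lfloor>real (Suc n) * max 0 r\<rfloor>) = a n r" for r
      by (simp add: a_def b_def del: of_nat_Suc)
    ultimately show ?thesis by (simp add: case_prod_beta)
  qed
  show ?thesis
  proof (rule borel_measurable_LIMSEQ_order[OF _ meas])
    fix p assume "p \<in> space ((borel :: real measure) \<Otimes>\<^sub>M cadlag_space {0..})"
    then obtain r f where p: "p = (r, f)" "cadlag_on {0..} f"
      by (cases p) (auto simp: space_pair_measure space_cadlag_space)
    have "(f \<longlongrightarrow> f (max 0 r)) (at (max 0 r) within ({0..} \<inter> {max 0 r<..}))"
      using p(2) by (auto simp: cadlag_on_def)
    moreover have "filterlim (\<lambda>n. a n r) (at (max 0 r) within ({0..} \<inter> {max 0 r<..})) sequentially"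
      unfolding filterlim_at
    proof (intro conjI always_eventually allI)
      show "a n r \<in> {0..} \<inter> {max 0 r<..}" "a n r \<noteq> max 0 r" for n using a_gt[of r n] by auto
    qed (rule a_lim)
    ultimately have "(\<lambda>n. f (a n r)) \<longlonglongrightarrow> f (max 0 r)" by (rule filterlim_compose)
    then show "(\<lambda>n. (case p of (r, f) \<Rightarrow> f (a n r))) \<longlonglongrightarrow> (case p of (r, f) \<Rightarrow> f (max 0 r))"
      by (simp add: p)
  qed
qed

text \<open>The mirror image, with approximations strictly below r. At r \<le> 0 there is nothing to
  the left within the half-line, and cutting off at 0 makes the approximations constantly 0.\<close>

lemma measurable_caglad_eval_joint:
  "(\<lambda>(r, f). f (max 0 r)) \<in> borel_measurable (borel \<Otimes>\<^sub>M caglad_space {0..})"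
proof -
  define a where "a n r = max 0 ((real_of_int \<lceil>real (Suc n) * r\<rceil> - 1) / real (Suc n))" for n :: nat and r :: real
  have a_lt: "a n r < r" if "r > 0" for n and r :: real
  proof -
    have "real_of_int \<lceil>real (Suc n) * r\<rceil> - 1 < r * real (Suc n)"
      by (simp only: mult.commute) linarith
    then have "(real_of_int \<lceil>real (Suc n) * r\<rceil> - 1) / real (Suc n) < r" by (subst pos_divide_less_eq) auto
    then show ?thesis using that by (simp add: a_def del: of_nat_Suc)
  qed
  have a_ge: "a n r \<ge> r - 1 / real (Suc n)" for n and r :: real
  proof -
    have "(real (Suc n) * r - 1) / real (Suc n) \<le> a n r"
      unfolding a_def by (intro max.coboundedI2 divide_right_mono) auto
    then show ?thesis by (simp add: diff_divide_distrib del: of_nat_Suc)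
  qed
  have a_lim: "(\<lambda>n. a n r) \<longlonglongrightarrow> r" if "r > 0" for r :: real
  proof -
    have "(\<lambda>n. r - 1 / real (Suc n)) \<longlonglongrightarrow> r"
      using tendsto_diff[OF tendsto_const LIMSEQ_inverse_real_of_nat, of r] by (simp add: inverse_eq_divide)
    from tendsto_sandwich[OF _ _ this tendsto_const] show ?thesis
      using less_imp_le[OF a_lt[OF that]] a_ge by auto
  qed
  have a_0: "a n r = 0" if "r \<le> 0" for n and r :: real
  proof -
    have "real (Suc n) * r \<le> 0" using that by (intro mult_nonneg_nonpos) auto
    then have "\<lceil>real (Suc n) * r\<rceil> \<le> 0" by (simp only: ceiling_le_zero)
    then have "(real_of_int \<lceil>real (Suc n) * r\<rceil> - 1) / real (Suc n) \<le> 0"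
      by (intro divide_nonpos_nonneg) auto
    then show ?thesis by (simp add: a_def del: of_nat_Suc)
  qed
  have meas: "(\<lambda>(r, f). f (a n r)) \<in> borel_measurable (borel \<Otimes>\<^sub>M caglad_space {0..})" for n
  proof -
    define b where "b k = max 0 ((real_of_int k - 1) / real (Suc n))" for k
    have "(\<lambda>p. snd p (b (\<lceil>real (Suc n) * fst p\<rceil>))) \<in> borel_measurable (borel \<Otimes>\<^sub>M caglad_space {0..})"
    proof (rule measurable_compose_countable[where g="\<lambda>p. \<lceil>real (Suc n) * fst p\<rceil>" and f="\<lambda>k p. snd p (b k)"])
      show "(\<lambda>p. snd p (b k)) \<in> borel_measurable (borel \<Otimes>\<^sub>M caglad_space {0..})" for k
        by (rule measurable_compose[OF measurable_snd measurable_caglad_eval]) (simp add: b_def)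
      show "(\<lambda>p. \<lceil>real (Suc n) * fst p\<rceil>) \<in> borel \<Otimes>\<^sub>M caglad_space {0..} \<rightarrow>\<^sub>M count_space UNIV"
        by measurable
    qed
    then show ?thesis by (simp add: case_prod_beta a_def b_def)
  qed
  show ?thesis
  proof (rule borel_measurable_LIMSEQ_order[OF _ meas])
    fix p assume "p \<in> space ((borel :: real measure) \<Otimes>\<^sub>M caglad_space {0..})"
    then obtain r f where p: "p = (r, f)" "caglad_on {0..} f"
      by (cases p) (auto simp: space_pair_measure space_caglad_space)
    have "(\<lambda>n. f (a n r)) \<longlonglongrightarrow> f (max 0 r)"
    proof (cases "r > 0")
      case True
      then have "(f \<longlongrightarrow> f r) (at r within ({0..} \<inter> {..<r}))"
        using p(2) by (auto simp: caglad_on_def)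
      moreover have "filterlim (\<lambda>n. a n r) (at r within ({0..} \<inter> {..<r})) sequentially"
        unfolding filterlim_at
      proof (intro conjI always_eventually allI)
        show "a n r \<in> {0..} \<inter> {..<r}" "a n r \<noteq> r" for n using a_lt[OF True, of n] by (auto simp: a_def)
      qed (rule a_lim[OF True])
      ultimately have "(\<lambda>n. f (a n r)) \<longlonglongrightarrow> f r" by (rule filterlim_compose)
      then show ?thesis using True by simp
    next
      case False
      then show ?thesis by (simp add: a_0 max_absorb1)
    qed
    then show "(\<lambda>n. (case p of (r, f) \<Rightarrow> f (a n r))) \<longlonglongrightarrow> (case p of (r, f) \<Rightarrow> f (max 0 r))"
      by (simp add: p)
  qed
qed

section \<open>Regularity and measurability of the particle trajectories\<close>

lemma cadlag_on_add_ereal: "cadlag_on I f \<Longrightarrow> cadlag_on I (\<lambda>t. ereal u + f t)"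
  unfolding cadlag_on_def
proof safe
  fix t l assume I: "\<forall>t\<in>I. f t \<noteq> \<infinity> \<and> (f \<longlongrightarrow> f t) (at t within I \<inter> {t<..}) \<and> (\<exists>l. l \<noteq> \<infinity> \<and> (f \<longlongrightarrow> l) (at t within I \<inter> {..<t}))"
    and t: "t \<in> I"
  { assume "ereal u + f t = \<infinity>" then show False using I t by auto }
  show "((\<lambda>t. ereal u + f t) \<longlongrightarrow> ereal u + f t) (at t within I \<inter> {t<..})"
    using bspec[OF I t] by (intro tendsto_add_ereal_general2) auto
  obtain l where l: "l \<noteq> \<infinity>" "(f \<longlongrightarrow> l) (at t within I \<inter> {..<t})" using I t by blast
  show "\<exists>l. l \<noteq> \<infinity> \<and> ((\<lambda>t. ereal u + f t) \<longlongrightarrow> l) (at t within I \<inter> {..<t})"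
    using l by (intro exI[of _ "ereal u + l"] conjI tendsto_add_ereal_general2) auto
qed

lemma caglad_on_add_ereal: "caglad_on I f \<Longrightarrow> caglad_on I (\<lambda>t. ereal u + f t)"
  unfolding caglad_on_def
proof safe
  fix t l assume I: "\<forall>t\<in>I. f t \<noteq> \<infinity> \<and> (f \<longlongrightarrow> f t) (at t within I \<inter> {..<t}) \<and> (\<exists>l. l \<noteq> \<infinity> \<and> (f \<longlongrightarrow> l) (at t within I \<inter> {t<..}))"
    and t: "t \<in> I"
  { assume "ereal u + f t = \<infinity>" then show False using I t by auto }
  show "((\<lambda>t. ereal u + f t) \<longlongrightarrow> ereal u + f t) (at t within I \<inter> {..<t})"
    using bspec[OF I t] by (intro tendsto_add_ereal_general2) auto
  obtain l where l: "l \<noteq> \<infinity>" "(f \<longlongrightarrow> l) (at t within I \<inter> {t<..})" using I t by blast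
  show "\<exists>l. l \<noteq> \<infinity> \<and> ((\<lambda>t. ereal u + f t) \<longlongrightarrow> l) (at t within I \<inter> {t<..})"
    using l by (intro exI[of _ "ereal u + l"] conjI tendsto_add_ereal_general2) auto
qed

lemma cadlag_on_UNIV_iff:
  "cadlag_on UNIV f \<longleftrightarrow> (\<forall>t. f t \<noteq> \<infinity> \<and> (f \<longlongrightarrow> f t) (at_right t) \<and> (\<exists>l. l \<noteq> \<infinity> \<and> (f \<longlongrightarrow> l) (at_left t)))"
  by (simp add: cadlag_on_def)

lemma cadlag_central_path: "cadlag_on UNIV f \<Longrightarrow> cadlag_on UNIV (central_path u f)"
  unfolding central_path_def[abs_def] by (rule cadlag_on_add_ereal)

lemma filterlim_shift_at_right: "filterlim (\<lambda>r. r - s) (at_right (t - s)) (at_right (t :: real))"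
  by (auto simp: filterlim_at eventually_at_filter intro!: tendsto_intros)

lemma filterlim_shift_at_left: "filterlim (\<lambda>r. r - s) (at_left (t - s)) (at_left (t :: real))"
  by (auto simp: filterlim_at eventually_at_filter intro!: tendsto_intros)

lemma filterlim_reflect_at_right: "filterlim (\<lambda>r. s - r) (at_left (s - t)) (at_right (t :: real))"
  by (auto simp: filterlim_at eventually_at_filter intro!: tendsto_intros)

lemma filterlim_reflect_at_left: "filterlim (\<lambda>r. s - r) (at_right (s - t)) (at_left (t :: real))"
  by (auto simp: filterlim_at eventually_at_filter intro!: tendsto_intros)

lemma at_left_half_line: "(t::real) > 0 \<Longrightarrow> at t within ({0..} \<inter> {..<t}) = at_left t"
  by (rule at_within_nhd[of _ "{0<..}"]) auto

lemma at_right_half_line: "(t::real) \<ge> 0 \<Longrightarrow> at t within ({0..} \<inter> {t<..}) = at_right t"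
  by (rule arg_cong[of _ _ "\<lambda>S. at t within S"]) auto

lemma cadlag_shift: "cadlag_on UNIV f \<Longrightarrow> cadlag_on UNIV (time_shift s f)"
  unfolding cadlag_on_UNIV_iff time_shift_def
  using filterlim_compose[OF _ filterlim_shift_at_right] filterlim_compose[OF _ filterlim_shift_at_left]
  by metis

text \<open>Before birth the path is constantly -\<infinity>; at the birth time only the left limit
  sees -\<infinity>, while right-continuity is that of f at 0; afterwards the regularity of f is
  transported by a shift.\<close>

lemma cadlag_plus_path:
  assumes f: "cadlag_on {0..} f"
  shows "cadlag_on UNIV (plus_path s u f)"
proof -
  define g where "g t = ereal u + f t" for t
  have g: "cadlag_on {0..} g" unfolding g_def using f by (rule cadlag_on_add_ereal)
  have p: "plus_path s u f = (\<lambda>t. if t < s then - \<infinity> else g (t - s))"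
    by (auto simp: plus_path_def g_def)
  show ?thesis
    unfolding cadlag_on_UNIV_iff p
  proof (intro allI conjI)
    fix t
    show "(if t < s then - \<infinity> else g (t - s)) \<noteq> \<infinity>" using g by (auto simp: cadlag_on_def)
    show "((\<lambda>t. if t < s then - \<infinity> else g (t - s)) \<longlongrightarrow> (if t < s then - \<infinity> else g (t - s))) (at_right t)"
    proof (cases "t < s")
      case True
      have "\<forall>\<^sub>F r in at_right t. r < s" using True by (intro eventually_at_right_field[THEN iffD2]) auto
      then show ?thesis using True by (intro tendsto_eventually) (auto elim: eventually_mono)
    next
      case False
      have "(g \<longlongrightarrow> g (t - s)) (at_right (t - s))"
        using g False unfolding cadlag_on_def by (subst at_right_half_line[symmetric]) auto
      then have "((\<lambda>r. g (r - s)) \<longlongrightarrow> g (t - s)) (at_right t)"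
        by (rule filterlim_compose[OF _ filterlim_shift_at_right])
      moreover have "\<forall>\<^sub>F r in at_right t. g (r - s) = (if r < s then - \<infinity> else g (r - s))"
        using False by (auto simp: eventually_at_filter)
      ultimately show ?thesis using False by (auto intro: Lim_transform_eventually)
    qed
    show "\<exists>l. l \<noteq> \<infinity> \<and> ((\<lambda>t. if t < s then - \<infinity> else g (t - s)) \<longlongrightarrow> l) (at_left t)"
    proof (cases "t \<le> s")
      case True
      have "\<forall>\<^sub>F r in at_left t. (if r < s then - \<infinity> else g (r - s)) = - \<infinity>"
        using True by (auto simp: eventually_at_filter)
      then show ?thesis by (intro exI[of _ "-\<infinity>"] conjI tendsto_eventually) auto
    next
      case False
      then obtain l where l: "l \<noteq> \<infinity>" "(g \<longlongrightarrow> l) (at_left (t - s))"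
        using bspec[OF g[unfolded cadlag_on_def], of "t - s"] at_left_half_line[of "t - s"] by auto
      have "((\<lambda>r. g (r - s)) \<longlongrightarrow> l) (at_left t)"
        by (rule filterlim_compose[OF l(2) filterlim_shift_at_left])
      moreover have "\<forall>\<^sub>F r in at_left t. s < r" using False by (intro eventually_at_leftI[of s]) auto
      then have "\<forall>\<^sub>F r in at_left t. g (r - s) = (if r < s then - \<infinity> else g (r - s))"
        by eventually_elim auto
      ultimately show ?thesis using l by (auto intro: Lim_transform_eventually)
    qed
  qed
qed

text \<open>The reflection of t to s - t turns left-continuity of f into right-continuity, which is
  why backward paths are taken caglad. The path is -\<infinity> at s itself and hence
  right-continuous there; its left limit at s comes from the right limit of f at 0.\<close>

lemma cadlag_minus_path:
  assumes f: "caglad_on {0..} f"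
  shows "cadlag_on UNIV (minus_path s u f)"
proof -
  define g where "g t = ereal u + f t" for t
  have g: "caglad_on {0..} g" unfolding g_def using f by (rule caglad_on_add_ereal)
  have p: "minus_path s u f = (\<lambda>t. if t < s then g (s - t) else - \<infinity>)"
    by (auto simp: minus_path_def g_def)
  show ?thesis
    unfolding cadlag_on_UNIV_iff p
  proof (intro allI conjI)
    fix t
    show "(if t < s then g (s - t) else - \<infinity>) \<noteq> \<infinity>" using g by (auto simp: caglad_on_def)
    show "((\<lambda>t. if t < s then g (s - t) else - \<infinity>) \<longlongrightarrow> (if t < s then g (s - t) else - \<infinity>)) (at_right t)"
    proof (cases "t < s")
      case True
      have "(g \<longlongrightarrow> g (s - t)) (at_left (s - t))"
        using g True unfolding caglad_on_def by (subst at_left_half_line[symmetric]) auto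
      then have "((\<lambda>r. g (s - r)) \<longlongrightarrow> g (s - t)) (at_right t)"
        by (rule filterlim_compose[OF _ filterlim_reflect_at_right])
      moreover have "\<forall>\<^sub>F r in at_right t. r < s" using True by (intro eventually_at_right_field[THEN iffD2]) auto
      then have "\<forall>\<^sub>F r in at_right t. g (s - r) = (if r < s then g (s - r) else - \<infinity>)"
        by eventually_elim auto
      ultimately show ?thesis using True by (auto intro: Lim_transform_eventually)
    next
      case False
      have "\<forall>\<^sub>F r in at_right t. (if r < s then g (s - r) else - \<infinity>) = - \<infinity>"
        using False by (auto simp: eventually_at_filter)
      then show ?thesis using False by (intro tendsto_eventually) auto
    qed
    show "\<exists>l. l \<noteq> \<infinity> \<and> ((\<lambda>t. if t < s then g (s - t) else - \<infinity>) \<longlongrightarrow> l) (at_left t)"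
    proof (cases "t \<le> s")
      case True
      then obtain l where l: "l \<noteq> \<infinity>" "(g \<longlongrightarrow> l) (at_right (s - t))"
        using bspec[OF g[unfolded caglad_on_def], of "s - t"] at_right_half_line[of "s - t"] by auto
      have "((\<lambda>r. g (s - r)) \<longlongrightarrow> l) (at_left t)"
        by (rule filterlim_compose[OF l(2) filterlim_reflect_at_left])
      moreover have "\<forall>\<^sub>F r in at_left t. g (s - r) = (if r < s then g (s - r) else - \<infinity>)"
        using True by (auto simp: eventually_at_filter)
      ultimately show ?thesis using l by (auto intro: Lim_transform_eventually)
    next
      case False
      have "\<forall>\<^sub>F r in at_left t. s < r" using False by (intro eventually_at_leftI[of s]) auto
      then have "\<forall>\<^sub>F r in at_left t. (if r < s then g (s - r) else - \<infinity>) = - \<infinity>"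
        by eventually_elim auto
      then show ?thesis by (intro exI[of _ "-\<infinity>"] conjI tendsto_eventually) auto
    qed
  qed
qed

lemma measurable_central_path:
  "(\<lambda>(u, f). central_path u f) \<in> borel \<Otimes>\<^sub>M Dbar \<rightarrow>\<^sub>M Dbar"
proof (rule measurable_DbarI)
  show "cadlag_on UNIV (case p of (u, f) \<Rightarrow> central_path u f)" if "p \<in> space (borel \<Otimes>\<^sub>M Dbar)" for p
    using that by (cases p) (auto simp: space_pair_measure space_Dbar intro: cadlag_central_path)
  show "(\<lambda>p. (case p of (u, f) \<Rightarrow> central_path u f) t) \<in> borel_measurable (borel \<Otimes>\<^sub>M Dbar)" for t
    by (simp add: case_prod_beta central_path_def)
qed

lemma measurable_plus_path:
  "(\<lambda>((s, u), f). plus_path s u f) \<in> (borel \<Otimes>\<^sub>M borel) \<Otimes>\<^sub>M cadlag_space {0..} \<rightarrow>\<^sub>M Dbar"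
proof (rule measurable_DbarI)
  let ?M = "(borel \<Otimes>\<^sub>M borel) \<Otimes>\<^sub>M cadlag_space {0..} :: ((real \<times> real) \<times> _) measure"
  show "cadlag_on UNIV ((\<lambda>((s, u), f). plus_path s u f) p)" if "p \<in> space ?M" for p
    using that by (cases p) (auto simp: space_pair_measure space_cadlag_space intro: cadlag_plus_path)
  fix t
  \<comment> \<open>The age t - s is cut off at 0 to stay in the domain of the driver; the value
    before birth is discarded by the case distinction.\<close>
  have [measurable]: "(\<lambda>p. snd p (max 0 (t - fst (fst p)))) \<in> borel_measurable ?M"
    using measurable_compose[of "\<lambda>p. (t - fst (fst p), snd p)" ?M, OF _ measurable_cadlag_eval_joint] by simp
  have "(\<lambda>p. if t < fst (fst p) then - \<infinity> else ereal (snd (fst p)) + snd p (max 0 (t - fst (fst p)))) \<in> borel_measurable ?M"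
    by measurable
  moreover have "((\<lambda>((s, u), f). plus_path s u f) p) t =
    (if t < fst (fst p) then - \<infinity> else ereal (snd (fst p)) + snd p (max 0 (t - fst (fst p))))" for p
    by (auto simp: plus_path_def case_prod_beta max_absorb2)
  ultimately show "(\<lambda>p. ((\<lambda>((s, u), f). plus_path s u f) p) t) \<in> borel_measurable ?M"
    by simp
qed

lemma measurable_minus_path:
  "(\<lambda>((s, u), f). minus_path s u f) \<in> (borel \<Otimes>\<^sub>M borel) \<Otimes>\<^sub>M caglad_space {0..} \<rightarrow>\<^sub>M Dbar"
proof (rule measurable_DbarI)
  let ?M = "(borel \<Otimes>\<^sub>M borel) \<Otimes>\<^sub>M caglad_space {0..} :: ((real \<times> real) \<times> _) measure"
  show "cadlag_on UNIV ((\<lambda>((s, u), f). minus_path s u f) p)" if "p \<in> space ?M" for p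
    using that by (cases p) (auto simp: space_pair_measure space_caglad_space intro: cadlag_minus_path)
  fix t
  have [measurable]: "(\<lambda>p. snd p (max 0 (fst (fst p) - t))) \<in> borel_measurable ?M"
    using measurable_compose[of "\<lambda>p. (fst (fst p) - t, snd p)" ?M, OF _ measurable_caglad_eval_joint] by simp
  have "(\<lambda>p. if t < fst (fst p) then ereal (snd (fst p)) + snd p (max 0 (fst (fst p) - t)) else - \<infinity>) \<in> borel_measurable ?M"
    by measurable
  moreover have "((\<lambda>((s, u), f). minus_path s u f) p) t =
    (if t < fst (fst p) then ereal (snd (fst p)) + snd p (max 0 (fst (fst p) - t)) else - \<infinity>)" for p
    by (auto simp: minus_path_def case_prod_beta max_absorb2)
  ultimately show "(\<lambda>p. ((\<lambda>((s, u), f). minus_path s u f) p) t) \<in> borel_measurable ?M"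
    by simp
qed

lemma measurable_time_shift: "time_shift s \<in> Dbar \<rightarrow>\<^sub>M Dbar"
  by (rule measurable_DbarI) (auto simp: space_Dbar time_shift_def intro: cadlag_shift[unfolded time_shift_def])

section \<open>Killed Levy processes and duality\<close>

lemma ereal_image_measurable [measurable (raw)]:
  assumes "B \<in> sets borel" shows "ereal ` B \<in> sets borel"
proof -
  have "ereal ` B = {x \<in> space borel. \<bar>x\<bar> \<noteq> \<infinity> \<and> real_of_ereal x \<in> B}"
    by (auto intro!: image_eqI[of _ _ "real_of_ereal _"] simp: ereal_real')
  then show ?thesis using assms by simp
qed

text \<open>The product rule on rectangles identifies the law of the pair with the product of the
  laws, so that Fubini replaces one variable by an independent copy.\<close>

lemma (in prob_space) indep_nn_integral:
  assumes m[measurable]: "A \<in> M \<rightarrow>\<^sub>M S" "B \<in> M \<rightarrow>\<^sub>M T"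
    and ind: "\<And>a b. a \<in> sets S \<Longrightarrow> b \<in> sets T \<Longrightarrow>
      prob ((\<lambda>\<omega>. (A \<omega>, B \<omega>)) -` (a \<times> b) \<inter> space M) = prob (A -` a \<inter> space M) * prob (B -` b \<inter> space M)"
    and h[measurable]: "h \<in> borel_measurable (S \<Otimes>\<^sub>M T)"
  shows "(\<integral>\<^sup>+\<omega>. h (A \<omega>, B \<omega>) \<partial>M) = (\<integral>\<^sup>+\<omega>. (\<integral>\<^sup>+\<omega>'. h (A \<omega>, B \<omega>') \<partial>M) \<partial>M)"
proof -
  interpret A: prob_space "distr M S A" by (rule prob_space_distr) fact
  interpret B: prob_space "distr M T B" by (rule prob_space_distr) fact
  have eq: "distr M S A \<Otimes>\<^sub>M distr M T B = distr M (S \<Otimes>\<^sub>M T) (\<lambda>x. (A x, B x))"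
  proof (rule pair_measure_eqI)
    fix a b assume ab: "a \<in> sets (distr M S A)" "b \<in> sets (distr M T B)"
    then show "emeasure (distr M S A) a * emeasure (distr M T B) b = emeasure (distr M (S \<Otimes>\<^sub>M T) (\<lambda>x. (A x, B x))) (a \<times> b)"
      using ind[of a b] by (simp add: emeasure_distr emeasure_eq_measure flip: ennreal_mult)
  qed (auto intro: A.sigma_finite_measure_axioms B.sigma_finite_measure_axioms)
  have "(\<integral>\<^sup>+\<omega>. h (A \<omega>, B \<omega>) \<partial>M) = (\<integral>\<^sup>+p. h p \<partial>distr M (S \<Otimes>\<^sub>M T) (\<lambda>x. (A x, B x)))"
    by (simp add: nn_integral_distr)
  also have "\<dots> = (\<integral>\<^sup>+a. \<integral>\<^sup>+b. h (a, b) \<partial>distr M T B \<partial>distr M S A)"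
    unfolding eq[symmetric]
    by (subst B.nn_integral_fst[symmetric]) (auto cong: measurable_cong_sets)
  also have "\<dots> = (\<integral>\<^sup>+\<omega>. (\<integral>\<^sup>+b. h (A \<omega>, b) \<partial>distr M T B) \<partial>M)"
    by (subst nn_integral_distr) (auto intro!: B.borel_measurable_nn_integral cong: measurable_cong_sets)
  also have "\<dots> = (\<integral>\<^sup>+\<omega>. (\<integral>\<^sup>+\<omega>'. h (A \<omega>, B \<omega>') \<partial>M) \<partial>M)"
    by (intro nn_integral_cong, subst nn_integral_distr)
       (auto intro!: measurable_compose[OF _ h] measurable_Pair dest: measurable_space[OF m(1)])
  finally show ?thesis .
qed

lemma (in prob_space) indep_vars_pair:
  assumes ind: "indep_vars M' Y I" and ij: "i \<in> I" "j \<in> I" "i \<noteq> j"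
  shows "indep_var (M' i) (Y i) (M' j) (Y j)"
proof -
  have "indep_var (PiM {i} M') (\<lambda>\<omega>. restrict (\<lambda>l. Y l \<omega>) {i}) (PiM {j} M') (\<lambda>\<omega>. restrict (\<lambda>l. Y l \<omega>) {j})"
    by (rule indep_var_restrict[OF ind]) (use ij in auto)
  then have "indep_var (M' i) ((\<lambda>r. r i) \<circ> (\<lambda>\<omega>. restrict (\<lambda>l. Y l \<omega>) {i})) (M' j) ((\<lambda>r. r j) \<circ> (\<lambda>\<omega>. restrict (\<lambda>l. Y l \<omega>) {j}))"
    by (rule indep_var_compose) auto
  then show ?thesis by (simp add: comp_def)
qed

section \<open>Transition kernels of a killed Levy process\<close>

text \<open>Stated once and used twice, for the forward process killed at rate
  \<open>\<theta>m\<close> and the backward process killed at rate \<open>\<theta>p\<close>.\<close>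

locale levy =
  fixes M :: "'a measure" and X :: "real \<Rightarrow> 'a \<Rightarrow> real" and \<theta> :: real
  assumes levy: "levy_process M X" and rate: "\<theta> \<ge> 0"
begin

sublocale prob_space M
  using levy by (simp add: levy_process_def)

lemma X_measurable: "t \<ge> 0 \<Longrightarrow> X t \<in> borel_measurable M"
  using levy by (auto simp: levy_process_def)

lemma X_0: "AE \<omega> in M. X 0 \<omega> = 0"
  using levy by (auto simp: levy_process_def)

lemma increments_indep:
  "0 \<le> t 0 \<Longrightarrow> (\<And>i. i < n \<Longrightarrow> t i \<le> t (Suc i)) \<Longrightarrow>
    indep_vars (\<lambda>_. borel) (\<lambda>i \<omega>. X (t (Suc i)) \<omega> - X (t i) \<omega>) {..<n}"
  using levy by (auto simp: levy_process_def)

lemma nn_integral_increment: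
  assumes "0 \<le> s" "s \<le> t" and [measurable]: "f \<in> borel_measurable borel"
  shows "(\<integral>\<^sup>+\<omega>. f (X t \<omega> - X s \<omega>) \<partial>M) = (\<integral>\<^sup>+\<omega>. f (X (t - s) \<omega>) \<partial>M)"
proof -
  have [measurable]: "X s \<in> borel_measurable M" "X t \<in> borel_measurable M" "X (t - s) \<in> borel_measurable M"
    using assms by (auto intro: X_measurable)
  have eq: "distr M borel (\<lambda>\<omega>. X (s + (t - s)) \<omega> - X s \<omega>) = distr M borel (X (t - s))"
    using levy assms unfolding levy_process_def by (metis diff_ge_0_iff_ge)
  have "(\<integral>\<^sup>+\<omega>. f (X t \<omega> - X s \<omega>) \<partial>M) = (\<integral>\<^sup>+x. f x \<partial>distr M borel (\<lambda>\<omega>. X (s + (t - s)) \<omega> - X s \<omega>))"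
    by (subst nn_integral_distr) auto
  also have "\<dots> = (\<integral>\<^sup>+\<omega>. f (X (t - s) \<omega>) \<partial>M)"
    unfolding eq by (subst nn_integral_distr) auto
  finally show ?thesis .
qed

abbreviation q :: "real \<Rightarrow> real \<Rightarrow> real measure" where
  "q \<equiv> killed_kernel M X \<theta>"

lemma nn_integral_q:
  assumes t: "t \<ge> 0" and f[measurable]: "f \<in> borel_measurable borel"
  shows "(\<integral>\<^sup>+y. f y \<partial>q t x) = ennreal (exp (- \<theta> * t)) * (\<integral>\<^sup>+\<omega>. f (x + X t \<omega>) \<partial>M)"
proof -
  note [measurable] = X_measurable[OF t]
  show ?thesis
    unfolding killed_kernel_def levy_kernel_def
    by (subst nn_integral_scale_measure) (auto simp: nn_integral_distr)
qed

lemma sets_q [simp]: "sets (q t x) = sets borel"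
  by (simp add: killed_kernel_def levy_kernel_def)

lemma q_mass: "t \<ge> 0 \<Longrightarrow> (\<integral>\<^sup>+y. 1 \<partial>q t x) = ennreal (exp (- \<theta> * t))"
  by (subst nn_integral_q) (auto simp: emeasure_space_1)

lemma measurable_nn_integral_q:
  assumes t: "t \<ge> 0" and f[measurable]: "f \<in> borel_measurable borel"
  shows "(\<lambda>x. \<integral>\<^sup>+y. f y \<partial>q t x) \<in> borel_measurable borel"
proof -
  note [measurable] = X_measurable[OF t]
  show ?thesis by (simp add: nn_integral_q t)
qed

text \<open>The functional of f is integration against the law of x + X t under w(x) dx, times the
  survival factor. Two such functionals can then be compared on indicators by
  \<open>measure_eqI\<close>, even when the measures are infinite.\<close>

lemma q_representation:
  assumes t: "t \<ge> 0" and w[measurable]: "w \<in> borel_measurable borel"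
  obtains \<nu> where "sets \<nu> = sets borel"
    "\<And>f. f \<in> borel_measurable borel \<Longrightarrow> (\<integral>\<^sup>+x. w x * (\<integral>\<^sup>+y. f y \<partial>q t x) \<partial>lborel) = (\<integral>\<^sup>+y. f y \<partial>\<nu>)"
proof
  note [measurable] = X_measurable[OF t]
  let ?\<nu> = "distr (density (lborel \<Otimes>\<^sub>M M) (\<lambda>p. ennreal (exp (- \<theta> * t)) * w (fst p))) borel (\<lambda>p. fst p + X t (snd p))"
  show "sets ?\<nu> = sets borel" by simp
  fix f :: "real \<Rightarrow> ennreal" assume [measurable]: "f \<in> borel_measurable borel"
  have "(\<integral>\<^sup>+y. f y \<partial>?\<nu>) = (\<integral>\<^sup>+p. ennreal (exp (- \<theta> * t)) * w (fst p) * f (fst p + X t (snd p)) \<partial>(lborel \<Otimes>\<^sub>M M))"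
    by (simp add: nn_integral_distr nn_integral_density)
  also have "\<dots> = (\<integral>\<^sup>+x. \<integral>\<^sup>+\<omega>. ennreal (exp (- \<theta> * t)) * w x * f (x + X t \<omega>) \<partial>M \<partial>lborel)"
    by (subst nn_integral_fst[symmetric]) auto
  also have "\<dots> = (\<integral>\<^sup>+x. w x * (\<integral>\<^sup>+y. f y \<partial>q t x) \<partial>lborel)"
    by (simp add: nn_integral_q t nn_integral_cmult mult_ac)
  finally show "(\<integral>\<^sup>+x. w x * (\<integral>\<^sup>+y. f y \<partial>q t x) \<partial>lborel) = (\<integral>\<^sup>+y. f y \<partial>?\<nu>)" ..
qed

text \<open>The increments over [0, a] and [a, a + b] are independent, the second is distributed
  like X b, and the survival factors multiply.\<close>

lemma chapman_kolmogorov: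
  assumes a: "a \<ge> 0" and b: "b \<ge> 0" and f[measurable]: "f \<in> borel_measurable borel"
  shows "(\<integral>\<^sup>+y. (\<integral>\<^sup>+z. f z \<partial>q b y) \<partial>q a x) = (\<integral>\<^sup>+z. f z \<partial>q (a + b) x)"
proof -
  note [measurable] = X_measurable[OF a] X_measurable[OF b] X_measurable[OF order_refl]
  have [measurable]: "X (a + b) \<in> borel_measurable M" using a b by (intro X_measurable) auto
  define t where "t i = (if i = 0 then 0 else if i = 1 then a else a + b)" for i :: nat
  have ind: "indep_vars (\<lambda>_. borel) (\<lambda>i \<omega>. X (t (Suc i)) \<omega> - X (t i) \<omega>) {..<2}"
    by (rule increments_indep) (auto simp: t_def a b)
  have "indep_var borel (\<lambda>\<omega>. X (t (Suc 0)) \<omega> - X (t 0) \<omega>) borel (\<lambda>\<omega>. X (t (Suc 1)) \<omega> - X (t 1) \<omega>)"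
    by (rule indep_vars_pair[OF ind]) auto
  then have ind': "indep_var borel (\<lambda>\<omega>. X a \<omega> - X 0 \<omega>) borel (\<lambda>\<omega>. X (a + b) \<omega> - X a \<omega>)"
    by (simp add: t_def)
  have "(\<integral>\<^sup>+\<omega>. f (x + X (a + b) \<omega>) \<partial>M) = (\<integral>\<^sup>+\<omega>. (\<lambda>p. f (x + fst p + snd p)) (X a \<omega> - X 0 \<omega>, X (a + b) \<omega> - X a \<omega>) \<partial>M)"
    using X_0 by (intro nn_integral_cong_AE) auto
  also have "\<dots> = (\<integral>\<^sup>+\<omega>. \<integral>\<^sup>+\<omega>'. f (x + (X a \<omega> - X 0 \<omega>) + (X (a + b) \<omega>' - X a \<omega>')) \<partial>M \<partial>M)"
    by (subst indep_nn_integral[OF _ _ indep_varD[OF ind']]) auto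
  also have "\<dots> = (\<integral>\<^sup>+\<omega>. \<integral>\<^sup>+\<omega>'. f (x + (X a \<omega> - X 0 \<omega>) + X b \<omega>') \<partial>M \<partial>M)"
    using nn_integral_increment[of a "a + b" "\<lambda>y. f (z + y)" for z] a b
    by - (rule nn_integral_cong, simp)
  also have "\<dots> = (\<integral>\<^sup>+\<omega>. \<integral>\<^sup>+\<omega>'. f (x + X a \<omega> + X b \<omega>') \<partial>M \<partial>M)"
    using X_0 by (intro nn_integral_cong_AE) auto
  finally have *: "(\<integral>\<^sup>+\<omega>. f (x + X (a + b) \<omega>) \<partial>M) = (\<integral>\<^sup>+\<omega>. \<integral>\<^sup>+\<omega>'. f (x + X a \<omega> + X b \<omega>') \<partial>M \<partial>M)" .
  have "(\<integral>\<^sup>+y. (\<integral>\<^sup>+z. f z \<partial>q b y) \<partial>q a x) =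
      ennreal (exp (- \<theta> * a)) * (ennreal (exp (- \<theta> * b)) * (\<integral>\<^sup>+\<omega>. \<integral>\<^sup>+\<omega>'. f (x + X a \<omega> + X b \<omega>') \<partial>M \<partial>M))"
    using a b measurable_nn_integral_q[OF b f] by (simp add: nn_integral_q nn_integral_cmult)
  also have "\<dots> = ennreal (exp (- \<theta> * (a + b))) * (\<integral>\<^sup>+\<omega>. f (x + X (a + b) \<omega>) \<partial>M)"
    unfolding * by (simp add: ring_distribs exp_add[symmetric] mult.assoc[symmetric] flip: ennreal_mult)
  finally show ?thesis using a b by (simp add: nn_integral_q)
qed

lemma kernel_chain_measurable:
  assumes "\<And>j. i \<le> j \<Longrightarrow> j < i + k \<Longrightarrow> t j \<le> t (Suc j)" "\<And>j. i < j \<Longrightarrow> j \<le> i + k \<Longrightarrow> B j \<in> sets borel"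
  shows "(\<lambda>x. kernel_chain q t B k i x) \<in> borel_measurable borel"
  using assms
proof (induction k arbitrary: i)
  case (Suc k)
  have [measurable]: "B (Suc i) \<in> sets borel" "(\<lambda>x. kernel_chain q t B k (Suc i) x) \<in> borel_measurable borel"
    using Suc by auto
  have "t i \<le> t (Suc i)" using Suc.prems by auto
  then show ?case by (simp add: measurable_nn_integral_q)
next
  case (0 i)
  have "(\<lambda>x. kernel_chain q t B 0 i x) = (\<lambda>_. 1)" by (rule ext) simp
  then show ?case by simp
qed

text \<open>Condition on the first increment: the later ones are independent of it and pose the same
  problem from the new position, while the survival factor splits over the intervals. Killing is
  present in this factor alone; the paths under the integral are unkilled.\<close>

lemma unkilled_chain:
  assumes t0: "0 \<le> t 0" and t: "\<And>j. j < n \<Longrightarrow> t j \<le> t (Suc j)" and B: "\<And>j. j \<le> n \<Longrightarrow> B j \<in> sets borel"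
    and ik: "i + k \<le> n"
  shows "ennreal (exp (- \<theta> * (t (i + k) - t i))) * (\<integral>\<^sup>+\<omega>. (\<Prod>j\<in>{i<..i + k}. indicator (B j) (x + (X (t j) \<omega> - X (t i) \<omega>))) \<partial>M) =
    kernel_chain q t B k i x"
  using ik
proof (induction k arbitrary: i x)
  case 0
  then show ?case by (simp add: emeasure_space_1)
next
  case (Suc k)
  have tmono: "t a \<le> t b" if "a \<le> b" "b \<le> n" for a b
    using that by (induction b rule: dec_induct) (auto intro: order_trans[OF _ t])
  have tnn: "t j \<ge> 0" if "j \<le> n" for j using tmono[of 0 j] t0 that by simp
  have Xm[measurable]: "j \<le> n \<Longrightarrow> X (t j) \<in> borel_measurable M" for j by (intro X_measurable tnn)
  have Bm: "j \<in> {Suc i<..Suc i + k} \<Longrightarrow> B j \<in> sets borel" for j using B Suc.prems by auto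
  have Bi[measurable]: "B (Suc i) \<in> sets borel" using B Suc.prems by auto
  define Y where "Y l \<omega> = X (t (Suc l)) \<omega> - X (t l) \<omega>" for l \<omega>
  \<comment> \<open>Y l leads from t l to t (l + 1), so J collects the k increments that follow the
    first one.\<close>
  define J where "J = {Suc i..<Suc i + k}"
  have ind: "indep_vars (\<lambda>_. borel) Y {..<n}"
    unfolding Y_def using t0 t by (rule increments_indep)
  have Ym[measurable]: "l < n \<Longrightarrow> Y l \<in> borel_measurable M" for l unfolding Y_def[abs_def] by measurable
  have Rm: "(\<lambda>\<omega>. restrict (\<lambda>l. Y l \<omega>) J) \<in> M \<rightarrow>\<^sub>M PiM J (\<lambda>_. borel)"
    by (rule measurable_restrict) (use Suc.prems in \<open>auto simp: J_def intro!: Ym\<close>)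
  have "indep_var (PiM {i} (\<lambda>_. borel)) (\<lambda>\<omega>. restrict (\<lambda>l. Y l \<omega>) {i}) (PiM J (\<lambda>_. borel)) (\<lambda>\<omega>. restrict (\<lambda>l. Y l \<omega>) J)"
    by (rule indep_var_restrict[OF ind]) (use Suc.prems in \<open>auto simp: J_def\<close>)
  note ind1 = indep_varD[OF this]
  have ind2: "prob ((\<lambda>\<omega>. (Y i \<omega>, restrict (\<lambda>l. Y l \<omega>) J)) -` (a \<times> b) \<inter> space M) =
      prob (Y i -` a \<inter> space M) * prob ((\<lambda>\<omega>. restrict (\<lambda>l. Y l \<omega>) J) -` b \<inter> space M)"
    if "a \<in> sets borel" "b \<in> sets (PiM J (\<lambda>_. borel))" for a b
  proof -
    let ?a = "(\<lambda>r. r i) -` a \<inter> space (PiM {i} (\<lambda>_. borel :: real measure))"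
    have "?a \<in> sets (PiM {i} (\<lambda>_. borel))"
      using that by (intro measurable_sets[OF measurable_component_singleton]) auto
    from ind1[OF this that(2)] show ?thesis
      by (simp add: space_PiM vimage_def Int_def)
  qed
  have tel: "X (t j) \<omega> - X (t (Suc i)) \<omega> = (\<Sum>l\<in>{Suc i..<j}. restrict (\<lambda>l. Y l \<omega>) J l)" if "j \<in> {Suc i<..Suc i + k}" for j \<omega>
  proof -
    have "(\<Sum>l\<in>{Suc i..<j}. restrict (\<lambda>l. Y l \<omega>) J l) = (\<Sum>l\<in>{Suc i..<j}. Y l \<omega>)"
      using that by (intro sum.cong) (auto simp: J_def)
    also have "\<dots> = X (t j) \<omega> - X (t (Suc i)) \<omega>"
      unfolding Y_def using that by (intro sum_Suc_diff'[of "Suc i" j "\<lambda>l. X (t l) \<omega>"]) auto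
    finally show ?thesis ..
  qed
  define h :: "real \<times> (nat \<Rightarrow> real) \<Rightarrow> ennreal" where "h = (\<lambda>(y, r). indicator (B (Suc i)) (x + y) * (\<Prod>j\<in>{Suc i<..Suc i + k}. indicator (B j) (x + y + (\<Sum>l\<in>{Suc i..<j}. r l))))"
  have h[measurable]: "h \<in> borel_measurable (borel \<Otimes>\<^sub>M PiM J (\<lambda>_. borel))"
  proof -
    have [measurable]: "(\<lambda>p. \<Sum>l\<in>{Suc i..<j}. snd p l) \<in> borel_measurable ((borel :: real measure) \<Otimes>\<^sub>M PiM J (\<lambda>_. borel :: real measure))"
      if "j \<in> {Suc i<..Suc i + k}" for j
      using that by (intro borel_measurable_sum measurable_compose[OF measurable_snd measurable_component_singleton]) (auto simp: J_def)
    show ?thesis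
      unfolding h_def case_prod_beta
      by (intro borel_measurable_times_ennreal borel_measurable_prod_ennreal measurable_compose[OF _ borel_measurable_indicator[OF Bi]]
          measurable_compose[OF _ borel_measurable_indicator[OF Bm]]) auto
  qed
  have set: "{i<..i + Suc k} = insert (Suc i) {Suc i<..Suc i + k}" by auto
  have "(\<integral>\<^sup>+\<omega>. (\<Prod>j\<in>{i<..i + Suc k}. indicator (B j) (x + (X (t j) \<omega> - X (t i) \<omega>))) \<partial>M) =
      (\<integral>\<^sup>+\<omega>. h (Y i \<omega>, restrict (\<lambda>l. Y l \<omega>) J) \<partial>M)"
  proof (intro nn_integral_cong)
    fix \<omega>
    have "(\<Prod>j\<in>{Suc i<..Suc i + k}. indicator (B j) (x + (X (t j) \<omega> - X (t i) \<omega>))) =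
      (\<Prod>j\<in>{Suc i<..Suc i + k}. indicator (B j) (x + Y i \<omega> + (\<Sum>l\<in>{Suc i..<j}. restrict (\<lambda>l. Y l \<omega>) J l)) :: ennreal)"
    proof (intro prod.cong refl arg_cong2[of _ _ _ _ indicator])
      fix j assume j: "j \<in> {Suc i<..Suc i + k}"
      show "x + (X (t j) \<omega> - X (t i) \<omega>) = x + Y i \<omega> + (\<Sum>l\<in>{Suc i..<j}. restrict (\<lambda>l. Y l \<omega>) J l)"
        unfolding tel[OF j, symmetric] by (simp add: Y_def)
    qed
    then show "(\<Prod>j\<in>{i<..i + Suc k}. indicator (B j) (x + (X (t j) \<omega> - X (t i) \<omega>))) = h (Y i \<omega>, restrict (\<lambda>l. Y l \<omega>) J)"
      unfolding set h_def by (simp add: Y_def)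
  qed
  also have "\<dots> = (\<integral>\<^sup>+\<omega>. (\<integral>\<^sup>+\<omega>'. h (Y i \<omega>, restrict (\<lambda>l. Y l \<omega>') J) \<partial>M) \<partial>M)"
    by (rule indep_nn_integral[OF Ym Rm ind2 h]) (use Suc.prems in auto)
  also have "\<dots> = (\<integral>\<^sup>+\<omega>. indicator (B (Suc i)) (x + Y i \<omega>) *
      (\<integral>\<^sup>+\<omega>'. (\<Prod>j\<in>{Suc i<..Suc i + k}. indicator (B j) (x + Y i \<omega> + (X (t j) \<omega>' - X (t (Suc i)) \<omega>'))) \<partial>M) \<partial>M)"
  proof (intro nn_integral_cong)
    fix \<omega>
    have Xm': "j \<in> {Suc i<..Suc i + k} \<Longrightarrow> X (t j) \<in> borel_measurable M" "X (t (Suc i)) \<in> borel_measurable M" for j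
      using Suc.prems by (auto intro!: Xm)
    have "(\<integral>\<^sup>+\<omega>'. h (Y i \<omega>, restrict (\<lambda>l. Y l \<omega>') J) \<partial>M) = (\<integral>\<^sup>+\<omega>'. indicator (B (Suc i)) (x + Y i \<omega>) *
      (\<Prod>j\<in>{Suc i<..Suc i + k}. indicator (B j) (x + Y i \<omega> + (X (t j) \<omega>' - X (t (Suc i)) \<omega>'))) \<partial>M)"
      unfolding h_def prod.case
      by (intro nn_integral_cong arg_cong2[of _ _ _ _ "(*)"] prod.cong refl) (simp only: tel)
    also have "\<dots> = indicator (B (Suc i)) (x + Y i \<omega>) *
      (\<integral>\<^sup>+\<omega>'. (\<Prod>j\<in>{Suc i<..Suc i + k}. indicator (B j) (x + Y i \<omega> + (X (t j) \<omega>' - X (t (Suc i)) \<omega>'))) \<partial>M)"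
      by (intro nn_integral_cmult borel_measurable_prod_ennreal measurable_compose[OF _ borel_measurable_indicator[OF Bm]]
          borel_measurable_add borel_measurable_diff borel_measurable_const Xm') auto
    finally show "(\<integral>\<^sup>+\<omega>'. h (Y i \<omega>, restrict (\<lambda>l. Y l \<omega>') J) \<partial>M) = \<dots>" .
  qed
  finally have E: "(\<integral>\<^sup>+\<omega>. (\<Prod>j\<in>{i<..i + Suc k}. indicator (B j) (x + (X (t j) \<omega> - X (t i) \<omega>))) \<partial>M) = \<dots>" .
  have mon: "t i \<le> t (Suc i)" "0 \<le> t i" using t tnn Suc.prems by auto
  have Cm[measurable]: "(\<lambda>x. kernel_chain q t B k (Suc i) x) \<in> borel_measurable borel"
    using Suc.prems t B by (intro kernel_chain_measurable) auto
  have [measurable]: "Y i \<in> borel_measurable M" using Suc.prems by (intro Ym) simp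
  let ?e = "ennreal (exp (- \<theta> * (t (i + Suc k) - t (Suc i))))"
  have ex: "ennreal (exp (- \<theta> * (t (i + Suc k) - t i))) = ennreal (exp (- \<theta> * (t (Suc i) - t i))) * ?e"
    by (simp add: exp_add[symmetric] ring_distribs flip: ennreal_mult)
  have "ennreal (exp (- \<theta> * (t (i + Suc k) - t i))) * (\<integral>\<^sup>+\<omega>. (\<Prod>j\<in>{i<..i + Suc k}. indicator (B j) (x + (X (t j) \<omega> - X (t i) \<omega>))) \<partial>M) =
    ennreal (exp (- \<theta> * (t (Suc i) - t i))) * (?e * (\<integral>\<^sup>+\<omega>. indicator (B (Suc i)) (x + Y i \<omega>) *
      (\<integral>\<^sup>+\<omega>'. (\<Prod>j\<in>{Suc i<..Suc i + k}. indicator (B j) (x + Y i \<omega> + (X (t j) \<omega>' - X (t (Suc i)) \<omega>'))) \<partial>M) \<partial>M))"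
    unfolding E ex by (simp only: mult.assoc)
  also have "?e * (\<integral>\<^sup>+\<omega>. indicator (B (Suc i)) (x + Y i \<omega>) *
      (\<integral>\<^sup>+\<omega>'. (\<Prod>j\<in>{Suc i<..Suc i + k}. indicator (B j) (x + Y i \<omega> + (X (t j) \<omega>' - X (t (Suc i)) \<omega>'))) \<partial>M) \<partial>M) =
    (\<integral>\<^sup>+\<omega>. indicator (B (Suc i)) (x + Y i \<omega>) * kernel_chain q t B k (Suc i) (x + Y i \<omega>) \<partial>M)"
  proof -
    define G where "G y = (\<integral>\<^sup>+\<omega>'. (\<Prod>j\<in>{Suc i<..Suc i + k}. indicator (B j) (y + (X (t j) \<omega>' - X (t (Suc i)) \<omega>'))) \<partial>M)" for y
    have IH: "kernel_chain q t B k (Suc i) y = ?e * G y" for y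
      using Suc.IH[of "Suc i" y] Suc.prems by (simp add: G_def)
    \<comment> \<open>The induction hypothesis is solved for G in order to read off its
      measurability.\<close>
    have "G = (\<lambda>y. ennreal (exp (\<theta> * (t (i + Suc k) - t (Suc i)))) * kernel_chain q t B k (Suc i) y)"
      by (simp add: IH mult.assoc[symmetric] exp_add[symmetric] flip: ennreal_mult)
    then have [measurable]: "G \<in> borel_measurable borel" by simp
    show ?thesis
      unfolding IH G_def[symmetric]
      by (subst nn_integral_cmult[symmetric]) (auto intro!: nn_integral_cong simp: mult_ac)
  qed
  also have "(\<integral>\<^sup>+\<omega>. indicator (B (Suc i)) (x + Y i \<omega>) * kernel_chain q t B k (Suc i) (x + Y i \<omega>) \<partial>M) =
     (\<integral>\<^sup>+\<omega>. indicator (B (Suc i)) (x + X (t (Suc i) - t i) \<omega>) * kernel_chain q t B k (Suc i) (x + X (t (Suc i) - t i) \<omega>) \<partial>M)"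
    unfolding Y_def using mon by (subst nn_integral_increment) auto
  also have "ennreal (exp (- \<theta> * (t (Suc i) - t i))) * \<dots> = kernel_chain q t B (Suc k) i x"
    using mon by (simp add: nn_integral_q mult.commute)
  finally show ?case .
qed

end

text \<open>A chain sees the times only through their differences. The offset c thus expresses
  invariance under time shifts, while m drops the first m entries of both sequences.\<close>

lemma kernel_chain_shift:
  "kernel_chain q (\<lambda>j. t (j + m) - c) (\<lambda>j. B (j + m)) k i x = kernel_chain q t B k (i + m) x"
  by (induction k arbitrary: i x) auto

section \<open>Laws of killed paths\<close>

lemma sets_exp_time [simp]: "sets (exp_time \<theta>) = sets borel"
  by (simp add: exp_time_def)

lemma space_exp_time [simp]: "space (exp_time \<theta>) = UNIV"
  by (simp add: exp_time_def)

lemma prob_space_exp_time: "\<theta> \<ge> 0 \<Longrightarrow> prob_space (exp_time \<theta>)"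
  by (auto simp: exp_time_def intro!: prob_space_return prob_space.prob_space_distr prob_space_exponential_density)

lemma emeasure_exp_time_greater:
  assumes \<theta>: "\<theta> \<ge> 0" and s: "s \<ge> 0"
  shows "emeasure (exp_time \<theta>) {\<tau>. ereal s < \<tau>} = ennreal (exp (- \<theta> * s))"
proof (cases "\<theta> = 0")
  case True
  then show ?thesis by (simp add: exp_time_def)
next
  case False
  then have pos: "\<theta> > 0" using \<theta> by simp
  let ?E = "density lborel (exponential_density \<theta>)"
  interpret E: prob_space ?E by (rule prob_space_exponential_density[OF pos])
  have "distributed ?E lborel (\<lambda>x. x) (exponential_density \<theta>)"
    by (auto simp: distributed_def distr_id2)
  from E.exponential_distributedD_gt[OF this s pos] have "measure ?E {x. s < x} = exp (- s * \<theta>)"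
    by simp
  moreover have "emeasure (exp_time \<theta>) {\<tau>. ereal s < \<tau>} = emeasure ?E {x. s < x}"
    using False by (simp add: exp_time_def emeasure_distr vimage_def)
  ultimately show ?thesis by (simp add: E.emeasure_eq_measure mult.commute)
qed

context levy
begin

abbreviation killed_path :: "'a \<times> ereal \<Rightarrow> real \<Rightarrow> ereal" where
  "killed_path \<equiv> \<lambda>(\<omega>, \<tau>). \<lambda>t\<in>{0..}. if ereal t < \<tau> then ereal (X t \<omega>) else -\<infinity>"

lemma killed_path_measurable: "killed_path \<in> M \<Otimes>\<^sub>M exp_time \<theta> \<rightarrow>\<^sub>M path_alg {0..}"
proof -
  have "(\<lambda>p. if ereal t < snd p then ereal (X t (fst p)) else -\<infinity>) \<in> borel_measurable (M \<Otimes>\<^sub>M exp_time \<theta>)" if "t \<in> {0..}" for t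
  proof -
    have [measurable]: "X t \<in> borel_measurable M" using that by (intro X_measurable) simp
    have "(\<lambda>\<tau>. \<tau>) \<in> borel_measurable (exp_time \<theta>)" by (simp add: measurable_ident_sets)
    note [measurable] = measurable_compose[OF measurable_snd this]
    show ?thesis by measurable
  qed
  then show ?thesis unfolding case_prod_beta by (rule measurable_restrict)
qed

lemma prob_space_killed_law: "prob_space (killed_law M X \<theta>)"
proof -
  interpret E: prob_space "exp_time \<theta>" by (rule prob_space_exp_time[OF rate])
  interpret P: pair_prob_space M "exp_time \<theta>" ..
  show ?thesis unfolding killed_law_def by (rule P.prob_space_distr[OF killed_path_measurable])
qed

lemma sets_killed_law [simp]: "sets (killed_law M X \<theta>) = sets (path_alg {0..})"
  by (simp add: killed_law_def)

text \<open>The path is alive at all the times exactly if it is alive at the last one, so the event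
  is a rectangle: a condition on the unkilled process, and an independent lifetime beyond s
  k.\<close>

lemma killed_law_chain:
  assumes s0: "0 \<le> s 0" and s: "\<And>j. j < k \<Longrightarrow> s j \<le> s (Suc j)" and B: "\<And>j. j \<le> k \<Longrightarrow> B j \<in> sets borel"
  shows "emeasure (killed_law M X \<theta>) {f \<in> space (path_alg {0..}). \<forall>j\<le>k. ereal x + f (s j) \<in> ereal ` B j} =
    (\<integral>\<^sup>+y\<in>B 0. kernel_chain q s B k 0 y \<partial>q (s 0) x)"
proof -
  interpret E: prob_space "exp_time \<theta>" by (rule prob_space_exp_time[OF rate])
  have smono: "s a \<le> s b" if "a \<le> b" "b \<le> k" for a b
    using that by (induction b rule: dec_induct) (auto intro: order_trans[OF _ s])
  have snn: "s j \<ge> 0" if "j \<le> k" for j using smono[of 0 j] s0 that by simp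
  define S where "S = {f \<in> space (path_alg {0..}). \<forall>j\<le>k. ereal x + f (s j) \<in> ereal ` B j}"
  have S: "S \<in> sets (path_alg {0..})"
  proof -
    have m: "(\<lambda>f. ereal x + f (s j)) \<in> borel_measurable (path_alg {0..})" if "j \<le> k" for j
      using snn[OF that] by (intro borel_measurable_ereal_add measurable_component_singleton) auto
    have "{f \<in> space (path_alg {0..}). ereal x + f (s j) \<in> ereal ` B j} \<in> sets (path_alg {0..})" if "j \<le> k" for j
      using measurable_sets[OF m[OF that] ereal_image_measurable[OF B[OF that]]] by (simp add: vimage_def Int_def conj_commute)
    then have "{f \<in> space (path_alg {0..}). \<forall>j\<in>{..k}. ereal x + f (s j) \<in> ereal ` B j} \<in> sets (path_alg {0..})"
      by (intro sets.sets_Collect_finite_All) auto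
    moreover have "S = {f \<in> space (path_alg {0..}). \<forall>j\<in>{..k}. ereal x + f (s j) \<in> ereal ` B j}"
      unfolding S_def by (simp only: Ball_def atMost_iff)
    ultimately show ?thesis by (simp only:)
  qed
  define A where "A = {\<omega> \<in> space M. \<forall>j\<le>k. x + X (s j) \<omega> \<in> B j}"
  have Xm[measurable]: "j \<le> k \<Longrightarrow> X (s j) \<in> borel_measurable M" for j by (intro X_measurable snn)
  have A: "A \<in> sets M"
  proof -
    have m: "(\<lambda>\<omega>. x + X (s j) \<omega>) \<in> borel_measurable M" if "j \<le> k" for j using that by measurable
    have "{\<omega> \<in> space M. x + X (s j) \<omega> \<in> B j} \<in> sets M" if "j \<le> k" for j
      using measurable_sets[OF m[OF that] B[OF that]] by (simp add: vimage_def Int_def conj_commute)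
    then have "{\<omega> \<in> space M. \<forall>j\<in>{..k}. x + X (s j) \<omega> \<in> B j} \<in> sets M"
      by (intro sets.sets_Collect_finite_All) auto
    moreover have "A = {\<omega> \<in> space M. \<forall>j\<in>{..k}. x + X (s j) \<omega> \<in> B j}"
      unfolding A_def by (simp only: Ball_def atMost_iff)
    ultimately show ?thesis by (simp only:)
  qed
  have vim: "killed_path -` S \<inter> space (M \<Otimes>\<^sub>M exp_time \<theta>) = A \<times> {\<tau>. ereal (s k) < \<tau>}"
  proof (intro set_eqI)
    fix p :: "'a \<times> ereal"
    obtain \<omega> \<tau> where p: "p = (\<omega>, \<tau>)" by (cases p)
    have "killed_path p \<in> space (path_alg {0..})" by (simp add: p space_PiM)
    moreover have "ereal x + killed_path p (s j) \<in> ereal ` B j \<longleftrightarrow> ereal (s j) < \<tau> \<and> x + X (s j) \<omega> \<in> B j" if "j \<le> k" for j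
      using snn[OF that] by (auto simp: p)
    moreover have "ereal (s j) < \<tau>" if "j \<le> k" "ereal (s k) < \<tau>" for j
      using smono[of j k] that by (intro order.strict_trans1[of "ereal (s j)" "ereal (s k)"]) auto
    then have "(\<forall>j\<le>k. ereal (s j) < \<tau>) \<longleftrightarrow> ereal (s k) < \<tau>" by blast
    ultimately show "p \<in> killed_path -` S \<inter> space (M \<Otimes>\<^sub>M exp_time \<theta>) \<longleftrightarrow> p \<in> A \<times> {\<tau>. ereal (s k) < \<tau>}"
      by (auto simp: S_def A_def p space_pair_measure)
  qed
  \<comment> \<open>Time 0 with the trivial set UNIV is put in front, so that the transition from x
    over [0, s 0] becomes the first step of a chain.\<close>
  define t where "t = case_nat 0 s"
  define B' where "B' = case_nat UNIV B"
  have "emeasure (killed_law M X \<theta>) S = emeasure (M \<Otimes>\<^sub>M exp_time \<theta>) (A \<times> {\<tau>. ereal (s k) < \<tau>})"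
    unfolding killed_law_def vim[symmetric] by (rule emeasure_distr[OF killed_path_measurable S])
  also have "\<dots> = emeasure M A * ennreal (exp (- \<theta> * s k))"
    using A by (subst E.emeasure_pair_measure_Times) (auto simp: emeasure_exp_time_greater rate snn)
  also have "emeasure M A = (\<integral>\<^sup>+\<omega>. (\<Prod>j\<in>{0<..0 + Suc k}. indicator (B' j) (x + (X (t j) \<omega> - X (t 0) \<omega>))) \<partial>M)"
  proof -
    have "emeasure M A = (\<integral>\<^sup>+\<omega>. indicator A \<omega> \<partial>M)" using A by simp
    also have "\<dots> = (\<integral>\<^sup>+\<omega>. (\<Prod>j\<in>{0<..0 + Suc k}. indicator (B' j) (x + (X (t j) \<omega> - X (t 0) \<omega>))) \<partial>M)"
      using X_0 AE_space
    proof (intro nn_integral_cong_AE, eventually_elim)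
      fix \<omega> assume "X 0 \<omega> = 0" and \<omega>: "\<omega> \<in> space M"
      have im: "{0<..0 + Suc k} = Suc ` {..k}" by (auto simp: image_iff Suc_le_eq gr0_conv_Suc)
      have "(\<Prod>j\<in>{0<..0 + Suc k}. indicator (B' j) (x + (X (t j) \<omega> - X (t 0) \<omega>))) = (\<Prod>j\<le>k. indicator (B j) (x + X (s j) \<omega>) :: ennreal)"
        unfolding im by (subst prod.reindex) (auto simp: t_def B'_def \<open>X 0 \<omega> = 0\<close>)
      also have "\<dots> = indicator {\<omega>. \<forall>j\<le>k. x + X (s j) \<omega> \<in> B j} \<omega>"
        by (auto simp: indicator_def prod_zero_iff intro!: prod_zero prod.neutral)
      finally show "indicator A \<omega> = (\<Prod>j\<in>{0<..0 + Suc k}. indicator (B' j) (x + (X (t j) \<omega> - X (t 0) \<omega>)) :: ennreal)"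
        using \<omega> by (simp add: A_def indicator_def)
    qed
    finally show ?thesis .
  qed
  also have "\<dots> * ennreal (exp (- \<theta> * s k)) = ennreal (exp (- \<theta> * (t (0 + Suc k) - t 0))) *
      (\<integral>\<^sup>+\<omega>. (\<Prod>j\<in>{0<..0 + Suc k}. indicator (B' j) (x + (X (t j) \<omega> - X (t 0) \<omega>))) \<partial>M)"
    by (simp add: t_def mult.commute)
  also have "\<dots> = kernel_chain q t B' (Suc k) 0 x"
  proof (rule unkilled_chain[where n="Suc k"])
    show "t j \<le> t (Suc j)" if "j < Suc k" for j using that s0 s by (cases j) (auto simp: t_def)
    show "B' j \<in> sets borel" if "j \<le> Suc k" for j using that B by (cases j) (auto simp: B'_def)
  qed (auto simp: t_def)
  also have "\<dots> = (\<integral>\<^sup>+y\<in>B 0. kernel_chain q s B k 0 y \<partial>q (s 0) x)"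
    using kernel_chain_shift[of q t 1 0 B' k 0] by (simp add: t_def B'_def)
  finally show ?thesis by (simp add: S_def)
qed

end

section \<open>Duality of the forward and the backward process\<close>

text \<open>Read forwards in time, \<open>\<theta>m\<close> is a rate of deaths and
  \<open>\<theta>p\<close> a rate of births, and births are the deaths of the backward process;
  hence the crossed indices.\<close>

locale dual_pair = p: levy M X \<theta>m + m: levy M' X' \<theta>p
  for M :: "'a measure" and X :: "real \<Rightarrow> 'a \<Rightarrow> real" and M' :: "'b measure" and X' :: "real \<Rightarrow> 'b \<Rightarrow> real"
    and \<theta>p \<theta>m :: real +
  assumes dual: "\<And>t. t \<ge> 0 \<Longrightarrow> exp_dual (m.q t) (p.q t)"
begin

text \<open>\<open>exp_dual\<close> tests rectangles only. Each side is integration against a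
  measure in f for fixed g and in g for fixed f, so indicators are replaced by functions in one
  argument at a time.\<close>

lemma duality:
  assumes t: "t \<ge> 0" and f[measurable]: "f \<in> borel_measurable borel" and g[measurable]: "g \<in> borel_measurable borel"
  shows "(\<integral>\<^sup>+x. ennreal (exp (- x)) * f x * (\<integral>\<^sup>+y. g y \<partial>m.q t x) \<partial>lborel) =
    (\<integral>\<^sup>+y. ennreal (exp (- y)) * g y * (\<integral>\<^sup>+x. f x \<partial>p.q t y) \<partial>lborel)"
proof -
  have step1: "(\<integral>\<^sup>+x. ennreal (exp (- x)) * h x * (\<integral>\<^sup>+y. indicator B y \<partial>m.q t x) \<partial>lborel) =
    (\<integral>\<^sup>+y. ennreal (exp (- y)) * indicator B y * (\<integral>\<^sup>+x. h x \<partial>p.q t y) \<partial>lborel)"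
    if B[measurable]: "B \<in> sets borel" and h[measurable]: "h \<in> borel_measurable borel" for B h
  proof -
    have w: "(\<lambda>y. ennreal (exp (- y)) * indicator B y) \<in> borel_measurable borel" by measurable
    obtain \<nu> where \<nu>: "sets \<nu> = sets borel" "\<And>f. f \<in> borel_measurable borel \<Longrightarrow>
        (\<integral>\<^sup>+y. ennreal (exp (- y)) * indicator B y * (\<integral>\<^sup>+x. f x \<partial>p.q t y) \<partial>lborel) = (\<integral>\<^sup>+x. f x \<partial>\<nu>)"
      using p.q_representation[OF t w] by metis
    define w' where "w' x = ennreal (exp (- x)) * (\<integral>\<^sup>+y. indicator B y \<partial>m.q t x)" for x
    have w'[measurable]: "w' \<in> borel_measurable borel"
      unfolding w'_def using m.measurable_nn_integral_q[OF t, of "indicator B"] by measurable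
    have "\<nu> = density lborel w'"
    proof (rule measure_eqI)
      fix A assume "A \<in> sets \<nu>"
      then have A[measurable]: "A \<in> sets borel" using \<nu> by simp
      have "emeasure \<nu> A = (\<integral>\<^sup>+y. ennreal (exp (- y)) * indicator B y * (\<integral>\<^sup>+x. indicator A x \<partial>p.q t y) \<partial>lborel)"
        using \<nu>(2)[of "indicator A"] \<nu>(1) by simp
      also have "\<dots> = (\<integral>\<^sup>+y\<in>B. ennreal (exp (- y)) * emeasure (p.q t y) A \<partial>lborel)"
        by (simp add: mult_ac)
      also have "\<dots> = (\<integral>\<^sup>+x\<in>A. ennreal (exp (- x)) * emeasure (m.q t x) B \<partial>lborel)"
        using dual[OF t] A B by (simp add: exp_dual_def)
      also have "\<dots> = emeasure (density lborel w') A"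
        by (simp add: emeasure_density w'_def)
      finally show "emeasure \<nu> A = emeasure (density lborel w') A" .
    qed (simp add: \<nu>)
    then show ?thesis
      unfolding \<nu>(2)[OF h] by (simp add: nn_integral_density w'_def mult_ac)
  qed
  have w: "(\<lambda>x. ennreal (exp (- x)) * f x) \<in> borel_measurable borel" by measurable
  obtain \<nu> where \<nu>: "sets \<nu> = sets borel" "\<And>g. g \<in> borel_measurable borel \<Longrightarrow>
      (\<integral>\<^sup>+x. ennreal (exp (- x)) * f x * (\<integral>\<^sup>+y. g y \<partial>m.q t x) \<partial>lborel) = (\<integral>\<^sup>+y. g y \<partial>\<nu>)"
    using m.q_representation[OF t w] by metis
  define w' where "w' y = ennreal (exp (- y)) * (\<integral>\<^sup>+x. f x \<partial>p.q t y)" for y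
  have w'[measurable]: "w' \<in> borel_measurable borel"
    unfolding w'_def using p.measurable_nn_integral_q[OF t f] by measurable
  have "\<nu> = density lborel w'"
  proof (rule measure_eqI)
    fix B assume "B \<in> sets \<nu>"
    then have B[measurable]: "B \<in> sets borel" using \<nu> by simp
    have "emeasure \<nu> B = (\<integral>\<^sup>+x. ennreal (exp (- x)) * f x * (\<integral>\<^sup>+y. indicator B y \<partial>m.q t x) \<partial>lborel)"
      using \<nu>(2)[of "indicator B"] \<nu>(1) by simp
    also have "\<dots> = emeasure (density lborel w') B"
      unfolding step1[OF B f] by (simp add: emeasure_density w'_def mult_ac)
    finally show "emeasure \<nu> B = emeasure (density lborel w') B" .
  qed (simp add: \<nu>)
  then show ?thesis
    unfolding \<nu>(2)[OF g] by (simp add: nn_integral_density w'_def mult_ac)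
qed

context
  fixes t :: "nat \<Rightarrow> real" and B :: "nat \<Rightarrow> real set" and n :: nat
  assumes t: "\<And>j. j < n \<Longrightarrow> t j \<le> t (Suc j)" and B: "\<And>j. j \<le> n \<Longrightarrow> B j \<in> sets borel"
begin

text \<open>
  For a path through \<open>B 0, \<dots>, B n\<close>: the mass of its part after time \<open>t i\<close>, run by the first process, and
  of its part before time \<open>t i\<close>, run backwards by the second one, given the position \<open>x\<close> at time \<open>t i\<close>.
  By duality the integral of \<open>e\<^sup>-\<^sup>x * bwd i x * fwd i x\<close> does not depend on \<open>i\<close>.
\<close>

definition fwd :: "nat \<Rightarrow> real \<Rightarrow> ennreal" where
  "fwd i x = indicator (B i) x * kernel_chain p.q t B (n - i) i x"

definition bwd :: "nat \<Rightarrow> real \<Rightarrow> ennreal" where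
  "bwd i x = indicator (B i) x * kernel_chain m.q (\<lambda>j. - t (i - j)) (\<lambda>j. B (i - j)) i 0 x"

definition total :: ennreal where
  "total = (\<integral>\<^sup>+x. ennreal (exp (- x)) * fwd 0 x \<partial>lborel)"

lemma fwd_measurable: "i \<le> n \<Longrightarrow> fwd i \<in> borel_measurable borel"
proof -
  assume i: "i \<le> n"
  have [measurable]: "B i \<in> sets borel" using B i by simp
  have [measurable]: "(\<lambda>x. kernel_chain p.q t B (n - i) i x) \<in> borel_measurable borel"
    using i by (intro p.kernel_chain_measurable t B) auto
  show ?thesis unfolding fwd_def[abs_def] by measurable
qed

lemma bwd_measurable: "i \<le> n \<Longrightarrow> bwd i \<in> borel_measurable borel"
proof -
  assume i: "i \<le> n"
  have [measurable]: "B i \<in> sets borel" using B i by simp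
  have [measurable]: "(\<lambda>x. kernel_chain m.q (\<lambda>j. - t (i - j)) (\<lambda>j. B (i - j)) i 0 x) \<in> borel_measurable borel"
  proof (rule m.kernel_chain_measurable)
    fix j assume "0 \<le> j" "j < 0 + i"
    then show "- t (i - j) \<le> - t (i - Suc j)" using t[of "i - Suc j"] i by (simp add: Suc_diff_Suc)
  qed (use B i in auto)
  show ?thesis unfolding bwd_def[abs_def] by measurable
qed

lemma fwd_step: "i < n \<Longrightarrow> fwd i x = indicator (B i) x * (\<integral>\<^sup>+y. fwd (Suc i) y \<partial>p.q (t (Suc i) - t i) x)"
  unfolding fwd_def by (subst Suc_diff_Suc[symmetric]) (simp_all add: mult.commute)

text \<open>Dropping the first entry of the reversed sequence belonging to i + 1 leaves the one
  belonging to i.\<close>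

lemma bwd_step: "bwd (Suc i) x = indicator (B (Suc i)) x * (\<integral>\<^sup>+y. bwd i y \<partial>m.q (t (Suc i) - t i) x)"
proof -
  have "kernel_chain m.q (\<lambda>j. - t (Suc i - j)) (\<lambda>j. B (Suc i - j)) i (Suc 0) y =
    kernel_chain m.q (\<lambda>j. - t (i - j)) (\<lambda>j. B (i - j)) i 0 y" for y
    using kernel_chain_shift[of m.q "\<lambda>j. - t (Suc i - j)" 1 0 "\<lambda>j. B (Suc i - j)" i 0 y] by simp
  then show ?thesis unfolding bwd_def by (simp add: mult.commute)
qed

text \<open>Duality over the interval from t m to t (m + 1) moves one transition from the forward to
  the backward part without changing the integral; for m = 0 the backward part is trivial.\<close>

lemma bwd_fwd_total:
  assumes "m < n"
  shows "(\<integral>\<^sup>+x. ennreal (exp (- x)) * bwd m x * (\<integral>\<^sup>+y. fwd (Suc m) y \<partial>p.q (t (Suc m) - t m) x) \<partial>lborel) = total"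
  using assms
proof (induction m)
  case 0
  have "bwd 0 x = indicator (B 0) x" for x by (simp add: bwd_def)
  then show ?case using 0 by (simp add: total_def fwd_step mult.assoc)
next
  case (Suc m)
  have tt: "t (Suc m) - t m \<ge> 0" using t[of m] Suc.prems by simp
  have "(\<integral>\<^sup>+x. ennreal (exp (- x)) * bwd (Suc m) x * (\<integral>\<^sup>+y. fwd (Suc (Suc m)) y \<partial>p.q (t (Suc (Suc m)) - t (Suc m)) x) \<partial>lborel) =
    (\<integral>\<^sup>+x. ennreal (exp (- x)) * fwd (Suc m) x * (\<integral>\<^sup>+y. bwd m y \<partial>m.q (t (Suc m) - t m) x) \<partial>lborel)"
    using Suc.prems by (intro nn_integral_cong) (simp only: bwd_step fwd_step mult_ac)
  also have "\<dots> = (\<integral>\<^sup>+y. ennreal (exp (- y)) * bwd m y * (\<integral>\<^sup>+x. fwd (Suc m) x \<partial>p.q (t (Suc m) - t m) y) \<partial>lborel)"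
    using Suc.prems by (intro duality tt fwd_measurable bwd_measurable) auto
  finally show ?case using Suc by simp
qed

text \<open>The last exchange of this kind, after which no forward transition remains.\<close>

lemma bwd_total: "(\<integral>\<^sup>+x. ennreal (exp (- x)) * bwd n x \<partial>lborel) = total"
proof (cases n)
  case 0
  show ?thesis unfolding total_def fwd_def bwd_def using 0 by simp
next
  case (Suc m)
  have tt: "t (Suc m) - t m \<ge> 0" using t[of m] Suc by simp
  have f: "fwd (Suc m) x = indicator (B (Suc m)) x" for x unfolding fwd_def using Suc by simp
  have "bwd n = bwd (Suc m)" by (simp only: Suc)
  then have "(\<integral>\<^sup>+x. ennreal (exp (- x)) * bwd n x \<partial>lborel) =
    (\<integral>\<^sup>+x. ennreal (exp (- x)) * fwd (Suc m) x * (\<integral>\<^sup>+y. bwd m y \<partial>m.q (t (Suc m) - t m) x) \<partial>lborel)"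
    by (intro nn_integral_cong) (simp only: f bwd_step mult_ac)
  also have "\<dots> = (\<integral>\<^sup>+y. ennreal (exp (- y)) * bwd m y * (\<integral>\<^sup>+x. fwd (Suc m) x \<partial>p.q (t (Suc m) - t m) y) \<partial>lborel)"
    using Suc by (intro duality tt fwd_measurable bwd_measurable) auto
  finally show ?thesis using Suc bwd_fwd_total[of m] by simp
qed

text \<open>The start e^(-u) du carries no constraint, so duality turns the forward step over
  [s, t 0] into the total mass of the backward kernel, which is the survival factor.\<close>

lemma plus_total:
  assumes s: "s \<le> t 0"
  shows "(\<integral>\<^sup>+u. ennreal (exp (- u)) * emeasure (killed_law M X \<theta>m)
      {f \<in> space (path_alg {0..}). \<forall>j\<le>n. ereal u + f (t j - s) \<in> ereal ` B j} \<partial>lborel) =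
    ennreal (exp (- \<theta>p * (t 0 - s))) * total"
proof -
  have "emeasure (killed_law M X \<theta>m) {f \<in> space (path_alg {0..}). \<forall>j\<le>n. ereal u + f (t j - s) \<in> ereal ` B j} =
    (\<integral>\<^sup>+y. fwd 0 y \<partial>p.q (t 0 - s) u)" for u
    using p.killed_law_chain[of "\<lambda>j. t j - s" n B u] s t B kernel_chain_shift[of p.q t 0 s B n 0]
    by (simp add: fwd_def mult.commute)
  then have "(\<integral>\<^sup>+u. ennreal (exp (- u)) * emeasure (killed_law M X \<theta>m)
      {f \<in> space (path_alg {0..}). \<forall>j\<le>n. ereal u + f (t j - s) \<in> ereal ` B j} \<partial>lborel) =
    (\<integral>\<^sup>+u. ennreal (exp (- u)) * 1 * (\<integral>\<^sup>+y. fwd 0 y \<partial>p.q (t 0 - s) u) \<partial>lborel)" by simp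
  also have "\<dots> = (\<integral>\<^sup>+u. ennreal (exp (- u)) * fwd 0 u * (\<integral>\<^sup>+y. 1 \<partial>m.q (t 0 - s) u) \<partial>lborel)"
    using s by (intro duality[symmetric] fwd_measurable) auto
  also have "\<dots> = (\<integral>\<^sup>+u. ennreal (exp (- \<theta>p * (t 0 - s))) * (ennreal (exp (- u)) * fwd 0 u) \<partial>lborel)"
    using s by (simp only: m.q_mass diff_ge_0_iff_ge mult_ac)
  also have "\<dots> = ennreal (exp (- \<theta>p * (t 0 - s))) * total"
    unfolding total_def using fwd_measurable[of 0] by (intro nn_integral_cmult) auto
  finally show ?thesis .
qed

text \<open>The backward path meets the times in the order t i, ..., t 0; reflecting the index by j
  to i - j makes its times increasing. It is stated for initial segments because a path running
  through s in both directions uses the backward process for such a segment only.\<close>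

lemma minus_chain:
  assumes i: "i \<le> n" and s: "t i \<le> s"
  shows "emeasure (killed_law M' X' \<theta>p) {f \<in> space (path_alg {0..}). \<forall>j\<le>i. ereal u + f (s - t j) \<in> ereal ` B j} =
    (\<integral>\<^sup>+y. bwd i y \<partial>m.q (s - t i) u)"
proof -
  have "{f \<in> space (path_alg {0..}). \<forall>j\<le>i. ereal u + f (s - t j) \<in> ereal ` B j} =
    {f \<in> space (path_alg {0..}). \<forall>j\<le>i. ereal u + f (s - t (i - j)) \<in> ereal ` B (i - j)}"
    by (metis diff_diff_cancel diff_le_self)
  also have "emeasure (killed_law M' X' \<theta>p) \<dots> =
    (\<integral>\<^sup>+y\<in>B i. kernel_chain m.q (\<lambda>j. s - t (i - j)) (\<lambda>j. B (i - j)) i 0 y \<partial>m.q (s - t i) u)"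
  proof (subst m.killed_law_chain)
    fix j assume "j < i"
    then show "s - t (i - j) \<le> s - t (i - Suc j)" using t[of "i - Suc j"] i by (simp add: Suc_diff_Suc)
  qed (use i s B in auto)
  also have "\<dots> = (\<integral>\<^sup>+y. bwd i y \<partial>m.q (s - t i) u)"
    using kernel_chain_shift[of m.q "\<lambda>j. - t (i - j)" 0 "- s" "\<lambda>j. B (i - j)" i 0]
    by (simp add: bwd_def mult.commute add.commute)
  finally show ?thesis .
qed

lemma minus_total:
  assumes s: "t n \<le> s"
  shows "(\<integral>\<^sup>+u. ennreal (exp (- u)) * emeasure (killed_law M' X' \<theta>p)
      {f \<in> space (path_alg {0..}). \<forall>j\<le>n. ereal u + f (s - t j) \<in> ereal ` B j} \<partial>lborel) =
    ennreal (exp (- \<theta>m * (s - t n))) * total"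
proof -
  have "(\<integral>\<^sup>+u. ennreal (exp (- u)) * emeasure (killed_law M' X' \<theta>p)
      {f \<in> space (path_alg {0..}). \<forall>j\<le>n. ereal u + f (s - t j) \<in> ereal ` B j} \<partial>lborel) =
    (\<integral>\<^sup>+u. ennreal (exp (- u)) * 1 * (\<integral>\<^sup>+y. bwd n y \<partial>m.q (s - t n) u) \<partial>lborel)"
    using minus_chain[of n s] s by simp
  also have "\<dots> = (\<integral>\<^sup>+u. ennreal (exp (- u)) * bwd n u * (\<integral>\<^sup>+y. 1 \<partial>p.q (s - t n) u) \<partial>lborel)"
    using s by (intro duality bwd_measurable) auto
  also have "\<dots> = (\<integral>\<^sup>+u. ennreal (exp (- \<theta>m * (s - t n))) * (ennreal (exp (- u)) * bwd n u) \<partial>lborel)"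
    using s by (simp only: p.q_mass diff_ge_0_iff_ge mult_ac)
  also have "\<dots> = ennreal (exp (- \<theta>m * (s - t n))) * total"
    unfolding bwd_total[symmetric] using bwd_measurable[of n] by (intro nn_integral_cmult) auto
  finally show ?thesis .
qed

text \<open>Given the level u at time s, the two parts are independent. Duality moves the backward
  step over [t m, s] to the forward side, where Chapman-Kolmogorov joins it to the step over
  [s, t (m + 1)]. No unconstrained kernel mass is left over, hence no survival factor.\<close>

lemma mid_total:
  assumes m: "m < n" and s: "t m \<le> s" "s \<le> t (Suc m)"
  shows "(\<integral>\<^sup>+u. ennreal (exp (- u)) *
      (emeasure (killed_law M' X' \<theta>p) {f \<in> space (path_alg {0..}). \<forall>j\<le>m. ereal u + f (s - t j) \<in> ereal ` B j} *
       emeasure (killed_law M X \<theta>m) {f \<in> space (path_alg {0..}). \<forall>j\<in>{Suc m..n}. ereal u + f (t j - s) \<in> ereal ` B j}) \<partial>lborel) = total"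
proof -
  have "emeasure (killed_law M X \<theta>m) {f \<in> space (path_alg {0..}). \<forall>j\<in>{Suc m..n}. ereal u + f (t j - s) \<in> ereal ` B j} =
    (\<integral>\<^sup>+y. fwd (Suc m) y \<partial>p.q (t (Suc m) - s) u)" for u
  proof -
    have "(\<forall>j\<in>{Suc m..n}. P j) \<longleftrightarrow> (\<forall>j\<le>n - Suc m. P (j + Suc m))" for P
    proof
      assume P: "\<forall>j\<le>n - Suc m. P (j + Suc m)"
      show "\<forall>j\<in>{Suc m..n}. P j"
      proof
        fix j assume "j \<in> {Suc m..n}"
        then show "P j" using P[rule_format, of "j - Suc m"] by auto
      qed
    next
      assume P: "\<forall>j\<in>{Suc m..n}. P j"
      show "\<forall>j\<le>n - Suc m. P (j + Suc m)"
      proof (intro allI impI)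
        fix j assume "j \<le> n - Suc m"
        then have "j + Suc m \<in> {Suc m..n}" using m by simp
        then show "P (j + Suc m)" by (rule P[rule_format])
      qed
    qed
    then have "{f \<in> space (path_alg {0..}). \<forall>j\<in>{Suc m..n}. ereal u + f (t j - s) \<in> ereal ` B j} =
      {f \<in> space (path_alg {0..}). \<forall>j\<le>n - Suc m. ereal u + f (t (j + Suc m) - s) \<in> ereal ` B (j + Suc m)}" by simp
    also have "emeasure (killed_law M X \<theta>m) \<dots> = (\<integral>\<^sup>+y\<in>B (Suc m).
        kernel_chain p.q (\<lambda>j. t (j + Suc m) - s) (\<lambda>j. B (j + Suc m)) (n - Suc m) 0 y \<partial>p.q (t (Suc m) - s) u)"
    proof (subst p.killed_law_chain)
      show "t (j + Suc m) - s \<le> t (Suc j + Suc m) - s" if "j < n - Suc m" for j using t[of "j + Suc m"] that m by simp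
    qed (use m s B in auto)
    also have "\<dots> = (\<integral>\<^sup>+y. fwd (Suc m) y \<partial>p.q (t (Suc m) - s) u)"
      by (simp only: kernel_chain_shift fwd_def) (simp add: mult.commute)
    finally show ?thesis .
  qed
  note plus = this
  define F where "F u = (\<integral>\<^sup>+y. fwd (Suc m) y \<partial>p.q (t (Suc m) - s) u)" for u
  have Fm: "F \<in> borel_measurable borel"
    unfolding F_def[abs_def] using m s by (intro p.measurable_nn_integral_q fwd_measurable) auto
  have "(\<integral>\<^sup>+u. ennreal (exp (- u)) *
      (emeasure (killed_law M' X' \<theta>p) {f \<in> space (path_alg {0..}). \<forall>j\<le>m. ereal u + f (s - t j) \<in> ereal ` B j} *
       emeasure (killed_law M X \<theta>m) {f \<in> space (path_alg {0..}). \<forall>j\<in>{Suc m..n}. ereal u + f (t j - s) \<in> ereal ` B j}) \<partial>lborel) =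
    (\<integral>\<^sup>+u. ennreal (exp (- u)) * F u * (\<integral>\<^sup>+y. bwd m y \<partial>m.q (s - t m) u) \<partial>lborel)"
    using m s by (intro nn_integral_cong) (simp only: plus minus_chain F_def mult_ac less_imp_le)
  also have "\<dots> = (\<integral>\<^sup>+y. ennreal (exp (- y)) * bwd m y * (\<integral>\<^sup>+u. F u \<partial>p.q (s - t m) y) \<partial>lborel)"
    using m s by (intro duality Fm bwd_measurable) auto
  also have "\<dots> = (\<integral>\<^sup>+y. ennreal (exp (- y)) * bwd m y * (\<integral>\<^sup>+x. fwd (Suc m) x \<partial>p.q (t (Suc m) - t m) y) \<partial>lborel)"
    unfolding F_def using m s by (subst p.chapman_kolmogorov) (auto intro: fwd_measurable)
  also have "\<dots> = total" by (rule bwd_fwd_total[OF m])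
  finally show ?thesis .
qed

end

end

section \<open>Integrating out the driving paths\<close>

lemma nn_integral_count_space_LIMSEQ:
  assumes A: "incseq A" "\<And>n. finite (A n)" "(\<Union>n. A n) = K"
  shows "(\<lambda>n. \<Sum>k\<in>A n. a k :: ennreal) \<longlonglongrightarrow> (\<integral>\<^sup>+k. a k \<partial>count_space K)"
proof -
  have "(\<lambda>n. \<integral>\<^sup>+k. a k * indicator (A n) k \<partial>count_space K) \<longlonglongrightarrow> (\<integral>\<^sup>+k. a k * indicator K k \<partial>count_space K)"
  proof (rule nn_integral_LIMSEQ)
    show "incseq (\<lambda>n k. a k * indicator (A n) k)"
      using A(1) by (auto simp: incseq_def le_fun_def indicator_def)
    fix k
    show "(\<lambda>n. a k * indicator (A n) k) \<longlonglongrightarrow> a k * indicator K k"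
    proof (cases "k \<in> K")
      case True
      then obtain m where "k \<in> A m" using A(3) by auto
      then have "\<forall>n\<ge>m. k \<in> A n" using A(1) by (auto simp: incseq_def)
      then show ?thesis using True by (intro tendsto_eventually) (auto simp: eventually_sequentially intro!: exI[of _ m])
    next
      case False
      then show ?thesis using A(3) by (auto simp: indicator_def)
    qed
  qed simp
  moreover have "(\<integral>\<^sup>+k. a k * indicator (A n) k \<partial>count_space K) = (\<Sum>k\<in>A n. a k)" for n
  proof -
    have "(\<integral>\<^sup>+k. a k * indicator (A n) k \<partial>count_space K) = (\<Sum>k\<in>A n. a k * indicator (A n) k)"
      using A by (intro nn_integral_count_space') auto
    then show ?thesis by (simp cong: sum.cong)
  qed
  moreover have "(\<integral>\<^sup>+k. a k * indicator K k \<partial>count_space K) = (\<integral>\<^sup>+k. a k \<partial>count_space K)"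
    by (intro nn_integral_cong) auto
  ultimately show ?thesis by simp
qed

fun particle_index :: "particle \<Rightarrow> nat" where
  "particle_index (Central i) = i" | "particle_index (Plus i) = i" | "particle_index (Minus i) = i"

lemma countable_particles: "countable (particles \<theta>p \<theta>m)"
  by (auto simp: particles_def)

text \<open>Truncation by number keeps finitely many particles of each kind, so that drivers can be
  averaged in finite products; the truncations increase to all particles.\<close>

definition first_particles :: "real \<Rightarrow> real \<Rightarrow> nat \<Rightarrow> particle set" where
  "first_particles \<theta>p \<theta>m n = {k \<in> particles \<theta>p \<theta>m. particle_index k < n}"

lemma first_particles_eq: "first_particles \<theta>p \<theta>m n =
   Central ` {..<n} \<union> Plus ` (point_indices \<theta>p \<inter> {..<n}) \<union> Minus ` (point_indices \<theta>m \<inter> {..<n})"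
  by (auto simp: first_particles_def particles_def)

lemma finite_first_particles: "finite (first_particles \<theta>p \<theta>m n)"
  by (simp add: first_particles_eq)

lemma first_particles_limit:
  "(\<lambda>n. \<Sum>k\<in>first_particles \<theta>p \<theta>m n. a k :: ennreal) \<longlonglongrightarrow> (\<integral>\<^sup>+k. a k \<partial>count_space (particles \<theta>p \<theta>m))"
  by (rule nn_integral_count_space_LIMSEQ)
     (auto simp: incseq_def finite_first_particles, auto simp: first_particles_def)

lemma nn_integral_particles:
  "(\<integral>\<^sup>+k. a k \<partial>count_space (particles \<theta>p \<theta>m)) = (\<integral>\<^sup>+i. a (Central i) \<partial>count_space UNIV) +
     (\<integral>\<^sup>+i. a (Plus i) \<partial>count_space (point_indices \<theta>p)) + (\<integral>\<^sup>+i. a (Minus i) \<partial>count_space (point_indices \<theta>m))"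
proof (rule LIMSEQ_unique[OF first_particles_limit])
  have "(\<lambda>n. (\<Sum>i\<in>UNIV \<inter> {..<n}. a (Central i)) + (\<Sum>i\<in>point_indices \<theta>p \<inter> {..<n}. a (Plus i)) + (\<Sum>i\<in>point_indices \<theta>m \<inter> {..<n}. a (Minus i)))
    \<longlonglongrightarrow> (\<integral>\<^sup>+i. a (Central i) \<partial>count_space UNIV) +
     (\<integral>\<^sup>+i. a (Plus i) \<partial>count_space (point_indices \<theta>p)) + (\<integral>\<^sup>+i. a (Minus i) \<partial>count_space (point_indices \<theta>m))"
    by (intro tendsto_add nn_integral_count_space_LIMSEQ) (auto simp: incseq_def)
  moreover have "(\<Sum>k\<in>first_particles \<theta>p \<theta>m n. a k) = (\<Sum>i\<in>UNIV \<inter> {..<n}. a (Central i)) + (\<Sum>i\<in>point_indices \<theta>p \<inter> {..<n}. a (Plus i)) + (\<Sum>i\<in>point_indices \<theta>m \<inter> {..<n}. a (Minus i))" for n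
    unfolding first_particles_eq
    by (subst sum.union_disjoint, simp, simp, blast)+ (simp add: sum.reindex inj_on_def)
  ultimately show "(\<lambda>n. \<Sum>k\<in>first_particles \<theta>p \<theta>m n. a k) \<longlonglongrightarrow> (\<integral>\<^sup>+i. a (Central i) \<partial>count_space UNIV) +
     (\<integral>\<^sup>+i. a (Plus i) \<partial>count_space (point_indices \<theta>p)) + (\<integral>\<^sup>+i. a (Minus i) \<partial>count_space (point_indices \<theta>m))"
    by simp
qed

section \<open>Sums of point masses, intensities and Campbell's formula\<close>

lemma sets_dirac_sum [simp]: "sets (dirac_sum S I x) = sets S"
  by (simp add: dirac_sum_def)

lemma nn_integral_dirac_sum:
  assumes "\<And>i. i \<in> I \<Longrightarrow> x i \<in> space S" and f: "f \<in> borel_measurable S"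
  shows "(\<integral>\<^sup>+y. f y \<partial>dirac_sum S I x) = (\<integral>\<^sup>+i. f (x i) \<partial>count_space I)"
  unfolding dirac_sum_def by (rule nn_integral_distr) (use assms in auto)

lemma emeasure_dirac_sum:
  assumes "\<And>i. i \<in> I \<Longrightarrow> x i \<in> space S" and B: "B \<in> sets S"
  shows "emeasure (dirac_sum S I x) B = emeasure (count_space I) (x -` B \<inter> I)"
  unfolding dirac_sum_def by (subst emeasure_distr[OF _ B]) (use assms(1) in auto)

lemma count_valued_dirac_sum:
  assumes "\<And>i. i \<in> I \<Longrightarrow> x i \<in> space S" and B: "B \<in> sets S"
  shows "count_valued (emeasure (dirac_sum S I x) B)"
proof -
  have "count_valued (emeasure (count_space I) A)" if "A \<subseteq> I" for A
    using that by (cases "finite A") (auto simp: count_valued_def)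
  then show ?thesis by (simp add: emeasure_dirac_sum[OF assms])
qed

lemma sets_intensity_measure [simp]: "sets (intensity_measure \<Omega> S N) = sets S"
  by (simp add: intensity_measure_def)

lemma space_intensity_measure [simp]: "space (intensity_measure \<Omega> S N) = space S"
  by (simp add: intensity_measure_def)

text \<open>\<open>measure_of\<close> has the intended values only once countable additivity is
  verified; exchanging series and expectation supplies it.\<close>

lemma emeasure_intensity_measure:
  assumes N: "N \<in> \<Omega> \<rightarrow>\<^sub>M measure_algebra S" and B: "B \<in> sets S"
  shows "emeasure (intensity_measure \<Omega> S N) B = (\<integral>\<^sup>+\<omega>. emeasure (N \<omega>) B \<partial>\<Omega>)"
  unfolding intensity_measure_def
proof (rule emeasure_measure_of_sigma[OF sets.sigma_algebra_axioms _ _ B])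
  show "positive (sets S) (\<lambda>B. \<integral>\<^sup>+\<omega>. emeasure (N \<omega>) B \<partial>\<Omega>)" by (simp add: positive_def)
  show "countably_additive (sets S) (\<lambda>B. \<integral>\<^sup>+\<omega>. emeasure (N \<omega>) B \<partial>\<Omega>)"
  proof (rule countably_additiveI)
    fix A :: "nat \<Rightarrow> _" assume A: "range A \<subseteq> sets S" "disjoint_family A"
    have "(\<Sum>i. \<integral>\<^sup>+\<omega>. emeasure (N \<omega>) (A i) \<partial>\<Omega>) = (\<integral>\<^sup>+\<omega>. (\<Sum>i. emeasure (N \<omega>) (A i)) \<partial>\<Omega>)"
      using A by (intro nn_integral_suminf[symmetric] measurable_emeasure_point_process[OF N]) auto
    also have "\<dots> = (\<integral>\<^sup>+\<omega>. emeasure (N \<omega>) (\<Union>i. A i) \<partial>\<Omega>)"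
      using A measure_algebra_sets_eq[OF N] by (intro nn_integral_cong suminf_emeasure) auto
    finally show "(\<Sum>i. \<integral>\<^sup>+\<omega>. emeasure (N \<omega>) (A i) \<partial>\<Omega>) = (\<integral>\<^sup>+\<omega>. emeasure (N \<omega>) (\<Union>i. A i) \<partial>\<Omega>)" .
  qed
qed

text \<open>Campbell's formula for a general random measure, extended from sets to
  functions.\<close>

lemma nn_integral_intensity_measure:
  assumes N: "N \<in> \<Omega> \<rightarrow>\<^sub>M measure_algebra S" and f: "f \<in> borel_measurable S"
  shows "(\<integral>\<^sup>+x. f x \<partial>intensity_measure \<Omega> S N) = (\<integral>\<^sup>+\<omega>. (\<integral>\<^sup>+x. f x \<partial>N \<omega>) \<partial>\<Omega>)"
  using f
proof induction
  case (cong f g)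
  have "(\<integral>\<^sup>+x. f x \<partial>N \<omega>) = (\<integral>\<^sup>+x. g x \<partial>N \<omega>)" if "\<omega> \<in> space \<Omega>" for \<omega>
    using cong sets_eq_imp_space_eq[OF measure_algebra_sets_eq[OF N that]] by (intro nn_integral_cong) auto
  moreover have "(\<integral>\<^sup>+x. f x \<partial>intensity_measure \<Omega> S N) = (\<integral>\<^sup>+x. g x \<partial>intensity_measure \<Omega> S N)"
    using cong by (intro nn_integral_cong) auto
  ultimately show ?case using cong by (simp cong: nn_integral_cong)
next
  case (set A)
  then have "(\<integral>\<^sup>+x. indicator A x \<partial>N \<omega>) = emeasure (N \<omega>) A" if "\<omega> \<in> space \<Omega>" for \<omega>
    using measure_algebra_sets_eq[OF N that] by simp
  then show ?case using set emeasure_intensity_measure[OF N set] by (simp cong: nn_integral_cong)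
next
  case (mult u c)
  have "(\<integral>\<^sup>+x. c * u x \<partial>N \<omega>) = c * (\<integral>\<^sup>+x. u x \<partial>N \<omega>)" if "\<omega> \<in> space \<Omega>" for \<omega>
    using mult by (intro nn_integral_cmult borel_measurable_point_process[OF N that])
  then have "(\<integral>\<^sup>+\<omega>. (\<integral>\<^sup>+x. c * u x \<partial>N \<omega>) \<partial>\<Omega>) = c * (\<integral>\<^sup>+\<omega>. (\<integral>\<^sup>+x. u x \<partial>N \<omega>) \<partial>\<Omega>)"
    using measurable_nn_integral_point_process[OF N mult(2)] by (simp add: nn_integral_cmult cong: nn_integral_cong)
  moreover have "u \<in> borel_measurable (intensity_measure \<Omega> S N)" using mult by (simp cong: measurable_cong_sets)
  ultimately show ?case using mult by (simp add: nn_integral_cmult)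
next
  case (add u v)
  have "(\<integral>\<^sup>+x. v x + u x \<partial>N \<omega>) = (\<integral>\<^sup>+x. v x \<partial>N \<omega>) + (\<integral>\<^sup>+x. u x \<partial>N \<omega>)" if "\<omega> \<in> space \<Omega>" for \<omega>
    using add by (intro nn_integral_add borel_measurable_point_process[OF N that])
  then have "(\<integral>\<^sup>+\<omega>. (\<integral>\<^sup>+x. v x + u x \<partial>N \<omega>) \<partial>\<Omega>) = (\<integral>\<^sup>+\<omega>. (\<integral>\<^sup>+x. v x \<partial>N \<omega>) \<partial>\<Omega>) + (\<integral>\<^sup>+\<omega>. (\<integral>\<^sup>+x. u x \<partial>N \<omega>) \<partial>\<Omega>)"
    using measurable_nn_integral_point_process[OF N] add by (simp add: nn_integral_add cong: nn_integral_cong)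
  moreover have "u \<in> borel_measurable (intensity_measure \<Omega> S N)" "v \<in> borel_measurable (intensity_measure \<Omega> S N)"
    using add by (simp_all cong: measurable_cong_sets)
  ultimately show ?case using add by (simp add: nn_integral_add)
next
  case (seq U)
  have U: "U i \<in> borel_measurable (intensity_measure \<Omega> S N)" for i using seq by (simp cong: measurable_cong_sets)
  have inner: "(\<integral>\<^sup>+x. (SUP i. U i) x \<partial>N \<omega>) = (SUP i. \<integral>\<^sup>+x. U i x \<partial>N \<omega>)" if "\<omega> \<in> space \<Omega>" for \<omega>
    unfolding SUP_apply
    using seq by (intro nn_integral_monotone_convergence_SUP borel_measurable_point_process[OF N that])
  have "(\<integral>\<^sup>+\<omega>. (\<integral>\<^sup>+x. (SUP i. U i) x \<partial>N \<omega>) \<partial>\<Omega>) = (\<integral>\<^sup>+\<omega>. (SUP i. \<integral>\<^sup>+x. U i x \<partial>N \<omega>) \<partial>\<Omega>)"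
    using inner by (intro nn_integral_cong)
  also have "\<dots> = (SUP i. \<integral>\<^sup>+\<omega>. (\<integral>\<^sup>+x. U i x \<partial>N \<omega>) \<partial>\<Omega>)"
    using seq measurable_nn_integral_point_process[OF N]
    by (intro nn_integral_monotone_convergence_SUP) (auto simp: incseq_def le_fun_def intro!: nn_integral_mono)
  also have "\<dots> = (SUP i. \<integral>\<^sup>+x. U i x \<partial>intensity_measure \<Omega> S N)" using seq by simp
  also have "\<dots> = (\<integral>\<^sup>+x. (SUP i. U i x) \<partial>intensity_measure \<Omega> S N)"
    using seq U by (intro nn_integral_monotone_convergence_SUP[symmetric])
  finally show ?case by (simp add: SUP_apply image_image)
qed

text \<open>The expected counts are those of \<mu>, so the intensity measure is \<mu>
  itself.\<close>

lemma poisson_campbell: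
  assumes \<Omega>: "prob_space \<Omega>" and N: "poisson_point_process \<Omega> \<mu> N" and cnt: "counting \<Omega> \<mu> N"
    and f: "f \<in> borel_measurable \<mu>"
  shows "(\<integral>\<^sup>+\<omega>. (\<integral>\<^sup>+x. f x \<partial>N \<omega>) \<partial>\<Omega>) = (\<integral>\<^sup>+x. f x \<partial>\<mu>)"
proof -
  note D = poisson_point_processD[OF N]
  have "intensity_measure \<Omega> \<mu> N = \<mu>"
    by (rule measure_eqI) (simp_all add: emeasure_intensity_measure[OF D(2)] poisson_mean_measure[OF \<Omega> N cnt])
  then show ?thesis using nn_integral_intensity_measure[OF D(2) f] by simp
qed

lemma sets_exp_intensity [simp]: "sets exp_intensity = sets borel"
  by (simp add: exp_intensity_def)

lemma space_exp_intensity [simp]: "space exp_intensity = UNIV"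
  by (simp add: exp_intensity_def)

text \<open>The rate intensities live on a restricted half-plane; functions on the plane are pulled
  back along this inclusion.\<close>

lemma measurable_rate_intensity: "(\<lambda>x. x) \<in> rate_intensity I \<theta> \<rightarrow>\<^sub>M borel \<Otimes>\<^sub>M borel"
proof -
  have "fst \<in> rate_intensity I \<theta> \<rightarrow>\<^sub>M borel" "snd \<in> rate_intensity I \<theta> \<rightarrow>\<^sub>M borel"
  proof -
    have "(\<lambda>x. x) \<in> scale_measure (ennreal \<theta>) (restrict_space lborel I) \<rightarrow>\<^sub>M borel"
      by (subst measurable_cong_sets[OF sets_scale_measure refl], rule measurable_restrict_space1) simp
    then show "fst \<in> rate_intensity I \<theta> \<rightarrow>\<^sub>M borel"
      unfolding rate_intensity_def by (rule measurable_compose[OF measurable_fst])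
    have "(\<lambda>x. x) \<in> exp_intensity \<rightarrow>\<^sub>M borel" by (simp add: measurable_ident_sets)
    then show "snd \<in> rate_intensity I \<theta> \<rightarrow>\<^sub>M borel"
      unfolding rate_intensity_def by (rule measurable_compose[OF measurable_snd])
  qed
  then show ?thesis by (intro measurable_Pair[where f=fst and g=snd, simplified]) 
qed

section \<open>The particle system and the independence of its inputs\<close>

text \<open>The probabilistic input with its abbreviations unfolded. Within this locale the three
  kinds of particles are treated uniformly, each by an index, a starting point and a driver.\<close>

locale particle_system = dual_pair M \<xi> M' \<xi>' \<theta>p \<theta>m + prob_space \<Omega>
  for M :: "'a measure" and \<xi> :: "real \<Rightarrow> 'a \<Rightarrow> real" and M' :: "'b measure" and \<xi>' :: "real \<Rightarrow> 'b \<Rightarrow> real"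
    and \<theta>p \<theta>m :: real and \<Omega> :: "'w measure" +
  fixes U Tp Up Tm Um :: "nat \<Rightarrow> 'w \<Rightarrow> real" and L Lp Lm :: "nat \<Rightarrow> 'w \<Rightarrow> real \<Rightarrow> ereal"
  assumes ppp0: "poisson_points \<Omega> exp_intensity UNIV U"
    and ppp_plus: "poisson_points \<Omega> (rate_intensity {0<..} \<theta>p)
                     (point_indices \<theta>p) (\<lambda>i \<omega>. (Tp i \<omega>, Up i \<omega>))"
    and ppp_minus: "poisson_points \<Omega> (rate_intensity {..<0} \<theta>m)
                     (point_indices \<theta>m) (\<lambda>i \<omega>. (Tm i \<omega>, Um i \<omega>))"
    and L_rv: "\<And>i. L i \<in> \<Omega> \<rightarrow>\<^sub>M Dbar"
    and L_law: "\<And>i. distr \<Omega> (path_alg UNIV) (L i) = two_sided_law (killed_law M \<xi> \<theta>m) (killed_law M' \<xi>' \<theta>p)"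
    and Lp_rv: "\<And>i. Lp i \<in> \<Omega> \<rightarrow>\<^sub>M cadlag_space {0..}"
    and Lp_law: "\<And>i. distr \<Omega> (path_alg {0..}) (Lp i) = killed_law M \<xi> \<theta>m"
    and Lm_rv: "\<And>i. Lm i \<in> \<Omega> \<rightarrow>\<^sub>M caglad_space {0..}"
    and Lm_law: "\<And>i. distr \<Omega> (path_alg {0..}) (Lm i) = killed_law M' \<xi>' \<theta>p"
    and indep: "indep_sets (\<lambda>s. case s of
        Points0 \<Rightarrow> generated \<Omega> (\<Pi>\<^sub>M i\<in>UNIV. borel) (\<lambda>\<omega> i. U i \<omega>)
      | PointsPlus \<Rightarrow> generated \<Omega> (\<Pi>\<^sub>M i\<in>point_indices \<theta>p. borel)
                        (\<lambda>\<omega>. \<lambda>i\<in>point_indices \<theta>p. (Tp i \<omega>, Up i \<omega>))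
      | PointsMinus \<Rightarrow> generated \<Omega> (\<Pi>\<^sub>M i\<in>point_indices \<theta>m. borel)
                        (\<lambda>\<omega>. \<lambda>i\<in>point_indices \<theta>m. (Tm i \<omega>, Um i \<omega>))
      | Driver (Central i) \<Rightarrow> generated \<Omega> (path_alg UNIV) (L i)
      | Driver (Plus i) \<Rightarrow> generated \<Omega> (path_alg {0..}) (Lp i)
      | Driver (Minus i) \<Rightarrow> generated \<Omega> (path_alg {0..}) (Lm i)) UNIV"
begin

abbreviation K :: "particle set" where "K \<equiv> particles \<theta>p \<theta>m"

definition input_events :: "input \<Rightarrow> 'w set set" where
  "input_events s = (case s of
        Points0 \<Rightarrow> generated \<Omega> (\<Pi>\<^sub>M i\<in>UNIV. borel) (\<lambda>\<omega> i. U i \<omega>)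
      | PointsPlus \<Rightarrow> generated \<Omega> (\<Pi>\<^sub>M i\<in>point_indices \<theta>p. borel)
                        (\<lambda>\<omega>. \<lambda>i\<in>point_indices \<theta>p. (Tp i \<omega>, Up i \<omega>))
      | PointsMinus \<Rightarrow> generated \<Omega> (\<Pi>\<^sub>M i\<in>point_indices \<theta>m. borel)
                        (\<lambda>\<omega>. \<lambda>i\<in>point_indices \<theta>m. (Tm i \<omega>, Um i \<omega>))
      | Driver (Central i) \<Rightarrow> generated \<Omega> (path_alg UNIV) (L i)
      | Driver (Plus i) \<Rightarrow> generated \<Omega> (path_alg {0..}) (Lp i)
      | Driver (Minus i) \<Rightarrow> generated \<Omega> (path_alg {0..}) (Lm i))"

text \<open>The information carried by a set of inputs; independence is used in the form that
  disjoint sets of inputs generate independent \<sigma>-algebras.\<close>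

definition gen :: "input set \<Rightarrow> 'w measure" where
  "gen A = sigma (space \<Omega>) (\<Union>s\<in>A. input_events s)"

primrec source :: "particle \<Rightarrow> input" where
  "source (Central i) = Points0" | "source (Plus i) = PointsPlus" | "source (Minus i) = PointsMinus"

text \<open>The central particles get the dummy time \<open>0\<close>, so that all marks have the same type.\<close>

primrec point :: "particle \<Rightarrow> 'w \<Rightarrow> real \<times> real" where
  "point (Central i) = (\<lambda>\<omega>. (0, U i \<omega>))"
| "point (Plus i) = (\<lambda>\<omega>. (Tp i \<omega>, Up i \<omega>))"
| "point (Minus i) = (\<lambda>\<omega>. (Tm i \<omega>, Um i \<omega>))"

primrec driver :: "particle \<Rightarrow> 'w \<Rightarrow> real \<Rightarrow> ereal" where
  "driver (Central i) = L i" | "driver (Plus i) = Lp i" | "driver (Minus i) = Lm i"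

primrec mark_space :: "particle \<Rightarrow> (real \<Rightarrow> ereal) measure" where
  "mark_space (Central i) = Dbar" | "mark_space (Plus i) = cadlag_space {0..}" | "mark_space (Minus i) = caglad_space {0..}"

primrec path :: "particle \<Rightarrow> real \<times> real \<Rightarrow> (real \<Rightarrow> ereal) \<Rightarrow> real \<Rightarrow> ereal" where
  "path (Central i) = (\<lambda>p f. central_path (snd p) f)"
| "path (Plus i) = (\<lambda>p f. plus_path (fst p) (snd p) f)"
| "path (Minus i) = (\<lambda>p f. minus_path (fst p) (snd p) f)"

definition X :: "particle \<Rightarrow> 'w \<Rightarrow> real \<Rightarrow> ereal" where
  "X k \<omega> = path k (point k \<omega>) (driver k \<omega>)"

definition N :: "'w \<Rightarrow> (real \<Rightarrow> ereal) measure" where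
  "N \<omega> = dirac_sum Dbar K (\<lambda>k. X k \<omega>)"

lemma input_events_sub: "input_events s \<subseteq> events"
  using indep by (auto simp: indep_sets_def input_events_def[abs_def])

lemma gen_sub: "(\<Union>s\<in>A. input_events s) \<subseteq> Pow (space \<Omega>)"
  using input_events_sub sets.sets_into_space by blast

lemma space_gen [simp]: "space (gen A) = space \<Omega>"
  unfolding gen_def by (rule space_measure_of[OF gen_sub])

lemma sets_gen: "sets (gen A) = sigma_sets (space \<Omega>) (\<Union>s\<in>A. input_events s)"
  unfolding gen_def by (rule sets_measure_of[OF gen_sub])

lemma sets_gen_sub: "sets (gen A) \<subseteq> events"
  unfolding sets_gen using input_events_sub by (intro sets.sigma_sets_subset) auto

lemma measurable_gen: "f \<in> gen A \<rightarrow>\<^sub>M S \<Longrightarrow> f \<in> \<Omega> \<rightarrow>\<^sub>M S"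
  using sets_gen_sub by (auto simp: measurable_def)

lemma measurable_gen_mono: "f \<in> gen A \<rightarrow>\<^sub>M S \<Longrightarrow> A \<subseteq> A' \<Longrightarrow> f \<in> gen A' \<rightarrow>\<^sub>M S"
proof -
  assume "f \<in> gen A \<rightarrow>\<^sub>M S" "A \<subseteq> A'"
  moreover have "sets (gen A) \<subseteq> sets (gen A')"
    unfolding sets_gen using \<open>A \<subseteq> A'\<close> by (intro sigma_sets_mono') auto
  ultimately show ?thesis by (auto simp: measurable_def)
qed

text \<open>Each single input generates a class closed under intersections, so independence passes
  to the \<sigma>-algebras of disjoint groups.\<close>

lemma gen_indep:
  assumes "A \<inter> A' = {}" "a \<in> sets (gen A)" "b \<in> sets (gen A')"
  shows "prob (a \<inter> b) = prob a * prob b"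
proof -
  have ind: "indep_sets input_events (\<Union>j\<in>UNIV. case_bool A A' j)"
    using indep unfolding input_events_def[abs_def] by (rule indep_sets_mono_index[rotated]) simp
  have "indep_sets (\<lambda>j. sigma_sets (space \<Omega>) (\<Union>i\<in>case_bool A A' j. input_events i)) UNIV"
  proof (rule indep_sets_collect_sigma[OF ind])
    show "Int_stable (input_events i)" for i
      by (auto simp: input_events_def generated_def sets.Int_stable split: input.split particle.split)
    show "disjoint_family_on (case_bool A A') UNIV"
      using assms(1) by (auto simp: disjoint_family_on_def split: bool.split)
  qed
  moreover have "(\<lambda>j. sigma_sets (space \<Omega>) (\<Union>i\<in>case_bool A A' j. input_events i)) = case_bool (sets (gen A)) (sets (gen A'))"
    by (auto simp: fun_eq_iff sets_gen split: bool.split)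
  ultimately have "indep_set (sets (gen A)) (sets (gen A'))" by (simp add: indep_set_def)
  then show ?thesis using assms by (intro indep_setD)
qed

lemma indep_gen_nn_integral:
  assumes AA: "A \<inter> A' = {}" and Y: "Y \<in> gen A \<rightarrow>\<^sub>M S" and Z: "Z \<in> gen A' \<rightarrow>\<^sub>M T"
    and h: "h \<in> borel_measurable (S \<Otimes>\<^sub>M T)"
  shows "(\<integral>\<^sup>+\<omega>. h (Y \<omega>, Z \<omega>) \<partial>\<Omega>) = (\<integral>\<^sup>+\<omega>. (\<integral>\<^sup>+\<omega>'. h (Y \<omega>, Z \<omega>') \<partial>\<Omega>) \<partial>\<Omega>)"
proof (rule indep_nn_integral[OF measurable_gen[OF Y] measurable_gen[OF Z] _ h])
  fix a b assume "a \<in> sets S" "b \<in> sets T"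
  then have "Y -` a \<inter> space \<Omega> \<in> sets (gen A)" "Z -` b \<inter> space \<Omega> \<in> sets (gen A')"
    using measurable_sets[OF Y] measurable_sets[OF Z] by auto
  from gen_indep[OF AA this]
  show "prob ((\<lambda>\<omega>. (Y \<omega>, Z \<omega>)) -` (a \<times> b) \<inter> space \<Omega>) = prob (Y -` a \<inter> space \<Omega>) * prob (Z -` b \<inter> space \<Omega>)"
    by (metis (no_types, lifting) Int_assoc Int_commute Int_left_absorb vimage_Times comp_def fst_conv snd_conv ext)
qed

lemma measurable_generated:
  assumes Y: "Y \<in> space \<Omega> \<rightarrow> space S" and s: "s \<in> A" and ev: "input_events s = generated \<Omega> S Y"
  shows "Y \<in> gen A \<rightarrow>\<^sub>M S"
proof (rule measurableI)
  fix a assume "a \<in> sets S"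
  then have "Y -` a \<inter> space \<Omega> \<in> input_events s"
    unfolding ev generated_def by (rule in_vimage_algebra)
  then show "Y -` a \<inter> space (gen A) \<in> sets (gen A)"
    using s by (auto simp: sets_gen)
qed (use Y in auto)

text \<open>The input \<sigma>-algebra comes from the full product of evaluations; since the paths
  are regular, measurability restricts to the space of regular paths.\<close>

lemma driver_measurable: "Driver k \<in> A \<Longrightarrow> driver k \<in> gen A \<rightarrow>\<^sub>M mark_space k"
proof (cases k)
  case (Central i)
  assume A: "Driver k \<in> A"
  have "L i \<in> gen A \<rightarrow>\<^sub>M path_alg UNIV"
    by (rule measurable_generated[OF _ A]) (auto simp: Central input_events_def space_PiM)
  moreover have "L i \<in> space \<Omega> \<rightarrow> space Dbar" using measurable_space[OF L_rv] by auto
  ultimately show ?thesis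
    by (auto simp: Central Dbar_def cadlag_space_def space_restrict_space intro!: measurable_restrict_space2)
next
  case (Plus i)
  assume A: "Driver k \<in> A"
  have sp: "Lp i \<in> space \<Omega> \<rightarrow> space (cadlag_space {0..})" using measurable_space[OF Lp_rv] by auto
  have "Lp i \<in> gen A \<rightarrow>\<^sub>M path_alg {0..}"
    by (rule measurable_generated[OF _ A]) (use sp in \<open>auto simp: Plus input_events_def cadlag_space_def space_restrict_space\<close>)
  then show ?thesis using sp
    by (auto simp: Plus cadlag_space_def space_restrict_space intro!: measurable_restrict_space2)
next
  case (Minus i)
  assume A: "Driver k \<in> A"
  have sp: "Lm i \<in> space \<Omega> \<rightarrow> space (caglad_space {0..})" using measurable_space[OF Lm_rv] by auto
  have "Lm i \<in> gen A \<rightarrow>\<^sub>M path_alg {0..}"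
    by (rule measurable_generated[OF _ A]) (use sp in \<open>auto simp: Minus input_events_def caglad_space_def space_restrict_space\<close>)
  then show ?thesis using sp
    by (auto simp: Minus caglad_space_def space_restrict_space intro!: measurable_restrict_space2)
qed

lemma point_measurable: "k \<in> K \<Longrightarrow> source k \<in> A \<Longrightarrow> point k \<in> gen A \<rightarrow>\<^sub>M borel \<Otimes>\<^sub>M borel"
proof (cases k)
  case (Central i)
  assume A: "source k \<in> A"
  have "(\<lambda>\<omega> i. U i \<omega>) \<in> gen A \<rightarrow>\<^sub>M (\<Pi>\<^sub>M i\<in>UNIV. borel)"
    by (rule measurable_generated[OF _ A]) (auto simp: Central input_events_def space_PiM)
  then have "(\<lambda>\<omega>. U i \<omega>) \<in> gen A \<rightarrow>\<^sub>M borel"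
    by (rule measurable_compose[OF _ measurable_component_singleton]) simp
  then show ?thesis by (simp add: Central)
next
  case (Plus i)
  assume A: "source k \<in> A" and k: "k \<in> K"
  then have i: "i \<in> point_indices \<theta>p" by (auto simp: Plus particles_def)
  have "(\<lambda>\<omega>. \<lambda>i\<in>point_indices \<theta>p. (Tp i \<omega>, Up i \<omega>)) \<in> gen A \<rightarrow>\<^sub>M (\<Pi>\<^sub>M i\<in>point_indices \<theta>p. borel)"
    by (rule measurable_generated[OF _ A]) (auto simp: Plus input_events_def space_PiM)
  from measurable_compose[OF this measurable_component_singleton[OF i]] i
  show ?thesis by (simp add: Plus borel_prod)
next
  case (Minus i)
  assume A: "source k \<in> A" and k: "k \<in> K"
  then have i: "i \<in> point_indices \<theta>m" by (auto simp: Minus particles_def)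
  have "(\<lambda>\<omega>. \<lambda>i\<in>point_indices \<theta>m. (Tm i \<omega>, Um i \<omega>)) \<in> gen A \<rightarrow>\<^sub>M (\<Pi>\<^sub>M i\<in>point_indices \<theta>m. borel)"
    by (rule measurable_generated[OF _ A]) (auto simp: Minus input_events_def space_PiM)
  from measurable_compose[OF this measurable_component_singleton[OF i]] i
  show ?thesis by (simp add: Minus borel_prod)
qed

lemma path_measurable: "(\<lambda>(p, f). path k p f) \<in> (borel \<Otimes>\<^sub>M borel) \<Otimes>\<^sub>M mark_space k \<rightarrow>\<^sub>M Dbar"
proof (cases k)
  case (Central i)
  have "(\<lambda>x. (snd (fst x), snd x)) \<in> ((borel :: real measure) \<Otimes>\<^sub>M (borel :: real measure)) \<Otimes>\<^sub>M Dbar \<rightarrow>\<^sub>M borel \<Otimes>\<^sub>M Dbar"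
    by measurable
  from measurable_compose[OF this measurable_central_path] show ?thesis by (simp add: Central case_prod_beta)
next
  case (Plus i)
  have "(\<lambda>(p, f). plus_path (fst p) (snd p) f) = (\<lambda>((s, u), f). plus_path s u f)" by auto
  then show ?thesis using measurable_plus_path by (simp add: Plus)
next
  case (Minus i)
  have "(\<lambda>(p, f). minus_path (fst p) (snd p) f) = (\<lambda>((s, u), f). minus_path s u f)" by auto
  then show ?thesis using measurable_minus_path by (simp add: Minus)
qed

lemma X_gen_measurable:
  assumes "k \<in> K" "source k \<in> A" "Driver k \<in> A" shows "X k \<in> gen A \<rightarrow>\<^sub>M Dbar"
proof -
  have "(\<lambda>\<omega>. (point k \<omega>, driver k \<omega>)) \<in> gen A \<rightarrow>\<^sub>M (borel \<Otimes>\<^sub>M borel) \<Otimes>\<^sub>M mark_space k"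
    using point_measurable[OF assms(1,2)] driver_measurable[OF assms(3)] by (rule measurable_Pair)
  from measurable_compose[OF this path_measurable[of k]] show ?thesis by (simp add: X_def[abs_def])
qed

lemma X_measurable: "k \<in> K \<Longrightarrow> X k \<in> \<Omega> \<rightarrow>\<^sub>M Dbar"
  by (rule measurable_gen[OF X_gen_measurable[where A=UNIV]]) auto

lemma X_space: "k \<in> K \<Longrightarrow> \<omega> \<in> space \<Omega> \<Longrightarrow> X k \<omega> \<in> space Dbar"
  using measurable_space[OF X_measurable] .

lemma nn_integral_N:
  "\<omega> \<in> space \<Omega> \<Longrightarrow> f \<in> borel_measurable Dbar \<Longrightarrow> (\<integral>\<^sup>+x. f x \<partial>N \<omega>) = (\<integral>\<^sup>+k. f (X k \<omega>) \<partial>count_space K)"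
  unfolding N_def by (rule nn_integral_dirac_sum) (auto intro: X_space)

lemma counting_N: "counting \<Omega> Dbar N"
  unfolding counting_def N_def by (auto intro!: count_valued_dirac_sum X_space)

lemma N_measurable: "N \<in> \<Omega> \<rightarrow>\<^sub>M measure_algebra Dbar"
proof (rule measurable_measure_algebraI)
  fix B assume B: "B \<in> sets Dbar"
  have "(\<lambda>\<omega>. \<integral>\<^sup>+k. indicator B (X k \<omega>) \<partial>count_space K) \<in> borel_measurable \<Omega>"
  proof (rule borel_measurable_LIMSEQ_order[OF first_particles_limit])
    have "(\<lambda>\<omega>. indicator B (X k \<omega>) :: ennreal) \<in> borel_measurable \<Omega>" if "k \<in> K" for k
      by (rule measurable_compose[OF X_measurable[OF that] borel_measurable_indicator[OF B]])
    then show "(\<lambda>\<omega>. \<Sum>k\<in>first_particles \<theta>p \<theta>m n. indicator B (X k \<omega>) :: ennreal) \<in> borel_measurable \<Omega>" for n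
      by (intro borel_measurable_sum) (auto simp: first_particles_def)
  qed
  moreover have "emeasure (N \<omega>) B = (\<integral>\<^sup>+k. indicator B (X k \<omega>) \<partial>count_space K)" if "\<omega> \<in> space \<Omega>" for \<omega>
    using nn_integral_N[OF that, of "indicator B"] B by (simp add: N_def)
  ultimately show "(\<lambda>\<omega>. emeasure (N \<omega>) B) \<in> borel_measurable \<Omega>" by (simp cong: measurable_cong)
qed (simp add: N_def)

text \<open>The conditional expectation of f at the trajectory of k, given the starting point
  p.\<close>

definition mark_avg :: "particle \<Rightarrow> ((real \<Rightarrow> ereal) \<Rightarrow> ennreal) \<Rightarrow> real \<times> real \<Rightarrow> ennreal" where
  "mark_avg k f p = (\<integral>\<^sup>+\<omega>. f (path k p (driver k \<omega>)) \<partial>\<Omega>)"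

lemma mark_avg_measurable:
  assumes f: "f \<in> borel_measurable Dbar"
  shows "mark_avg k f \<in> borel_measurable (borel \<Otimes>\<^sub>M borel)"
proof -
  have d: "driver k \<in> \<Omega> \<rightarrow>\<^sub>M mark_space k" by (rule measurable_gen[OF driver_measurable[where A=UNIV]]) simp
  have "(\<lambda>x. (fst x, driver k (snd x))) \<in> (borel \<Otimes>\<^sub>M borel) \<Otimes>\<^sub>M \<Omega> \<rightarrow>\<^sub>M (borel \<Otimes>\<^sub>M borel) \<Otimes>\<^sub>M mark_space k"
    using d by measurable
  from measurable_compose[OF measurable_compose[OF this path_measurable] f]
  show ?thesis
    unfolding mark_avg_def[abs_def] by (intro borel_measurable_nn_integral) (simp add: case_prod_beta)
qed

text \<open>W and the starting point of k are determined by inputs other than the driver of k, so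
  this driver may be replaced by an independent copy and averaged.\<close>

lemma integrate_mark:
  assumes f: "f \<in> borel_measurable Dbar" and k: "k \<in> K" and W: "W \<in> borel_measurable (gen (- {Driver k}))"
  shows "(\<integral>\<^sup>+\<omega>. W \<omega> * f (X k \<omega>) \<partial>\<Omega>) = (\<integral>\<^sup>+\<omega>. W \<omega> * mark_avg k f (point k \<omega>) \<partial>\<Omega>)"
proof -
  have s: "source k \<in> - {Driver k}" by (cases k) auto
  have Y: "(\<lambda>\<omega>. (W \<omega>, point k \<omega>)) \<in> gen (- {Driver k}) \<rightarrow>\<^sub>M borel \<Otimes>\<^sub>M (borel \<Otimes>\<^sub>M borel)"
    using W point_measurable[OF k s] by (rule measurable_Pair)
  have Z: "driver k \<in> gen {Driver k} \<rightarrow>\<^sub>M mark_space k" by (rule driver_measurable) simp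
  have "(\<lambda>x. (snd (fst x), snd x)) \<in> ((borel :: ennreal measure) \<Otimes>\<^sub>M (borel \<Otimes>\<^sub>M borel)) \<Otimes>\<^sub>M mark_space k \<rightarrow>\<^sub>M (borel \<Otimes>\<^sub>M borel) \<Otimes>\<^sub>M mark_space k"
    by measurable
  note [measurable] = measurable_compose[OF measurable_compose[OF this path_measurable] f, unfolded case_prod_beta fst_conv snd_conv]
  have h: "(\<lambda>x. fst (fst x) * f (path k (snd (fst x)) (snd x))) \<in> borel_measurable (((borel :: ennreal measure) \<Otimes>\<^sub>M (borel \<Otimes>\<^sub>M borel)) \<Otimes>\<^sub>M mark_space k)"
    by measurable
  have dm: "(\<lambda>\<omega>'. f (path k p (driver k \<omega>'))) \<in> borel_measurable \<Omega>" for p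
  proof -
    have "(\<lambda>\<omega>'. (p, driver k \<omega>')) \<in> \<Omega> \<rightarrow>\<^sub>M (borel \<Otimes>\<^sub>M borel) \<Otimes>\<^sub>M mark_space k"
      using measurable_gen[OF Z] by (intro measurable_Pair) (auto simp: space_pair_measure intro!: measurable_const)
    from measurable_compose[OF measurable_compose[OF this path_measurable] f] show ?thesis by simp
  qed
  have "(\<integral>\<^sup>+\<omega>. W \<omega> * f (X k \<omega>) \<partial>\<Omega>) = (\<integral>\<^sup>+\<omega>. (\<integral>\<^sup>+\<omega>'. W \<omega> * f (path k (point k \<omega>) (driver k \<omega>')) \<partial>\<Omega>) \<partial>\<Omega>)"
    using indep_gen_nn_integral[OF _ Y Z h] by (simp add: X_def)
  also have "\<dots> = (\<integral>\<^sup>+\<omega>. W \<omega> * mark_avg k f (point k \<omega>) \<partial>\<Omega>)"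
    unfolding mark_avg_def by (intro nn_integral_cong nn_integral_cmult dm)
  finally show ?thesis .
qed

text \<open>The drivers are averaged one by one. Factors already averaged depend on starting points
  only and are therefore admissible in the weight for the next driver.\<close>

lemma integrate_marks:
  assumes f: "f \<in> borel_measurable Dbar" and F: "finite F" "F \<subseteq> K"
    and W: "W \<in> borel_measurable (gen (- (Driver ` F)))"
  shows "(\<integral>\<^sup>+\<omega>. W \<omega> * (\<Prod>k\<in>F. f (X k \<omega>)) \<partial>\<Omega>) = (\<integral>\<^sup>+\<omega>. W \<omega> * (\<Prod>k\<in>F. mark_avg k f (point k \<omega>)) \<partial>\<Omega>)"
  using F W
proof (induction F arbitrary: W rule: finite_induct)
  case (insert a F)
  have a: "a \<in> K" and FK: "F \<subseteq> K" using insert.prems by auto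
  have src: "source k \<in> - (Driver ` G)" for k G by (cases k) auto
  have "(\<lambda>\<omega>. W \<omega> * f (X a \<omega>)) \<in> borel_measurable (gen (- (Driver ` F)))"
  proof (rule borel_measurable_times_ennreal)
    show "W \<in> borel_measurable (gen (- (Driver ` F)))"
      using insert.prems(2) by (rule measurable_gen_mono) auto
    show "(\<lambda>\<omega>. f (X a \<omega>)) \<in> borel_measurable (gen (- (Driver ` F)))"
      using insert.hyps by (intro measurable_compose[OF X_gen_measurable f] a src) auto
  qed
  from insert.IH[OF FK this]
  have "(\<integral>\<^sup>+\<omega>. W \<omega> * (\<Prod>k\<in>insert a F. f (X k \<omega>)) \<partial>\<Omega>) =
      (\<integral>\<^sup>+\<omega>. (W \<omega> * (\<Prod>k\<in>F. mark_avg k f (point k \<omega>))) * f (X a \<omega>) \<partial>\<Omega>)"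
    using insert.hyps by (simp add: mult_ac)
  also have "\<dots> = (\<integral>\<^sup>+\<omega>. (W \<omega> * (\<Prod>k\<in>F. mark_avg k f (point k \<omega>))) * mark_avg a f (point a \<omega>) \<partial>\<Omega>)"
  proof (rule integrate_mark[OF f a])
    have pm: "point k \<in> gen (- {Driver a}) \<rightarrow>\<^sub>M borel \<Otimes>\<^sub>M borel" if "k \<in> F" for k
      using FK that by (intro point_measurable) (use src[of k "{a}"] in auto)
    show "(\<lambda>\<omega>. W \<omega> * (\<Prod>k\<in>F. mark_avg k f (point k \<omega>))) \<in> borel_measurable (gen (- {Driver a}))"
      by (intro borel_measurable_times_ennreal borel_measurable_prod_ennreal measurable_gen_mono[OF insert.prems(2)]
          measurable_compose[OF pm mark_avg_measurable[OF f]]) auto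
  qed
  finally show ?case using insert.hyps by (simp add: mult_ac)
qed simp

end

text \<open>The laws are prescribed on the full product, where measurability of the set S of regular
  paths is not at hand. But every measurable set of the restricted space is the trace on S of one in
  the product, and variables with values in S do not distinguish the two.\<close>

lemma nn_integral_law_restrict_eq:
  assumes L: "L1 \<in> \<Omega> \<rightarrow>\<^sub>M restrict_space P S" "L2 \<in> \<Omega> \<rightarrow>\<^sub>M restrict_space P S"
    and eq: "distr \<Omega> P L1 = distr \<Omega> P L2" and f: "f \<in> borel_measurable (restrict_space P S)"
  shows "(\<integral>\<^sup>+\<omega>. f (L1 \<omega>) \<partial>\<Omega>) = (\<integral>\<^sup>+\<omega>. f (L2 \<omega>) \<partial>\<Omega>)"
proof -
  have "distr \<Omega> (restrict_space P S) L1 = distr \<Omega> (restrict_space P S) L2"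
  proof (rule measure_eqI)
    fix A assume A: "A \<in> sets (distr \<Omega> (restrict_space P S) L1)"
    then obtain A' where A': "A' \<in> sets P" "A = S \<inter> A'" by (auto simp: sets_restrict_space)
    have "emeasure (distr \<Omega> (restrict_space P S) L) A = emeasure (distr \<Omega> P L) A'" if L: "L \<in> \<Omega> \<rightarrow>\<^sub>M restrict_space P S" for L
    proof -
      have LP: "L \<in> \<Omega> \<rightarrow>\<^sub>M P" and LS: "\<And>\<omega>. \<omega> \<in> space \<Omega> \<Longrightarrow> L \<omega> \<in> S"
        using L by (auto simp: measurable_restrict_space2_iff)
      have "L -` A \<inter> space \<Omega> = L -` A' \<inter> space \<Omega>" using LS A' by auto
      then show ?thesis using L LP A A' by (simp add: emeasure_distr)
    qed
    then show "emeasure (distr \<Omega> (restrict_space P S) L1) A = emeasure (distr \<Omega> (restrict_space P S) L2) A"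
      using L eq by simp
  qed simp
  then have "(\<integral>\<^sup>+x. f x \<partial>distr \<Omega> (restrict_space P S) L1) = (\<integral>\<^sup>+x. f x \<partial>distr \<Omega> (restrict_space P S) L2)" by simp
  then show ?thesis using L f by (simp add: nn_integral_distr)
qed

section \<open>Integrals over starting levels and starting times\<close>

lemma nn_integral_exp_intensity:
  "f \<in> borel_measurable borel \<Longrightarrow> (\<integral>\<^sup>+u. f u \<partial>exp_intensity) = (\<integral>\<^sup>+u. ennreal (exp (- u)) * f u \<partial>lborel)"
  unfolding exp_intensity_def by (subst nn_integral_density) auto

lemma sigma_finite_exp_intensity: "sigma_finite_measure exp_intensity"
  unfolding exp_intensity_def
  by (subst sigma_finite_measure.sigma_finite_iff_density_finite[OF lborel.sigma_finite_measure_axioms]) auto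

lemma nn_integral_rate_intensity:
  assumes I: "I \<in> sets borel" and f: "f \<in> borel_measurable (borel \<Otimes>\<^sub>M borel)"
  shows "(\<integral>\<^sup>+p. f p \<partial>rate_intensity I \<theta>) =
    (\<integral>\<^sup>+s. ennreal \<theta> * indicator I s * (\<integral>\<^sup>+u. ennreal (exp (- u)) * f (s, u) \<partial>lborel) \<partial>lborel)"
proof -
  interpret E: sigma_finite_measure exp_intensity by (rule sigma_finite_exp_intensity)
  note [measurable] = f I
  let ?g = "\<lambda>s. \<integral>\<^sup>+u. ennreal (exp (- u)) * f (s, u) \<partial>lborel"
  have g[measurable]: "?g \<in> borel_measurable borel" by measurable
  have f': "f \<in> borel_measurable (scale_measure (ennreal \<theta>) (restrict_space lborel I) \<Otimes>\<^sub>M exp_intensity)"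
    using measurable_compose[OF measurable_rate_intensity f] by (simp add: rate_intensity_def)
  have "(\<integral>\<^sup>+p. f p \<partial>rate_intensity I \<theta>) = (\<integral>\<^sup>+s. \<integral>\<^sup>+u. f (s, u) \<partial>exp_intensity \<partial>scale_measure (ennreal \<theta>) (restrict_space lborel I))"
    unfolding rate_intensity_def by (rule E.nn_integral_fst[symmetric, OF f'])
  also have "\<dots> = (\<integral>\<^sup>+s. ?g s \<partial>scale_measure (ennreal \<theta>) (restrict_space lborel I))"
    by (subst nn_integral_exp_intensity) auto
  also have "\<dots> = ennreal \<theta> * (\<integral>\<^sup>+s. ?g s \<partial>restrict_space lborel I)"
    by (intro nn_integral_scale_measure measurable_restrict_space1) simp
  also have "(\<integral>\<^sup>+s. ?g s \<partial>restrict_space lborel I) = (\<integral>\<^sup>+s. ?g s * indicator I s \<partial>lborel)"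
    using I by (intro nn_integral_restrict_space) auto
  also have "ennreal \<theta> * \<dots> = (\<integral>\<^sup>+s. ennreal \<theta> * (?g s * indicator I s) \<partial>lborel)"
    by (intro nn_integral_cmult[symmetric]) measurable
  finally show ?thesis by (simp add: mult_ac)
qed

text \<open>Births at rate \<theta> up to time t, each weighted by the survival factor over the rest
  of the interval. The antiderivative needs the closed interval, which differs by the null set
  {0}.\<close>

lemma birth_integral:
  assumes "\<theta> \<ge> 0" "t \<ge> 0"
  shows "(\<integral>\<^sup>+s. ennreal \<theta> * indicator {0<..} s * (indicator {..t} s * ennreal (exp (- \<theta> * (t - s)))) \<partial>lborel) = ennreal (1 - exp (- \<theta> * t))"
proof -
  have "(\<integral>\<^sup>+s. ennreal \<theta> * indicator {0<..} s * (indicator {..t} s * ennreal (exp (- \<theta> * (t - s)))) \<partial>lborel) =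
    (\<integral>\<^sup>+s. ennreal (\<theta> * exp (- \<theta> * (t - s))) * indicator {0..t} s \<partial>lborel)"
    using AE_lborel_singleton[of "0::real"]
  proof (intro nn_integral_cong_AE, eventually_elim)
    fix s :: real assume "s \<noteq> 0"
    then show "ennreal \<theta> * indicator {0<..} s * (indicator {..t} s * ennreal (exp (- \<theta> * (t - s)))) =
      ennreal (\<theta> * exp (- \<theta> * (t - s))) * indicator {0..t} s"
      using assms by (auto simp: indicator_def ennreal_mult)
  qed
  also have "\<dots> = ennreal (exp (- \<theta> * (t - t)) - exp (- \<theta> * (t - 0)))"
    using assms by (intro nn_integral_FTC_Icc[where F="\<lambda>s. exp (- \<theta> * (t - s))"])
      (auto intro!: derivative_eq_intros)
  finally show ?thesis by simp
qed

lemma death_integral: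
  assumes "\<theta> \<ge> 0" "t \<le> 0"
  shows "(\<integral>\<^sup>+s. ennreal \<theta> * indicator {..<0} s * (indicator {t<..} s * ennreal (exp (- \<theta> * (s - t)))) \<partial>lborel) = ennreal (1 - exp (\<theta> * t))"
proof -
  have "(\<integral>\<^sup>+s. ennreal \<theta> * indicator {..<0} s * (indicator {t<..} s * ennreal (exp (- \<theta> * (s - t)))) \<partial>lborel) =
    (\<integral>\<^sup>+s. ennreal (\<theta> * exp (- \<theta> * (s - t))) * indicator {t..0} s \<partial>lborel)"
    using AE_lborel_singleton[of "0::real"] AE_lborel_singleton[of t]
  proof (intro nn_integral_cong_AE, eventually_elim)
    fix s :: real assume "s \<noteq> 0" "s \<noteq> t"
    then show "ennreal \<theta> * indicator {..<0} s * (indicator {t<..} s * ennreal (exp (- \<theta> * (s - t)))) =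
      ennreal (\<theta> * exp (- \<theta> * (s - t))) * indicator {t..0} s"
      using assms by (auto simp: indicator_def ennreal_mult)
  qed
  also have "\<dots> = ennreal (- exp (- \<theta> * (0 - t)) - - exp (- \<theta> * (t - t)))"
    using assms by (intro nn_integral_FTC_Icc[where F="\<lambda>s. - exp (- \<theta> * (s - t))"])
      (auto intro!: derivative_eq_intros)
  finally show ?thesis by simp
qed

lemma path_cylinder_measurable:
  assumes "finite J" "\<And>j. j \<in> J \<Longrightarrow> s j \<in> I" "\<And>j. j \<in> J \<Longrightarrow> B j \<in> sets borel"
  shows "{f \<in> space (path_alg I). \<forall>j\<in>J. ereal u + f (s j) \<in> ereal ` B j} \<in> sets (path_alg I)"
proof (rule sets.sets_Collect_finite_All[OF _ assms(1)])
  fix j assume j: "j \<in> J"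
  have "(\<lambda>f. ereal u + f (s j)) \<in> borel_measurable (path_alg I)"
    using assms(2)[OF j] by (intro borel_measurable_ereal_add measurable_component_singleton) auto
  from measurable_sets[OF this ereal_image_measurable[OF assms(3)[OF j]]]
  show "{f \<in> space (path_alg I). ereal u + f (s j) \<in> ereal ` B j} \<in> sets (path_alg I)"
    by (simp add: vimage_def Int_def conj_commute)
qed

text \<open>Evaluations at nonnegative times depend on the first component only and the others on
  the second, so the event is a rectangle; time 0 belongs to the forward part.\<close>

lemma emeasure_two_sided_law:
  fixes n :: nat
  assumes P: "prob_space P" "sets P = sets (path_alg {0..})" and Q: "prob_space Q" "sets Q = sets (path_alg {0..})"
    and B: "\<And>j. j \<le> n \<Longrightarrow> B j \<in> sets borel"
  shows "emeasure (two_sided_law P Q) {f \<in> space (path_alg UNIV). \<forall>j\<in>{..n}. ereal u + f (t j) \<in> ereal ` B j} =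
    emeasure P {f \<in> space (path_alg {0..}). \<forall>j\<in>{j. j \<le> n \<and> t j \<ge> 0}. ereal u + f (t j) \<in> ereal ` B j} *
    emeasure Q {f \<in> space (path_alg {0..}). \<forall>j\<in>{j. j \<le> n \<and> t j < 0}. ereal u + f (- t j) \<in> ereal ` B j}"
    (is "emeasure _ ?S = emeasure P ?A * emeasure Q ?B")
proof -
  interpret P: prob_space P by fact
  interpret Q: prob_space Q by fact
  let ?F = "\<lambda>(f, g) t. if t \<ge> 0 then f t else g (- t :: real) :: ereal"
  have spP: "space P = space (path_alg {0..})" and spQ: "space Q = space (path_alg {0..})"
    using P(2) Q(2) by (auto dest: sets_eq_imp_space_eq)
  have F: "?F \<in> P \<Otimes>\<^sub>M Q \<rightarrow>\<^sub>M path_alg UNIV"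
  proof (rule measurable_PiM_single')
    fix s :: real
    have "(\<lambda>f. f s) \<in> borel_measurable P" if "s \<ge> 0"
      using that by (subst measurable_cong_sets[OF P(2) refl]) (auto intro: measurable_component_singleton)
    moreover have "(\<lambda>g. g (- s)) \<in> borel_measurable Q" if "\<not> s \<ge> 0"
      using that by (subst measurable_cong_sets[OF Q(2) refl]) (auto intro: measurable_component_singleton)
    ultimately show "(\<lambda>p. ?F p s) \<in> borel_measurable (P \<Otimes>\<^sub>M Q)"
      by (cases "s \<ge> 0") (auto simp: case_prod_beta intro: measurable_compose[OF measurable_fst] measurable_compose[OF measurable_snd])
  qed (auto simp: PiE_def)
  have "emeasure (two_sided_law P Q) ?S = emeasure (P \<Otimes>\<^sub>M Q) (?F -` ?S \<inter> space (P \<Otimes>\<^sub>M Q))"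
    unfolding two_sided_law_def using B
    by (intro emeasure_distr[OF F] path_cylinder_measurable) auto
  also have "?F -` ?S \<inter> space (P \<Otimes>\<^sub>M Q) = ?A \<times> ?B"
  proof (intro set_eqI)
    fix p :: "(real \<Rightarrow> ereal) \<times> (real \<Rightarrow> ereal)"
    obtain f g where p: "p = (f, g)" by (cases p)
    have "(\<forall>j\<in>{..n}. ereal u + ?F p (t j) \<in> ereal ` B j) \<longleftrightarrow>
       (\<forall>j\<in>{j. j \<le> n \<and> t j \<ge> 0}. ereal u + f (t j) \<in> ereal ` B j) \<and> (\<forall>j\<in>{j. j \<le> n \<and> t j < 0}. ereal u + g (- t j) \<in> ereal ` B j)"
      unfolding p by (simp add: not_le) blast
    then show "p \<in> ?F -` ?S \<inter> space (P \<Otimes>\<^sub>M Q) \<longleftrightarrow> p \<in> ?A \<times> ?B"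
      by (auto simp: p space_pair_measure spP spQ space_PiM)
  qed
  also have "emeasure (P \<Otimes>\<^sub>M Q) (?A \<times> ?B) = emeasure P ?A * emeasure Q ?B"
    using B by (intro Q.emeasure_pair_measure_Times; subst P(2) Q(2); intro path_cylinder_measurable) auto
  finally show ?thesis .
qed

lemma measurable_nn_integral_points:
  fixes \<phi> :: "'p \<Rightarrow> ennreal" and I :: "nat set"
  assumes P: "\<And>i. i \<in> I \<Longrightarrow> (\<lambda>\<omega>. \<phi> (P i \<omega>)) \<in> borel_measurable M"
  shows "(\<lambda>\<omega>. \<integral>\<^sup>+i. \<phi> (P i \<omega>) \<partial>count_space I) \<in> borel_measurable M"
proof (rule borel_measurable_LIMSEQ_order)
  show "(\<lambda>n. \<Sum>i\<in>I \<inter> {..<n}. \<phi> (P i \<omega>)) \<longlonglongrightarrow> (\<integral>\<^sup>+i. \<phi> (P i \<omega>) \<partial>count_space I)" for \<omega>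
    by (rule nn_integral_count_space_LIMSEQ) (auto simp: incseq_def)
  show "(\<lambda>\<omega>. \<Sum>i\<in>I \<inter> {..<n}. \<phi> (P i \<omega>)) \<in> borel_measurable M" for n
    using P by (intro borel_measurable_sum) auto
qed

text \<open>Sums over an enumeration are integrals against the random measure it forms, so both
  formulas pass from the measure to the enumerated points.\<close>

lemma poisson_points_campbell:
  assumes \<Omega>: "prob_space \<Omega>" and P: "poisson_points \<Omega> \<nu> I P" and f: "\<phi> \<in> borel_measurable \<nu>"
  shows "(\<integral>\<^sup>+\<omega>. (\<integral>\<^sup>+i. \<phi> (P i \<omega>) \<partial>count_space I) \<partial>\<Omega>) = (\<integral>\<^sup>+x. \<phi> x \<partial>\<nu>)"
    and "(\<integral>\<^sup>+\<omega>. lexp (\<integral>\<^sup>+i. \<phi> (P i \<omega>) \<partial>count_space I) \<partial>\<Omega>) = lexp (\<integral>\<^sup>+x. 1 - lexp (\<phi> x) \<partial>\<nu>)"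
proof -
  let ?N = "\<lambda>\<omega>. dirac_sum \<nu> I (\<lambda>i. P i \<omega>)"
  have sp: "\<omega> \<in> space \<Omega> \<Longrightarrow> i \<in> I \<Longrightarrow> P i \<omega> \<in> space \<nu>" for i \<omega>
    using P by (auto simp: poisson_points_def dest: measurable_space)
  have N: "poisson_point_process \<Omega> \<nu> ?N" using P by (simp add: poisson_points_def)
  have cnt: "counting \<Omega> \<nu> ?N" using sp by (auto simp: counting_def intro!: count_valued_dirac_sum)
  have eq: "(\<integral>\<^sup>+x. \<phi> x \<partial>?N \<omega>) = (\<integral>\<^sup>+i. \<phi> (P i \<omega>) \<partial>count_space I)" if "\<omega> \<in> space \<Omega>" for \<omega>
    using sp[OF that] f by (intro nn_integral_dirac_sum)
  show "(\<integral>\<^sup>+\<omega>. (\<integral>\<^sup>+i. \<phi> (P i \<omega>) \<partial>count_space I) \<partial>\<Omega>) = (\<integral>\<^sup>+x. \<phi> x \<partial>\<nu>)"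
    using poisson_campbell[OF \<Omega> N cnt f] eq by (simp cong: nn_integral_cong)
  show "(\<integral>\<^sup>+\<omega>. lexp (\<integral>\<^sup>+i. \<phi> (P i \<omega>) \<partial>count_space I) \<partial>\<Omega>) = lexp (\<integral>\<^sup>+x. 1 - lexp (\<phi> x) \<partial>\<nu>)"
  proof -
    have "(\<integral>\<^sup>+\<omega>. lexp (\<integral>\<^sup>+i. \<phi> (P i \<omega>) \<partial>count_space I) \<partial>\<Omega>) = (\<integral>\<^sup>+\<omega>. lexp (\<integral>\<^sup>+x. \<phi> x \<partial>?N \<omega>) \<partial>\<Omega>)"
      by (rule nn_integral_cong) (simp only: eq)
    also have "\<dots> = lexp (\<integral>\<^sup>+x. 1 - lexp (\<phi> x) \<partial>\<nu>)"
      using poisson_imp_laplace[OF \<Omega> N cnt] f by (auto simp: laplace_functional_def)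
    finally show ?thesis .
  qed
qed

section \<open>The Laplace functional of the particle system\<close>

context particle_system
begin

lemma path_fixed_measurable: "path k p \<in> mark_space k \<rightarrow>\<^sub>M Dbar"
proof -
  have "(\<lambda>f. (p, f)) \<in> mark_space k \<rightarrow>\<^sub>M (borel \<Otimes>\<^sub>M borel) \<Otimes>\<^sub>M mark_space k"
    by (intro measurable_Pair measurable_const) (auto simp: space_pair_measure)
  from measurable_compose[OF this path_measurable] show ?thesis by simp
qed

text \<open>Only the law of the driver matters, and the copies share it; each kind of particle thus
  has a single averaged function of the starting point, to which the Poisson formulas can be
  applied.\<close>

lemma mark_avg_same_kind:
  assumes f: "f \<in> borel_measurable Dbar"
  shows "mark_avg (Central i) f = mark_avg (Central 0) f"
    "mark_avg (Plus i) f = mark_avg (Plus 0) f" "mark_avg (Minus i) f = mark_avg (Minus 0) f"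
proof -
  have m: "(\<lambda>d. f (path k p d)) \<in> borel_measurable (mark_space k)" for k p
    by (rule measurable_compose[OF path_fixed_measurable f])
  show "mark_avg (Central i) f = mark_avg (Central 0) f"
  proof
    fix p
    have "(\<integral>\<^sup>+\<omega>. (\<lambda>d. f (path (Central 0) p d)) (L i \<omega>) \<partial>\<Omega>) = (\<integral>\<^sup>+\<omega>. (\<lambda>d. f (path (Central 0) p d)) (L 0 \<omega>) \<partial>\<Omega>)"
      using L_rv L_law m[of "Central 0" p]
      by (intro nn_integral_law_restrict_eq[where P="path_alg UNIV" and S="{f. cadlag_on UNIV f}"])
         (simp_all add: Dbar_def cadlag_space_def)
    then show "mark_avg (Central i) f p = mark_avg (Central 0) f p" by (simp add: mark_avg_def)
  qed
  show "mark_avg (Plus i) f = mark_avg (Plus 0) f"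
  proof
    fix p
    have "(\<integral>\<^sup>+\<omega>. (\<lambda>d. f (path (Plus 0) p d)) (Lp i \<omega>) \<partial>\<Omega>) = (\<integral>\<^sup>+\<omega>. (\<lambda>d. f (path (Plus 0) p d)) (Lp 0 \<omega>) \<partial>\<Omega>)"
      using Lp_rv Lp_law m[of "Plus 0" p]
      by (intro nn_integral_law_restrict_eq[where P="path_alg {0..}" and S="{f. cadlag_on {0..} f}"])
         (simp_all add: cadlag_space_def)
    then show "mark_avg (Plus i) f p = mark_avg (Plus 0) f p" by (simp add: mark_avg_def)
  qed
  show "mark_avg (Minus i) f = mark_avg (Minus 0) f"
  proof
    fix p
    have "(\<integral>\<^sup>+\<omega>. (\<lambda>d. f (path (Minus 0) p d)) (Lm i \<omega>) \<partial>\<Omega>) = (\<integral>\<^sup>+\<omega>. (\<lambda>d. f (path (Minus 0) p d)) (Lm 0 \<omega>) \<partial>\<Omega>)"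
      using Lm_rv Lm_law m[of "Minus 0" p]
      by (intro nn_integral_law_restrict_eq[where P="path_alg {0..}" and S="{f. caglad_on {0..} f}"])
         (simp_all add: caglad_space_def)
    then show "mark_avg (Minus i) f p = mark_avg (Minus 0) f p" by (simp add: mark_avg_def)
  qed
qed

definition \<mu> :: "(real \<Rightarrow> ereal) measure" where
  "\<mu> = intensity_measure \<Omega> Dbar N"

lemma sets_\<mu> [simp]: "sets \<mu> = sets Dbar" and space_\<mu> [simp]: "space \<mu> = space Dbar"
  by (simp_all add: \<mu>_def)

lemma central_avg_measurable:
  "f \<in> borel_measurable Dbar \<Longrightarrow> (\<lambda>u. mark_avg (Central 0) f (0, u)) \<in> borel_measurable borel"
  by (rule measurable_compose[OF _ mark_avg_measurable]) auto

text \<open>Sum and expectation are exchanged, each driver is averaged out, and Campbell's formula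
  applies to the three processes of starting points separately.\<close>

lemma nn_integral_\<mu>:
  assumes f: "f \<in> borel_measurable Dbar"
  shows "(\<integral>\<^sup>+x. f x \<partial>\<mu>) = (\<integral>\<^sup>+u. mark_avg (Central 0) f (0, u) \<partial>exp_intensity) +
    (\<integral>\<^sup>+p. mark_avg (Plus 0) f p \<partial>rate_intensity {0<..} \<theta>p) + (\<integral>\<^sup>+p. mark_avg (Minus 0) f p \<partial>rate_intensity {..<0} \<theta>m)"
proof -
  define c p m where "c = mark_avg (Central 0) f" and "p = mark_avg (Plus 0) f" and "m = mark_avg (Minus 0) f"
  have eqs: "mark_avg (Central i) f = c" "mark_avg (Plus i) f = p" "mark_avg (Minus i) f = m" for i
    by (simp_all only: c_def p_def m_def mark_avg_same_kind[OF f, of i])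
  have pm: "point k \<in> \<Omega> \<rightarrow>\<^sub>M borel \<Otimes>\<^sub>M borel" if "k \<in> K" for k
    using that by (rule measurable_gen[OF point_measurable[where A=UNIV]]) simp
  have gm: "(\<lambda>\<omega>. mark_avg k f (point k \<omega>)) \<in> borel_measurable \<Omega>" if "k \<in> K" for k
    by (rule measurable_compose[OF pm[OF that] mark_avg_measurable[OF f]])
  have "(\<integral>\<^sup>+x. f x \<partial>\<mu>) = (\<integral>\<^sup>+\<omega>. (\<integral>\<^sup>+x. f x \<partial>N \<omega>) \<partial>\<Omega>)"
    unfolding \<mu>_def by (rule nn_integral_intensity_measure[OF N_measurable f])
  also have "\<dots> = (\<integral>\<^sup>+\<omega>. (\<integral>\<^sup>+k. f (X k \<omega>) \<partial>count_space K) \<partial>\<Omega>)"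
    using f by (intro nn_integral_cong nn_integral_N)
  also have "\<dots> = (\<integral>\<^sup>+k. (\<integral>\<^sup>+\<omega>. f (X k \<omega>) \<partial>\<Omega>) \<partial>count_space K)"
    by (intro nn_integral_count_space_nn_integral countable_particles measurable_compose[OF X_measurable f])
  also have "\<dots> = (\<integral>\<^sup>+k. (\<integral>\<^sup>+\<omega>. mark_avg k f (point k \<omega>) \<partial>\<Omega>) \<partial>count_space K)"
    by (rule nn_integral_cong) (use integrate_mark[OF f, where W="\<lambda>_. 1"] in simp)
  also have "\<dots> = (\<integral>\<^sup>+\<omega>. (\<integral>\<^sup>+k. mark_avg k f (point k \<omega>) \<partial>count_space K) \<partial>\<Omega>)"
    by (intro nn_integral_count_space_nn_integral[symmetric] countable_particles gm)
  also have "\<dots> = (\<integral>\<^sup>+\<omega>. (\<integral>\<^sup>+i. c (0, U i \<omega>) \<partial>count_space UNIV) +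
     (\<integral>\<^sup>+i. p (Tp i \<omega>, Up i \<omega>) \<partial>count_space (point_indices \<theta>p)) +
     (\<integral>\<^sup>+i. m (Tm i \<omega>, Um i \<omega>) \<partial>count_space (point_indices \<theta>m)) \<partial>\<Omega>)"
    by (simp add: nn_integral_particles eqs)
  also have "\<dots> = (\<integral>\<^sup>+\<omega>. (\<integral>\<^sup>+i. c (0, U i \<omega>) \<partial>count_space UNIV) \<partial>\<Omega>) +
     (\<integral>\<^sup>+\<omega>. (\<integral>\<^sup>+i. p (Tp i \<omega>, Up i \<omega>) \<partial>count_space (point_indices \<theta>p)) \<partial>\<Omega>) +
     (\<integral>\<^sup>+\<omega>. (\<integral>\<^sup>+i. m (Tm i \<omega>, Um i \<omega>) \<partial>count_space (point_indices \<theta>m)) \<partial>\<Omega>)"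
  proof -
    have "(\<lambda>\<omega>. c (0, U i \<omega>)) \<in> borel_measurable \<Omega>" for i
      using gm[of "Central i"] by (simp add: particles_def eqs)
    then have 1: "(\<lambda>\<omega>. \<integral>\<^sup>+i. c (0, U i \<omega>) \<partial>count_space UNIV) \<in> borel_measurable \<Omega>"
      by (intro measurable_nn_integral_points)
    have "(\<lambda>\<omega>. p (Tp i \<omega>, Up i \<omega>)) \<in> borel_measurable \<Omega>" if "i \<in> point_indices \<theta>p" for i
      using gm[of "Plus i"] that by (simp add: particles_def eqs)
    then have 2: "(\<lambda>\<omega>. \<integral>\<^sup>+i. p (Tp i \<omega>, Up i \<omega>) \<partial>count_space (point_indices \<theta>p)) \<in> borel_measurable \<Omega>"
      by (intro measurable_nn_integral_points)
    have "(\<lambda>\<omega>. m (Tm i \<omega>, Um i \<omega>)) \<in> borel_measurable \<Omega>" if "i \<in> point_indices \<theta>m" for i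
      using gm[of "Minus i"] that by (simp add: particles_def eqs)
    then have 3: "(\<lambda>\<omega>. \<integral>\<^sup>+i. m (Tm i \<omega>, Um i \<omega>) \<partial>count_space (point_indices \<theta>m)) \<in> borel_measurable \<Omega>"
      by (intro measurable_nn_integral_points)
    show ?thesis using 1 2 3 by (simp add: nn_integral_add)
  qed
  also have "(\<integral>\<^sup>+\<omega>. (\<integral>\<^sup>+i. c (0, U i \<omega>) \<partial>count_space UNIV) \<partial>\<Omega>) = (\<integral>\<^sup>+u. c (0, u) \<partial>exp_intensity)"
    using central_avg_measurable[OF f]
    by (intro poisson_points_campbell(1)[OF prob_space_axioms ppp0]) (simp add: eqs cong: measurable_cong_sets)
  also have "(\<integral>\<^sup>+\<omega>. (\<integral>\<^sup>+i. p (Tp i \<omega>, Up i \<omega>) \<partial>count_space (point_indices \<theta>p)) \<partial>\<Omega>) = (\<integral>\<^sup>+x. p x \<partial>rate_intensity {0<..} \<theta>p)"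
    unfolding p_def
    by (intro poisson_points_campbell(1)[OF prob_space_axioms ppp_plus] measurable_compose[OF measurable_rate_intensity mark_avg_measurable[OF f]])
  also have "(\<integral>\<^sup>+\<omega>. (\<integral>\<^sup>+i. m (Tm i \<omega>, Um i \<omega>) \<partial>count_space (point_indices \<theta>m)) \<partial>\<Omega>) = (\<integral>\<^sup>+x. m x \<partial>rate_intensity {..<0} \<theta>m)"
    unfolding m_def
    by (intro poisson_points_campbell(1)[OF prob_space_axioms ppp_minus] measurable_compose[OF measurable_rate_intensity mark_avg_measurable[OF f]])
  finally show ?thesis by (simp add: c_def p_def m_def)
qed

lemma one_minus_mark_avg:
  assumes f: "f \<in> borel_measurable Dbar"
  shows "1 - mark_avg k (\<lambda>x. lexp (f x)) p = mark_avg k (\<lambda>x. 1 - lexp (f x)) p"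
proof -
  have d: "driver k \<in> \<Omega> \<rightarrow>\<^sub>M mark_space k" by (rule measurable_gen[OF driver_measurable[where A=UNIV]]) simp
  have [measurable]: "(\<lambda>\<omega>. f (path k p (driver k \<omega>))) \<in> borel_measurable \<Omega>"
    using measurable_compose[OF measurable_compose[OF d path_fixed_measurable] f] by simp
  have fin: "(\<integral>\<^sup>+\<omega>. lexp (f (path k p (driver k \<omega>))) \<partial>\<Omega>) \<le> 1"
    by (rule nn_integral_le_const) (auto simp: lexp_le_1)
  have "(\<integral>\<^sup>+\<omega>. 1 - lexp (f (path k p (driver k \<omega>))) \<partial>\<Omega>) = (\<integral>\<^sup>+\<omega>. 1 \<partial>\<Omega>) - (\<integral>\<^sup>+\<omega>. lexp (f (path k p (driver k \<omega>))) \<partial>\<Omega>)"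
    using fin by (intro nn_integral_diff) (auto simp: lexp_le_1 top_unique)
  then show ?thesis by (simp add: mark_avg_def emeasure_space_1)
qed

lemma mark_avg_le_1: "(\<And>x. f x \<le> 1) \<Longrightarrow> mark_avg k f p \<le> 1"
  unfolding mark_avg_def by (rule nn_integral_le_const) auto

text \<open>The product of the averaged factors is again the exponential of a sum, with the test
  function G at the starting points, so the functionals of the three independent point processes
  apply. As 1 - e^(-G) is the average of 1 - e^(-f), their exponents add up to an integral against
  \<mu>.\<close>

lemma laplace_N: "laplace_functional \<Omega> \<mu> N"
  unfolding laplace_functional_def
proof
  fix f :: "(real \<Rightarrow> ereal) \<Rightarrow> ennreal" assume "f \<in> borel_measurable \<mu>"
  then have f: "f \<in> borel_measurable Dbar" by (simp cong: measurable_cong_sets)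
  define g where "g x = lexp (f x)" for x
  have g: "g \<in> borel_measurable Dbar" unfolding g_def[abs_def] using f by measurable
  \<comment> \<open>Where the averaged factor is 0 this is \<infinity>, which the Laplace
    functionals allow.\<close>
  define G where "G k p = nlog (mark_avg k g p)" for k p
  have Gm: "G k \<in> borel_measurable (borel \<Otimes>\<^sub>M borel)" for k
    unfolding G_def[abs_def] using mark_avg_measurable[OF g] by measurable
  have lG: "lexp (G k p) = mark_avg k g p" for k p
    unfolding G_def by (intro lexp_nlog mark_avg_le_1) (simp add: g_def lexp_le_1)
  define G0 Gp Gm' where "G0 = G (Central 0)" and "Gp = G (Plus 0)" and "Gm' = G (Minus 0)"
  have Gk: "G (Central i) = G0" "G (Plus i) = Gp" "G (Minus i) = Gm'" for i
    unfolding G0_def Gp_def Gm'_def G_def[abs_def] by (simp_all only: mark_avg_same_kind[OF g, of i])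
  have pm: "point k \<in> \<Omega> \<rightarrow>\<^sub>M borel \<Otimes>\<^sub>M borel" if "k \<in> K" for k
    using that by (rule measurable_gen[OF point_measurable[where A=UNIV]]) simp
  let ?F = "first_particles \<theta>p \<theta>m"
  have FK: "?F n \<subseteq> K" for n by (auto simp: first_particles_def)
  \<comment> \<open>Drivers can be averaged in finite products only, so the two infinite sums are
    compared through their truncations.\<close>
  have "(\<lambda>n. \<integral>\<^sup>+\<omega>. lexp (\<Sum>k\<in>?F n. f (X k \<omega>)) \<partial>\<Omega>) \<longlonglongrightarrow> (\<integral>\<^sup>+\<omega>. lexp (\<integral>\<^sup>+k. f (X k \<omega>) \<partial>count_space K) \<partial>\<Omega>)"
    using FK by (intro tendsto_nn_integral_lexp first_particles_limit borel_measurable_sum measurable_compose[OF X_measurable f]) auto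
  moreover have "(\<lambda>n. \<integral>\<^sup>+\<omega>. lexp (\<Sum>k\<in>?F n. G k (point k \<omega>)) \<partial>\<Omega>) \<longlonglongrightarrow> (\<integral>\<^sup>+\<omega>. lexp (\<integral>\<^sup>+k. G k (point k \<omega>) \<partial>count_space K) \<partial>\<Omega>)"
    using FK by (intro tendsto_nn_integral_lexp first_particles_limit borel_measurable_sum measurable_compose[OF pm Gm]) auto
  moreover have "(\<integral>\<^sup>+\<omega>. lexp (\<Sum>k\<in>?F n. f (X k \<omega>)) \<partial>\<Omega>) = (\<integral>\<^sup>+\<omega>. lexp (\<Sum>k\<in>?F n. G k (point k \<omega>)) \<partial>\<Omega>)" for n
    using integrate_marks[OF g finite_first_particles FK[of n], where W="\<lambda>_. 1"]
    by (simp add: lexp_sum finite_first_particles lG) (simp add: g_def)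
  ultimately have "(\<integral>\<^sup>+\<omega>. lexp (\<integral>\<^sup>+k. f (X k \<omega>) \<partial>count_space K) \<partial>\<Omega>) = (\<integral>\<^sup>+\<omega>. lexp (\<integral>\<^sup>+k. G k (point k \<omega>) \<partial>count_space K) \<partial>\<Omega>)"
    by (metis (no_types, lifting) LIMSEQ_unique ext)
  moreover have "(\<integral>\<^sup>+\<omega>. lexp (\<integral>\<^sup>+x. f x \<partial>N \<omega>) \<partial>\<Omega>) = (\<integral>\<^sup>+\<omega>. lexp (\<integral>\<^sup>+k. f (X k \<omega>) \<partial>count_space K) \<partial>\<Omega>)"
    using f by (intro nn_integral_cong arg_cong[of _ _ lexp] nn_integral_N)
  moreover have "(\<integral>\<^sup>+\<omega>. lexp (\<integral>\<^sup>+k. G k (point k \<omega>) \<partial>count_space K) \<partial>\<Omega>) = lexp (\<integral>\<^sup>+x. 1 - lexp (f x) \<partial>\<mu>)"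
  proof -
    define A0 where "A0 \<omega> = (\<integral>\<^sup>+i. G0 (0, U i \<omega>) \<partial>count_space UNIV)" for \<omega>
    define Ap where "Ap \<omega> = (\<integral>\<^sup>+i. Gp (Tp i \<omega>, Up i \<omega>) \<partial>count_space (point_indices \<theta>p))" for \<omega>
    define Am where "Am \<omega> = (\<integral>\<^sup>+i. Gm' (Tm i \<omega>, Um i \<omega>) \<partial>count_space (point_indices \<theta>m))" for \<omega>
    have A0: "A0 \<in> borel_measurable (gen {Points0})"
      unfolding A0_def[abs_def]
    proof (rule measurable_nn_integral_points)
      fix i have "point (Central i) \<in> gen {Points0} \<rightarrow>\<^sub>M borel \<Otimes>\<^sub>M borel"
        by (rule point_measurable) (auto simp: particles_def)
      from measurable_compose[OF this Gm, of "Central 0"] show "(\<lambda>\<omega>. G0 (0, U i \<omega>)) \<in> borel_measurable (gen {Points0})" by (simp add: Gk)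
    qed
    have Ap: "Ap \<in> borel_measurable (gen {PointsPlus})"
      unfolding Ap_def[abs_def]
    proof (rule measurable_nn_integral_points)
      fix i assume "i \<in> point_indices \<theta>p"
      then have "point (Plus i) \<in> gen {PointsPlus} \<rightarrow>\<^sub>M borel \<Otimes>\<^sub>M borel"
        by (intro point_measurable) (auto simp: particles_def)
      from measurable_compose[OF this Gm, of "Plus 0"] show "(\<lambda>\<omega>. Gp (Tp i \<omega>, Up i \<omega>)) \<in> borel_measurable (gen {PointsPlus})" by (simp add: Gk)
    qed
    have Am: "Am \<in> borel_measurable (gen {PointsMinus})"
      unfolding Am_def[abs_def]
    proof (rule measurable_nn_integral_points)
      fix i assume "i \<in> point_indices \<theta>m"
      then have "point (Minus i) \<in> gen {PointsMinus} \<rightarrow>\<^sub>M borel \<Otimes>\<^sub>M borel"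
        by (intro point_measurable) (auto simp: particles_def)
      from measurable_compose[OF this Gm, of "Minus 0"] show "(\<lambda>\<omega>. Gm' (Tm i \<omega>, Um i \<omega>)) \<in> borel_measurable (gen {PointsMinus})" by (simp add: Gk)
    qed
    have mult: "(\<integral>\<^sup>+\<omega>. Y \<omega> * Z \<omega> \<partial>\<Omega>) = (\<integral>\<^sup>+\<omega>. Y \<omega> \<partial>\<Omega>) * (\<integral>\<^sup>+\<omega>. Z \<omega> \<partial>\<Omega>)"
      if "A \<inter> A' = {}" and Y: "Y \<in> borel_measurable (gen A)" and Z: "Z \<in> borel_measurable (gen A')" for Y Z :: "'w \<Rightarrow> ennreal" and A A'
    proof -
      have "(\<integral>\<^sup>+\<omega>. Y \<omega> * Z \<omega> \<partial>\<Omega>) = (\<integral>\<^sup>+\<omega>. (\<integral>\<^sup>+\<omega>'. Y \<omega> * Z \<omega>' \<partial>\<Omega>) \<partial>\<Omega>)"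
        using indep_gen_nn_integral[OF that, of "\<lambda>p. fst p * snd p"] by simp
      then show ?thesis
        using measurable_gen[OF Y] measurable_gen[OF Z] by (simp add: nn_integral_cmult nn_integral_multc)
    qed
    have "(\<integral>\<^sup>+\<omega>. lexp (\<integral>\<^sup>+k. G k (point k \<omega>) \<partial>count_space K) \<partial>\<Omega>) = (\<integral>\<^sup>+\<omega>. lexp (A0 \<omega>) * (lexp (Ap \<omega>) * lexp (Am \<omega>)) \<partial>\<Omega>)"
      unfolding nn_integral_particles A0_def Ap_def Am_def
      by (intro nn_integral_cong) (simp add: lexp_add mult.assoc Gk)
    also have "\<dots> = (\<integral>\<^sup>+\<omega>. lexp (A0 \<omega>) \<partial>\<Omega>) * (\<integral>\<^sup>+\<omega>. lexp (Ap \<omega>) * lexp (Am \<omega>) \<partial>\<Omega>)"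
      using A0 measurable_gen_mono[OF Ap, of "{PointsPlus, PointsMinus}"] measurable_gen_mono[OF Am, of "{PointsPlus, PointsMinus}"]
      by (intro mult[of "{Points0}" "{PointsPlus, PointsMinus}"]) auto
    also have "(\<integral>\<^sup>+\<omega>. lexp (Ap \<omega>) * lexp (Am \<omega>) \<partial>\<Omega>) = (\<integral>\<^sup>+\<omega>. lexp (Ap \<omega>) \<partial>\<Omega>) * (\<integral>\<^sup>+\<omega>. lexp (Am \<omega>) \<partial>\<Omega>)"
      using Ap Am by (intro mult[of "{PointsPlus}" "{PointsMinus}"]) auto
    also have "(\<integral>\<^sup>+\<omega>. lexp (A0 \<omega>) \<partial>\<Omega>) = lexp (\<integral>\<^sup>+u. 1 - lexp (G0 (0, u)) \<partial>exp_intensity)"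
      unfolding A0_def using measurable_compose[OF _ Gm, of "\<lambda>u. (0, u)" borel "Central 0"]
      by (intro poisson_points_campbell(2)[OF prob_space_axioms ppp0]) (simp add: Gk cong: measurable_cong_sets)
    also have "(\<integral>\<^sup>+\<omega>. lexp (Ap \<omega>) \<partial>\<Omega>) = lexp (\<integral>\<^sup>+p. 1 - lexp (Gp p) \<partial>rate_intensity {0<..} \<theta>p)"
      unfolding Ap_def Gp_def by (intro poisson_points_campbell(2)[OF prob_space_axioms ppp_plus] measurable_compose[OF measurable_rate_intensity Gm])
    also have "(\<integral>\<^sup>+\<omega>. lexp (Am \<omega>) \<partial>\<Omega>) = lexp (\<integral>\<^sup>+p. 1 - lexp (Gm' p) \<partial>rate_intensity {..<0} \<theta>m)"
      unfolding Am_def Gm'_def by (intro poisson_points_campbell(2)[OF prob_space_axioms ppp_minus] measurable_compose[OF measurable_rate_intensity Gm])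
    also have "lexp (\<integral>\<^sup>+u. 1 - lexp (G0 (0, u)) \<partial>exp_intensity) *
        (lexp (\<integral>\<^sup>+p. 1 - lexp (Gp p) \<partial>rate_intensity {0<..} \<theta>p) * lexp (\<integral>\<^sup>+p. 1 - lexp (Gm' p) \<partial>rate_intensity {..<0} \<theta>m)) =
        lexp (\<integral>\<^sup>+x. 1 - lexp (f x) \<partial>\<mu>)"
      unfolding G0_def Gp_def Gm'_def lG g_def[abs_def] one_minus_mark_avg[OF f] using f by (subst nn_integral_\<mu>) (auto simp: lexp_add mult.assoc)
    finally show ?thesis .
  qed
  ultimately show "(\<integral>\<^sup>+\<omega>. lexp (\<integral>\<^sup>+x. f x \<partial>N \<omega>) \<partial>\<Omega>) = lexp (\<integral>\<^sup>+x. 1 - lexp (f x) \<partial>\<mu>)" by simp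
qed

end

section \<open>The intensity measure\<close>

lemma nn_integral_exp_tail: "(\<integral>\<^sup>+x\<in>{a<..}. ennreal (exp (- x)) \<partial>lborel) = ennreal (exp (- a))"
proof -
  have "(\<integral>\<^sup>+x\<in>{a<..}. ennreal (exp (- x)) \<partial>lborel) = (\<integral>\<^sup>+x. ennreal (exp (- x)) * indicator {a..} x \<partial>lborel)"
    using AE_lborel_singleton[of a]
    by (intro nn_integral_cong_AE) (auto simp: indicator_def elim!: eventually_mono)
  also have "\<dots> = ennreal (0 - - exp (- a))"
  proof (rule nn_integral_FTC_atLeast[where F="\<lambda>x. - exp (- x)"])
    have "((\<lambda>x::real. exp (- x)) \<longlongrightarrow> 0) at_top"
      by (rule filterlim_compose[OF exp_at_bot filterlim_uminus_at_bot_at_top])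
    then show "((\<lambda>x. - exp (- x)) \<longlongrightarrow> (0::real)) at_top" using tendsto_minus by fastforce
  qed (auto intro!: derivative_eq_intros)
  finally show ?thesis by simp
qed

text \<open>Values are tested against sets of reals, so a cylinder leaves out every path that is
  -\<infinity> at some time of J.\<close>

definition cylinder :: "real set \<Rightarrow> (real \<Rightarrow> real set) \<Rightarrow> (real \<Rightarrow> ereal) set" where
  "cylinder J B = {f \<in> space Dbar. \<forall>s\<in>J. f s \<in> ereal ` B s}"

definition bottom :: "(real \<Rightarrow> ereal) set" where
  "bottom = {f \<in> space Dbar. \<forall>s. f s = -\<infinity>}"

lemma cylinder_measurable:
  assumes "finite J" "\<And>s. s \<in> J \<Longrightarrow> B s \<in> sets borel"
  shows "cylinder J B \<in> sets Dbar"
  unfolding cylinder_def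
proof (rule sets.sets_Collect_finite_All[OF _ assms(1)])
  fix s assume s: "s \<in> J"
  from measurable_sets[OF measurable_Dbar_eval ereal_image_measurable[OF assms(2)[OF s]], of s]
  show "{f \<in> space Dbar. f s \<in> ereal ` B s} \<in> sets Dbar"
    by (simp add: vimage_def Int_def conj_commute)
qed

lemma Dbar_not_infty: "f \<in> space Dbar \<Longrightarrow> f s \<noteq> \<infinity>"
  by (simp add: space_Dbar cadlag_on_UNIV_iff)

text \<open>If f t > -\<infinity>, right-continuity keeps f above -\<infinity> just after t, hence
  at some rational time. Countably many evaluations therefore suffice for measurability.\<close>

lemma bottom_rational: "bottom = {f \<in> space Dbar. \<forall>s\<in>\<rat>. f s = -\<infinity>}"
proof -
  have "f t = -\<infinity>" if f: "f \<in> space Dbar" and q: "\<forall>s\<in>\<rat>. f s = -\<infinity>" for f t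
  proof (rule ccontr)
    assume "f t \<noteq> -\<infinity>"
    then have "-\<infinity> < f t" by auto
    moreover have "(f \<longlongrightarrow> f t) (at_right t)" using f by (simp add: space_Dbar cadlag_on_UNIV_iff)
    ultimately have "\<forall>\<^sub>F y in at_right t. -\<infinity> < f y" using order_tendstoD(1) by blast
    then obtain b where b: "b > t" "\<And>y. t < y \<Longrightarrow> y < b \<Longrightarrow> -\<infinity> < f y"
      by (auto simp: eventually_at_right_field)
    obtain y where "y \<in> \<rat>" "t < y" "y < b" using Rats_dense_in_real[OF b(1)] by blast
    then show False using b q by auto
  qed
  then show ?thesis by (auto simp: bottom_def)
qed

lemma bottom_measurable: "bottom \<in> sets Dbar"
proof -
  have "{f \<in> space Dbar. f s = -\<infinity>} \<in> sets Dbar" for s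
    using measurable_sets[OF measurable_Dbar_eval, of "{-\<infinity>}" s] by (simp add: vimage_def Int_def conj_commute)
  then show ?thesis unfolding bottom_rational
    by (intro sets.sets_Collect_countable_All' countable_rat) auto
qed

text \<open>The finite set of times is sorted into a strictly increasing sequence; n = card J - 1 is
  the index of its last member.\<close>

lemma cylinder_sequence:
  assumes "finite J" "J \<noteq> {}"
  shows "\<exists>(t :: nat \<Rightarrow> real) n. (\<forall>i<n. t i < t (Suc i)) \<and>
    (\<forall>B. cylinder J B = {f \<in> space Dbar. \<forall>i\<le>n. f (t i) \<in> ereal ` B (t i)})"
proof (intro exI conjI allI impI)
  let ?xs = "sorted_list_of_set J"
  let ?n = "card J - 1"
  have len: "length ?xs = Suc ?n" using assms by (simp add: card_gt_0_iff)
  have set: "set ?xs = J" using assms by simp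
  show "?xs ! i < ?xs ! Suc i" if "i < ?n" for i
    by (rule sorted_wrt_nth_less[OF strict_sorted_list_of_set]) (use that len in auto)
  show "cylinder J B = {f \<in> space Dbar. \<forall>i\<le>?n. f (?xs ! i) \<in> ereal ` B (?xs ! i)}" for B
  proof -
    have "(\<forall>s\<in>J. P s) \<longleftrightarrow> (\<forall>i\<le>?n. P (?xs ! i))" for P
    proof -
      have "(\<forall>s\<in>set ?xs. P s) \<longleftrightarrow> (\<forall>i<length ?xs. P (?xs ! i))" by (rule all_set_conv_all_nth)
      then show ?thesis unfolding set len less_Suc_eq_le .
    qed
    then show ?thesis by (simp add: cylinder_def)
  qed
qed

text \<open>The finite-dimensional marginals on \<open>\<real>\<close> (without \<open>-\<infinity>\<close>) determine a measure on the
  Skorokhod space up to its mass on the path \<open>-\<infinity>\<close>, which lies in no cylinder.\<close>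
lemma Dbar_measure_eqI:
  assumes sets: "sets M1 = sets Dbar" "sets M2 = sets Dbar"
    and bot: "emeasure M1 bottom = 0" "emeasure M2 bottom = 0"
    and fin: "\<And>q m. emeasure M1 (cylinder {q} (\<lambda>_. {- real m<..})) \<noteq> \<infinity>"
    and eq: "\<And>(t :: nat \<Rightarrow> real) B n. (\<And>i. i < n \<Longrightarrow> t i < t (Suc i)) \<Longrightarrow> (\<And>i. i \<le> n \<Longrightarrow> B i \<in> sets borel) \<Longrightarrow>
      emeasure M1 {f \<in> space Dbar. \<forall>i\<le>n. f (t i) \<in> ereal ` B i} = emeasure M2 {f \<in> space Dbar. \<forall>i\<le>n. f (t i) \<in> ereal ` B i}"
  shows "M1 = M2"
proof -
  define C where "C = {cylinder J B |J B. finite J \<and> J \<noteq> {} \<and> (\<forall>s. B s \<in> sets borel)}"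
  \<comment> \<open>The dead path is added because no cylinder contains it, the empty set because
    cylinders and \<open>bottom\<close> do not meet.\<close>
  define E where "E = C \<union> {bottom, {}}"
  have CD: "C \<subseteq> sets Dbar" by (auto simp: C_def intro!: cylinder_measurable)
  then have ED: "E \<subseteq> sets Dbar" by (auto simp: E_def bottom_measurable)
  then have Esp: "E \<subseteq> Pow (space Dbar)" using sets.sets_into_space by blast
  have disj: "cylinder J B \<inter> bottom = {}" if "J \<noteq> {}" for J B using that by (auto simp: cylinder_def bottom_def)
  have Ceq: "emeasure M1 X = emeasure M2 X" if X: "X \<in> C" for X
  proof -
    obtain J B where JB: "X = cylinder J B" "finite J" "J \<noteq> {}" "\<And>s. B s \<in> sets borel" using X by (auto simp: C_def)
    obtain t :: "nat \<Rightarrow> real" and n where tn: "\<forall>i<n. t i < t (Suc i)"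
      "\<forall>B. cylinder J B = {f \<in> space Dbar. \<forall>i\<le>n. f (t i) \<in> ereal ` B (t i)}"
      using cylinder_sequence[OF JB(2,3)] by blast
    show ?thesis unfolding JB(1) tn(2)[rule_format] by (rule eq) (use tn(1) JB(4) in auto)
  qed
  have gen: "sigma_sets (space Dbar) E = sets Dbar"
  proof
    show "sigma_sets (space Dbar) E \<subseteq> sets Dbar" by (rule sets.sigma_sets_subset[OF ED])
    let ?S = "sigma (space Dbar) E"
    have sS: "sets ?S = sigma_sets (space Dbar) E" "space ?S = space Dbar"
      using Esp by (auto simp: space_measure_of)
    have "(\<lambda>f. f) \<in> ?S \<rightarrow>\<^sub>M Dbar"
    proof (rule measurable_DbarI)
      show "cadlag_on UNIV f" if "f \<in> space ?S" for f
        using that unfolding sS(2) by (simp add: space_Dbar)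
      fix t
      have cyl: "{f \<in> space Dbar. f t \<in> ereal ` A} \<in> sets ?S" if "A \<in> sets borel" for A
      proof -
        have "{f \<in> space Dbar. f t \<in> ereal ` A} = cylinder {t} (\<lambda>_. A)" by (simp add: cylinder_def)
        also have "\<dots> \<in> E" using that unfolding E_def C_def by blast
        finally show ?thesis unfolding sS(1) by (rule sigma_sets.Basic)
      qed
      show "(\<lambda>f. f t) \<in> borel_measurable ?S"
      proof (rule measurableI)
        fix A :: "ereal set" assume A: "A \<in> sets borel"
        have "ereal -` A \<in> sets borel" using measurable_sets[OF borel_measurable_ereal[OF measurable_ident] A] by simp
        \<comment> \<open>Paths avoid \<infinity>, so the event f t = -\<infinity> is the complement
          of a cylinder.\<close>
        have "(\<lambda>f. f t) -` A \<inter> space ?S = {f \<in> space Dbar. f t \<in> ereal ` (ereal -` A)} \<union>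
          (if -\<infinity> \<in> A then space ?S - {f \<in> space Dbar. f t \<in> ereal ` UNIV} else {})"
        proof (intro set_eqI)
          fix f
          have "f \<in> space Dbar \<Longrightarrow> f t = -\<infinity> \<or> (\<exists>r. f t = ereal r)"
            using Dbar_not_infty[of f t] by (cases "f t") auto
          then show "f \<in> (\<lambda>f. f t) -` A \<inter> space ?S \<longleftrightarrow> f \<in> {f \<in> space Dbar. f t \<in> ereal ` (ereal -` A)} \<union>
            (if -\<infinity> \<in> A then space ?S - {f \<in> space Dbar. f t \<in> ereal ` UNIV} else {})"
            by (auto simp: sS)
        qed
        also have "\<dots> \<in> sets ?S" using cyl[OF \<open>ereal -` A \<in> sets borel\<close>] cyl[of UNIV] by (auto simp del: sets_measure_of)
        finally show "(\<lambda>f. f t) -` A \<inter> space ?S \<in> sets ?S" .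
      qed simp
    qed
    from measurable_sets[OF this] show "sets Dbar \<subseteq> sigma_sets (space Dbar) E"
      unfolding sS using sets.sets_into_space by (auto simp: Int_absorb2)
  qed
  \<comment> \<open>A countable cover by sets of finite mass: a path other than the dead one has a
    real value at some rational time, and this value exceeds -m for some m.\<close>
  define A where "A = insert bottom ((\<lambda>(q, m). cylinder {q} (\<lambda>_. {- real m<..})) ` (\<rat> \<times> (UNIV :: nat set)))"
  show ?thesis
  proof (rule measure_eqI_generator_eq_countable[where E=E and \<Omega>="space Dbar" and A=A])
    show "Int_stable E"
    proof (rule Int_stableI)
      fix a b assume ab: "a \<in> E" "b \<in> E"
      have CC: "a \<inter> b \<in> C" if C: "a \<in> C" "b \<in> C"
      proof -
        obtain J B J' B' where *: "a = cylinder J B" "finite J" "J \<noteq> {}" "\<And>s. B s \<in> sets borel"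
          "b = cylinder J' B'" "finite J'" "J' \<noteq> {}" "\<And>s. B' s \<in> sets borel"
          using C by (auto simp: C_def)
        define D where "D s = (if s \<in> J then B s else UNIV) \<inter> (if s \<in> J' then B' s else UNIV)" for s
        have im: "x \<in> ereal ` (A \<inter> A') \<longleftrightarrow> x \<in> ereal ` A \<and> x \<in> ereal ` A'" for x A A' by auto
        have D: "f s \<in> ereal ` D s \<longleftrightarrow> (s \<in> J \<longrightarrow> f s \<in> ereal ` B s) \<and> (s \<in> J' \<longrightarrow> f s \<in> ereal ` B' s)"
          if "s \<in> J \<union> J'" for f s
          unfolding D_def im using that by auto
        have "a \<inter> b = cylinder (J \<union> J') D"
        proof (intro set_eqI)
          fix f
          have "(\<forall>s\<in>J \<union> J'. f s \<in> ereal ` D s) \<longleftrightarrow> (\<forall>s\<in>J. f s \<in> ereal ` B s) \<and> (\<forall>s\<in>J'. f s \<in> ereal ` B' s)"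
            by (simp add: D ball_Un) blast
          then show "f \<in> a \<inter> b \<longleftrightarrow> f \<in> cylinder (J \<union> J') D" unfolding *(1,5) cylinder_def by auto
        qed
        moreover have "D s \<in> sets borel" for s using *(4,8) by (auto simp: D_def)
        moreover have "finite (J \<union> J')" "J \<union> J' \<noteq> {}" using * by auto
        ultimately show ?thesis unfolding C_def by auto
      qed
      have Cb: "c \<inter> bottom = {}" "bottom \<inter> c = {}" if "c \<in> C" for c using that disj by (auto simp: C_def)
      show "a \<inter> b \<in> E" using ab CC Cb by (auto simp: E_def)
    qed
    show "emeasure M1 X = emeasure M2 X" if "X \<in> E" for X using that Ceq bot by (auto simp: E_def)
    have "cylinder {q} (\<lambda>_. {- real m<..}) \<in> C" for q m
      unfolding C_def by (intro CollectI exI conjI) (rule refl, auto)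
    then show "A \<subseteq> E" by (auto simp: A_def E_def)
    show "\<Union>A = space Dbar"
    proof
      show "\<Union>A \<subseteq> space Dbar" by (auto simp: A_def cylinder_def bottom_def)
      show "space Dbar \<subseteq> \<Union>A"
      proof
        fix f assume f: "f \<in> space Dbar"
        show "f \<in> \<Union>A"
        proof (cases "f \<in> bottom")
          case True
          then show ?thesis by (auto simp: A_def)
        next
          case False
          then obtain q where q: "q \<in> \<rat>" "f q \<noteq> -\<infinity>" using f by (auto simp: bottom_rational)
          then obtain r where r: "f q = ereal r" using Dbar_not_infty[OF f, of q] by (cases "f q") auto
          obtain m :: nat where "- r < real m" using reals_Archimedean2 by blast
          then have "f \<in> cylinder {q} (\<lambda>_. {- real m<..})" using f r by (auto simp: cylinder_def)
          then show ?thesis using q by (auto simp: A_def)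
        qed
      qed
    qed
    show "emeasure M1 a \<noteq> \<infinity>" if "a \<in> A" for a using that fin bot by (auto simp: A_def)
    show "countable A" by (auto simp: A_def countable_rat)
  qed (use Esp sets gen in auto)
qed

section \<open>Contributions of the three kinds of particles to the marginals\<close>

context particle_system
begin

lemma finite_marginal_measurable:
  fixes n :: nat
  assumes "\<And>j. j \<le> n \<Longrightarrow> B j \<in> sets borel"
  shows "{f \<in> space Dbar. \<forall>j\<le>n. f (t j) \<in> ereal ` B j} \<in> sets Dbar"
proof -
  have "{f \<in> space Dbar. \<forall>j\<in>{..n}. f (t j) \<in> ereal ` B j} \<in> sets Dbar"
  proof (rule sets.sets_Collect_finite_All)
    fix j assume "j \<in> {..n}"
    then have "B j \<in> sets borel" using assms by simp
    from measurable_sets[OF measurable_Dbar_eval ereal_image_measurable[OF this], of "t j"]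
    show "{f \<in> space Dbar. f (t j) \<in> ereal ` B j} \<in> sets Dbar"
      by (simp add: vimage_def Int_def conj_commute)
  qed simp
  then show ?thesis unfolding Ball_def atMost_iff .
qed

lemma mark_avg_indicator:
  assumes S: "S \<in> sets Dbar"
  shows "mark_avg k (indicator S) p = emeasure \<Omega> {\<omega> \<in> space \<Omega>. path k p (driver k \<omega>) \<in> S}"
proof -
  have "(\<lambda>\<omega>. path k p (driver k \<omega>)) \<in> \<Omega> \<rightarrow>\<^sub>M Dbar"
    by (rule measurable_compose[OF measurable_gen[OF driver_measurable[where A=UNIV]] path_fixed_measurable]) simp
  from measurable_sets[OF this S] have "{\<omega> \<in> space \<Omega>. path k p (driver k \<omega>) \<in> S} \<in> events"
    by (simp add: vimage_def Int_def conj_commute)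
  moreover have "mark_avg k (indicator S) p = (\<integral>\<^sup>+\<omega>. indicator {\<omega> \<in> space \<Omega>. path k p (driver k \<omega>) \<in> S} \<omega> \<partial>\<Omega>)"
    unfolding mark_avg_def by (intro nn_integral_cong) (auto simp: indicator_def)
  ultimately show ?thesis by simp
qed

lemma law_emeasure:
  assumes "Y \<in> \<Omega> \<rightarrow>\<^sub>M path_alg I" "S \<in> sets (path_alg I)"
  shows "emeasure (distr \<Omega> (path_alg I) Y) S = emeasure \<Omega> {\<omega> \<in> space \<Omega>. Y \<omega> \<in> S}"
proof -
  have "Y -` S \<inter> space \<Omega> = {\<omega> \<in> space \<Omega>. Y \<omega> \<in> S}" by auto
  then show ?thesis using emeasure_distr[OF assms] by simp
qed

lemma L_path: "L i \<in> \<Omega> \<rightarrow>\<^sub>M path_alg UNIV" "Lp i \<in> \<Omega> \<rightarrow>\<^sub>M path_alg {0..}" "Lm i \<in> \<Omega> \<rightarrow>\<^sub>M path_alg {0..}"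
  by (rule measurable_restrict_space2_iff[THEN iffD1, THEN conjunct1, OF L_rv[of i, unfolded Dbar_def cadlag_space_def]]
    measurable_restrict_space2_iff[THEN iffD1, THEN conjunct1, OF Lp_rv[of i, unfolded cadlag_space_def]]
    measurable_restrict_space2_iff[THEN iffD1, THEN conjunct1, OF Lm_rv[of i, unfolded caglad_space_def]])+

lemma space_killed: "space (killed_law M \<xi> \<theta>m) = space (path_alg {0..})" "space (killed_law M' \<xi>' \<theta>p) = space (path_alg {0..})"
  by (rule sets_eq_imp_space_eq[OF p.sets_killed_law], rule sets_eq_imp_space_eq[OF m.sets_killed_law])

context
  fixes t :: "nat \<Rightarrow> real" and B :: "nat \<Rightarrow> real set" and n :: nat
  assumes t: "\<And>j. j < n \<Longrightarrow> t j \<le> t (Suc j)" and B: "\<And>j. j \<le> n \<Longrightarrow> B j \<in> sets borel"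
begin

abbreviation marginal :: "(real \<Rightarrow> ereal) set" where
  "marginal \<equiv> {f \<in> space Dbar. \<forall>j\<le>n. f (t j) \<in> ereal ` B j}"

lemma marginal_measurable: "marginal \<in> sets Dbar"
  by (rule finite_marginal_measurable[OF B])

lemma t_mono: "a \<le> b \<Longrightarrow> b \<le> n \<Longrightarrow> t a \<le> t b"
proof (induction b rule: dec_induct)
  case (step k)
  then have "t a \<le> t k" "t k \<le> t (Suc k)" by (simp_all add: t)
  then show ?case by (rule order_trans)
qed simp

lemma central_avg:
  "mark_avg (Central 0) (indicator marginal) (0, u) =
    emeasure (killed_law M \<xi> \<theta>m) {f \<in> space (path_alg {0..}). \<forall>j\<in>{j. j \<le> n \<and> t j \<ge> 0}. ereal u + f (t j) \<in> ereal ` B j} *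
    emeasure (killed_law M' \<xi>' \<theta>p) {f \<in> space (path_alg {0..}). \<forall>j\<in>{j. j \<le> n \<and> t j < 0}. ereal u + f (- t j) \<in> ereal ` B j}"
proof -
  let ?S = "{f \<in> space (path_alg UNIV). \<forall>j\<in>{..n}. ereal u + f (t j) \<in> ereal ` B j}"
  have "{\<omega> \<in> space \<Omega>. path (Central 0) (0, u) (driver (Central 0) \<omega>) \<in> marginal} = {\<omega> \<in> space \<Omega>. L 0 \<omega> \<in> ?S}"
    using measurable_space[OF L_rv[of 0]]
    by (auto simp: central_path_def[abs_def] space_Dbar space_PiM intro: cadlag_central_path[unfolded central_path_def[abs_def]])
  then have "mark_avg (Central 0) (indicator marginal) (0, u) = emeasure (distr \<Omega> (path_alg UNIV) (L 0)) ?S"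
    using B by (subst law_emeasure[OF L_path(1)]) (auto intro!: path_cylinder_measurable simp: mark_avg_indicator[OF marginal_measurable])
  then show ?thesis unfolding L_law
    using B by (subst (asm) emeasure_two_sided_law) (auto intro: p.prob_space_killed_law m.prob_space_killed_law)
qed

text \<open>A particle born after t 0 is at -\<infinity> at time t 0 and does not contribute; one
  born by then is observed at the ages t j - s.\<close>

lemma plus_avg:
  "mark_avg (Plus 0) (indicator marginal) (s, u) = indicator {..t 0} s *
    emeasure (killed_law M \<xi> \<theta>m) {f \<in> space (path_alg {0..}). \<forall>j\<le>n. ereal u + f (t j - s) \<in> ereal ` B j}"
proof (cases "s \<le> t 0")
  case True
  then have ts: "s \<le> t j" if "j \<le> n" for j using t_mono[of 0 j] that by simp
  let ?S = "{f \<in> space (path_alg {0..}). \<forall>j\<in>{..n}. ereal u + f (t j - s) \<in> ereal ` B j}"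
  have "{\<omega> \<in> space \<Omega>. path (Plus 0) (s, u) (driver (Plus 0) \<omega>) \<in> marginal} = {\<omega> \<in> space \<Omega>. Lp 0 \<omega> \<in> ?S}"
  proof (intro Collect_cong conj_cong refl)
    fix \<omega> assume "\<omega> \<in> space \<Omega>"
    then have "Lp 0 \<omega> \<in> space (cadlag_space {0..})" "Lp 0 \<omega> \<in> space (path_alg {0..})"
      using measurable_space[OF Lp_rv[of 0]] measurable_space[OF L_path(2)[of 0]] by auto
    moreover have "plus_path s u (Lp 0 \<omega>) (t j) = ereal u + Lp 0 \<omega> (t j - s)" if "j \<le> n" for j
      using ts[OF that] by (simp add: plus_path_def)
    ultimately show "path (Plus 0) (s, u) (driver (Plus 0) \<omega>) \<in> marginal \<longleftrightarrow> Lp 0 \<omega> \<in> ?S"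
      by (simp add: space_Dbar space_cadlag_space cadlag_plus_path Ball_def)
  qed
  then have "mark_avg (Plus 0) (indicator marginal) (s, u) = emeasure (distr \<Omega> (path_alg {0..}) (Lp 0)) ?S"
    using B ts by (subst law_emeasure[OF L_path(2)]) (auto intro!: path_cylinder_measurable simp: mark_avg_indicator[OF marginal_measurable])
  then show ?thesis using True by (simp add: Lp_law Ball_def)
next
  case False
  then have e: "{\<omega> \<in> space \<Omega>. path (Plus 0) (s, u) (driver (Plus 0) \<omega>) \<in> marginal} = {}"
    by (auto simp: plus_path_def intro!: exI[of _ 0])
  show ?thesis unfolding mark_avg_indicator[OF marginal_measurable] e using False by simp
qed

text \<open>The inequality is strict because a backward particle is already -\<infinity> at its
  starting time.\<close>

lemma minus_avg:
  "mark_avg (Minus 0) (indicator marginal) (s, u) = indicator {t n<..} s *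
    emeasure (killed_law M' \<xi>' \<theta>p) {f \<in> space (path_alg {0..}). \<forall>j\<le>n. ereal u + f (s - t j) \<in> ereal ` B j}"
proof (cases "t n < s")
  case True
  then have ts: "t j < s" if "j \<le> n" for j using t_mono[of j n] that by simp
  let ?S = "{f \<in> space (path_alg {0..}). \<forall>j\<in>{..n}. ereal u + f (s - t j) \<in> ereal ` B j}"
  have "{\<omega> \<in> space \<Omega>. path (Minus 0) (s, u) (driver (Minus 0) \<omega>) \<in> marginal} = {\<omega> \<in> space \<Omega>. Lm 0 \<omega> \<in> ?S}"
  proof (intro Collect_cong conj_cong refl)
    fix \<omega> assume "\<omega> \<in> space \<Omega>"
    then have "Lm 0 \<omega> \<in> space (caglad_space {0..})" "Lm 0 \<omega> \<in> space (path_alg {0..})"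
      using measurable_space[OF Lm_rv[of 0]] measurable_space[OF L_path(3)[of 0]] by auto
    moreover have "minus_path s u (Lm 0 \<omega>) (t j) = ereal u + Lm 0 \<omega> (s - t j)" if "j \<le> n" for j
      using ts[OF that] by (simp add: minus_path_def)
    ultimately show "path (Minus 0) (s, u) (driver (Minus 0) \<omega>) \<in> marginal \<longleftrightarrow> Lm 0 \<omega> \<in> ?S"
      by (simp add: space_Dbar space_caglad_space cadlag_minus_path Ball_def)
  qed
  then have "mark_avg (Minus 0) (indicator marginal) (s, u) = emeasure (distr \<Omega> (path_alg {0..}) (Lm 0)) ?S"
    using B less_imp_le[OF ts] by (subst law_emeasure[OF L_path(3)]) (auto intro!: path_cylinder_measurable simp: mark_avg_indicator[OF marginal_measurable])
  then show ?thesis using True by (simp add: Lm_law Ball_def)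
next
  case False
  then have e: "{\<omega> \<in> space \<Omega>. path (Minus 0) (s, u) (driver (Minus 0) \<omega>) \<in> marginal} = {}"
    by (auto simp: minus_path_def intro!: exI[of _ n])
  show ?thesis unfolding mark_avg_indicator[OF marginal_measurable] e using False by simp
qed

lemma plus_tot: "s \<le> t 0 \<Longrightarrow> (\<integral>\<^sup>+u. ennreal (exp (- u)) * emeasure (killed_law M \<xi> \<theta>m)
      {f \<in> space (path_alg {0..}). \<forall>j\<le>n. ereal u + f (t j - s) \<in> ereal ` B j} \<partial>lborel) =
    ennreal (exp (- \<theta>p * (t 0 - s))) * total t B n"
  by (rule plus_total) ((erule t B | assumption)+)

lemma minus_tot: "t n \<le> s \<Longrightarrow> (\<integral>\<^sup>+u. ennreal (exp (- u)) * emeasure (killed_law M' \<xi>' \<theta>p)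
      {f \<in> space (path_alg {0..}). \<forall>j\<le>n. ereal u + f (s - t j) \<in> ereal ` B j} \<partial>lborel) =
    ennreal (exp (- \<theta>m * (s - t n))) * total t B n"
  by (rule minus_total) ((erule t B | assumption)+)

text \<open>Time 0 lies before all observation times, after all of them, or between. In the first
  two cases survival up to the nearest one costs a factor; in the last the two halves of the path
  join without loss.\<close>

lemma central_integral:
  "(\<integral>\<^sup>+u. mark_avg (Central 0) (indicator marginal) (0, u) \<partial>exp_intensity) =
    (if 0 \<le> t 0 then ennreal (exp (- \<theta>p * t 0)) else if t n < 0 then ennreal (exp (\<theta>m * t n)) else 1) * total t B n"
proof -
  note tot = plus_tot minus_tot
  have ind: "indicator marginal \<in> borel_measurable Dbar" by (rule borel_measurable_indicator[OF marginal_measurable])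
  have triv: "emeasure (killed_law M \<xi> \<theta>m) (space (path_alg {0..})) = 1" "emeasure (killed_law M' \<xi>' \<theta>p) (space (path_alg {0..})) = 1"
    using prob_space.emeasure_space_1[OF p.prob_space_killed_law] prob_space.emeasure_space_1[OF m.prob_space_killed_law]
    by (simp_all add: space_killed)
  have eq: "(\<integral>\<^sup>+u. mark_avg (Central 0) (indicator marginal) (0, u) \<partial>exp_intensity) = (\<integral>\<^sup>+u. ennreal (exp (- u)) *
     (emeasure (killed_law M \<xi> \<theta>m) {f \<in> space (path_alg {0..}). \<forall>j\<in>{j. j \<le> n \<and> t j \<ge> 0}. ereal u + f (t j) \<in> ereal ` B j} *
      emeasure (killed_law M' \<xi>' \<theta>p) {f \<in> space (path_alg {0..}). \<forall>j\<in>{j. j \<le> n \<and> t j < 0}. ereal u + f (- t j) \<in> ereal ` B j}) \<partial>lborel)"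
    using central_avg_measurable[OF ind] by (subst nn_integral_exp_intensity) (simp_all add: central_avg)
  consider "0 \<le> t 0" | "t 0 < 0" "t n < 0" | "t 0 < 0" "0 \<le> t n" by linarith
  then show ?thesis
  proof cases
    case 1
    have "t j \<ge> 0" if "j \<le> n" for j using t_mono[of 0 j] 1 that by simp
    then have s: "{j. j \<le> n \<and> t j \<ge> 0} = {j. j \<le> n}" "{j. j \<le> n \<and> t j < 0} = {}" by (auto simp: not_less)
    show ?thesis unfolding eq s using 1 tot(1)[of 0] by (simp add: triv)
  next
    case 2
    have neg: "t j < 0" if "j \<le> n" for j using t_mono[of j n] 2 that by simp
    have s: "{j. j \<le> n \<and> t j \<ge> 0} = {}" "{j. j \<le> n \<and> t j < 0} = {j. j \<le> n}" using neg by force+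
    show ?thesis unfolding eq s using 2 tot(2)[of 0] by (simp add: triv)
  next
    case 3
    let ?A = "{j. j \<le> n \<and> t j < 0}"
    \<comment> \<open>The last index with a negative time: the backward half of the path serves t 0,
      ..., t m and the forward half the rest.\<close>
    define m where "m = Max ?A"
    have fin: "finite ?A" by simp
    have "0 \<in> ?A" using 3 by simp
    then have "m \<in> ?A" unfolding m_def using fin by (intro Max_in) blast+
    then have m: "m \<le> n" "t m < 0" by auto
    have mge: "j \<le> m" if "j \<in> ?A" for j unfolding m_def using fin that by (rule Max_ge)
    have "m \<noteq> n" using 3 m by auto
    then have "m < n" using m by simp
    have m': "\<not> t (Suc m) < 0" using mge[of "Suc m"] \<open>m < n\<close> by auto
    have s1: "{j. j \<le> n \<and> t j \<ge> 0} = {Suc m..n}"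
    proof (intro set_eqI iffI)
      fix j assume "j \<in> {j. j \<le> n \<and> t j \<ge> 0}"
      then have "j \<le> n" "\<not> j \<le> m" using m t_mono[of j m] by auto
      then show "j \<in> {Suc m..n}" by auto
    next
      fix j assume "j \<in> {Suc m..n}"
      then show "j \<in> {j. j \<le> n \<and> t j \<ge> 0}" using m' t_mono[of "Suc m" j] by auto
    qed
    have s2: "?A = {..m}"
    proof (intro set_eqI iffI)
      fix j assume "j \<in> {j. j \<le> n \<and> t j < 0}"
      then show "j \<in> {..m}" using mge by simp
    next
      fix j assume "j \<in> {..m}"
      then show "j \<in> {j. j \<le> n \<and> t j < 0}" using m t_mono[of j m] by auto
    qed
    have "(\<integral>\<^sup>+u. ennreal (exp (- u)) *
      (emeasure (killed_law M' \<xi>' \<theta>p) {f \<in> space (path_alg {0..}). \<forall>j\<le>m. ereal u + f (0 - t j) \<in> ereal ` B j} *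
       emeasure (killed_law M \<xi> \<theta>m) {f \<in> space (path_alg {0..}). \<forall>j\<in>{Suc m..n}. ereal u + f (t j - 0) \<in> ereal ` B j}) \<partial>lborel) = total t B n"
      by (rule mid_total) ((erule t B)+, use \<open>m < n\<close> m m' in auto)
    then have "(\<integral>\<^sup>+u. mark_avg (Central 0) (indicator marginal) (0, u) \<partial>exp_intensity) = total t B n"
      unfolding eq s1 s2 by (simp only: mult.commute mult.left_commute diff_0_right diff_0 mem_Collect_eq Ball_def atMost_iff)
    then show ?thesis using 3 by simp
  qed
qed

text \<open>For a fixed birth time the integral over the level is a survival factor times the total;
  what remains is \<open>birth_integral\<close>, and there is nothing to integrate if t 0 <
  0.\<close>

lemma plus_integral:
  "(\<integral>\<^sup>+p. mark_avg (Plus 0) (indicator marginal) p \<partial>rate_intensity {0<..} \<theta>p) =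
    (if 0 \<le> t 0 then ennreal (1 - exp (- \<theta>p * t 0)) else 0) * total t B n"
proof -
  have ind: "indicator marginal \<in> borel_measurable Dbar" by (rule borel_measurable_indicator[OF marginal_measurable])
  have inner: "(\<integral>\<^sup>+u. ennreal (exp (- u)) * mark_avg (Plus 0) (indicator marginal) (s, u) \<partial>lborel) =
    indicator {..t 0} s * ennreal (exp (- \<theta>p * (t 0 - s))) * total t B n" for s
    by (cases "s \<le> t 0") (simp_all add: plus_avg plus_tot)
  have "(\<integral>\<^sup>+p. mark_avg (Plus 0) (indicator marginal) p \<partial>rate_intensity {0<..} \<theta>p) =
    (\<integral>\<^sup>+s. ennreal \<theta>p * indicator {0<..} s * (indicator {..t 0} s * ennreal (exp (- \<theta>p * (t 0 - s)))) * total t B n \<partial>lborel)"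
    by (subst nn_integral_rate_intensity) (auto simp: inner mark_avg_measurable[OF ind] mult.assoc)
  also have "\<dots> = (\<integral>\<^sup>+s. ennreal \<theta>p * indicator {0<..} s * (indicator {..t 0} s * ennreal (exp (- \<theta>p * (t 0 - s)))) \<partial>lborel) * total t B n"
    by (intro nn_integral_multc) measurable
  also have "(\<integral>\<^sup>+s. ennreal \<theta>p * indicator {0<..} s * (indicator {..t 0} s * ennreal (exp (- \<theta>p * (t 0 - s)))) \<partial>lborel) =
    (if 0 \<le> t 0 then ennreal (1 - exp (- \<theta>p * t 0)) else 0)"
  proof (cases "0 \<le> t 0")
    case True
    then show ?thesis using birth_integral[OF m.rate, of "t 0"] by simp
  next
    case False
    then have "ennreal \<theta>p * indicator {0<..} s * (indicator {..t 0} s * ennreal (exp (- \<theta>p * (t 0 - s)))) = 0" for s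
      by (auto simp: indicator_def)
    then show ?thesis using False by (simp only: if_False) simp
  qed
  finally show ?thesis .
qed

lemma minus_integral:
  "(\<integral>\<^sup>+p. mark_avg (Minus 0) (indicator marginal) p \<partial>rate_intensity {..<0} \<theta>m) =
    (if t n < 0 then ennreal (1 - exp (\<theta>m * t n)) else 0) * total t B n"
proof -
  have ind: "indicator marginal \<in> borel_measurable Dbar" by (rule borel_measurable_indicator[OF marginal_measurable])
  have inner: "(\<integral>\<^sup>+u. ennreal (exp (- u)) * mark_avg (Minus 0) (indicator marginal) (s, u) \<partial>lborel) =
    indicator {t n<..} s * ennreal (exp (- \<theta>m * (s - t n))) * total t B n" for s
    by (cases "t n < s") (simp_all add: minus_avg minus_tot)
  have "(\<integral>\<^sup>+p. mark_avg (Minus 0) (indicator marginal) p \<partial>rate_intensity {..<0} \<theta>m) =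
    (\<integral>\<^sup>+s. ennreal \<theta>m * indicator {..<0} s * (indicator {t n<..} s * ennreal (exp (- \<theta>m * (s - t n)))) * total t B n \<partial>lborel)"
    by (subst nn_integral_rate_intensity) (auto simp: inner mark_avg_measurable[OF ind] mult.assoc)
  also have "\<dots> = (\<integral>\<^sup>+s. ennreal \<theta>m * indicator {..<0} s * (indicator {t n<..} s * ennreal (exp (- \<theta>m * (s - t n)))) \<partial>lborel) * total t B n"
    by (intro nn_integral_multc) measurable
  also have "(\<integral>\<^sup>+s. ennreal \<theta>m * indicator {..<0} s * (indicator {t n<..} s * ennreal (exp (- \<theta>m * (s - t n)))) \<partial>lborel) =
    (if t n < 0 then ennreal (1 - exp (\<theta>m * t n)) else 0)"
  proof (cases "t n < 0")
    case True
    then show ?thesis using death_integral[OF p.rate, of "t n"] by simp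
  next
    case False
    then have "ennreal \<theta>m * indicator {..<0} s * (indicator {t n<..} s * ennreal (exp (- \<theta>m * (s - t n)))) = 0" for s
      by (auto simp: indicator_def)
    then show ?thesis using False by (simp only: if_False) simp
  qed
  finally show ?thesis .
qed

lemma total_eq: "total t B n = (\<integral>\<^sup>+x. ennreal (exp (- x)) * (indicator (B 0) x * kernel_chain p.q t B n 0 x) \<partial>lborel)"
proof -
  have 1: "total t B n = (\<integral>\<^sup>+x. ennreal (exp (- x)) * fwd t B n 0 x \<partial>lborel)" by (rule total_def) ((erule t B | assumption)+)
  have 2: "fwd t B n 0 x = indicator (B 0) x * kernel_chain p.q t B (n - 0) 0 x" for x
    by (rule fwd_def) ((erule t B | assumption)+)
  show ?thesis unfolding 1 2 diff_zero ..
qed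

theorem fdd_formula:
  "emeasure \<mu> marginal = (\<integral>\<^sup>+x\<in>B 0. ennreal (exp (- x)) * kernel_chain p.q t B n 0 x \<partial>lborel)"
proof -
  have ind: "indicator marginal \<in> borel_measurable Dbar" by (rule borel_measurable_indicator[OF marginal_measurable])
  \<comment> \<open>The shares of the central, forward and backward particles; they add up to 1
    wherever time 0 lies among the times.\<close>
  define c p m where "c = (if 0 \<le> t 0 then ennreal (exp (- \<theta>p * t 0)) else if t n < 0 then ennreal (exp (\<theta>m * t n)) else 1)"
    and "p = (if 0 \<le> t 0 then ennreal (1 - exp (- \<theta>p * t 0)) else 0)"
    and "m = (if t n < 0 then ennreal (1 - exp (\<theta>m * t n)) else 0)"
  have "c + p + m = 1"
  proof -
    consider "0 \<le> t 0" "0 \<le> t n" | "t 0 < 0" "t n < 0" | "t 0 < 0" "0 \<le> t n"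
      using t_mono[of 0 n] by fastforce
    then show ?thesis
    proof cases
      case 1
      have "exp (- \<theta>p * t 0) \<le> 1" using m.rate 1 by simp
      then have "ennreal (exp (- \<theta>p * t 0)) + ennreal (1 - exp (- \<theta>p * t 0)) = 1" by (subst ennreal_plus[symmetric]) auto
      then show ?thesis using 1 by (simp add: c_def p_def m_def)
    next
      case 2
      have "exp (\<theta>m * t n) \<le> 1" using p.rate 2 by (simp add: mult_nonneg_nonpos)
      then have "ennreal (exp (\<theta>m * t n)) + ennreal (1 - exp (\<theta>m * t n)) = 1" by (subst ennreal_plus[symmetric]) auto
      then show ?thesis using 2 by (simp add: c_def p_def m_def)
    next
      case 3
      then show ?thesis by (simp add: c_def p_def m_def)
    qed
  qed
  have "emeasure \<mu> marginal = (\<integral>\<^sup>+f. indicator marginal f \<partial>\<mu>)"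
    by (rule nn_integral_indicator[symmetric]) (simp only: sets_\<mu> marginal_measurable)
  also have "\<dots> = c * total t B n + p * total t B n + m * total t B n"
    unfolding c_def p_def m_def
    by (subst nn_integral_\<mu>[OF ind], subst central_integral, subst plus_integral, subst minus_integral, rule refl)
  also have "\<dots> = (c + p + m) * total t B n" by (simp only: distrib_right)
  also have "\<dots> = total t B n" unfolding \<open>c + p + m = 1\<close> by (rule mult_1)
  also have "\<dots> = (\<integral>\<^sup>+x\<in>B 0. ennreal (exp (- x)) * kernel_chain p.q t B n 0 x \<partial>lborel)"
    unfolding total_eq by (intro nn_integral_cong) (simp only: mult.assoc mult.commute mult.left_commute)
  finally show ?thesis .
qed

end

end

section \<open>Stationarity and max-stability\<close>

text \<open>The kernels commute with translations, being laws of x plus an increment.\<close>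

lemma (in levy) kernel_chain_translate:
  assumes "\<And>j. i \<le> j \<Longrightarrow> j < i + k \<Longrightarrow> t j \<le> t (Suc j)" "\<And>j. i < j \<Longrightarrow> j \<le> i + k \<Longrightarrow> B j \<in> sets borel"
  shows "kernel_chain q t (\<lambda>j. (\<lambda>x. x - c) -` B j) k i (c + x) = kernel_chain q t B k i x"
  using assms
proof (induction k arbitrary: i x)
  case (Suc k)
  have t: "t (Suc i) - t i \<ge> 0" using Suc.prems(1)[of i] by simp
  have B: "B (Suc i) \<in> sets borel" using Suc.prems by auto
  have vim: "(\<lambda>x. x - c) -` B j \<in> sets borel" if "B j \<in> sets borel" for j
    using measurable_sets[of "\<lambda>x. x - c" borel borel "B j"] that by simp
  have m: "(\<lambda>y. kernel_chain q t (\<lambda>j. (\<lambda>x. x - c) -` B j) k (Suc i) y) \<in> borel_measurable borel"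
    "(\<lambda>y. kernel_chain q t B k (Suc i) y) \<in> borel_measurable borel"
    by (rule kernel_chain_measurable; use Suc.prems vim in auto)+
  have IH: "kernel_chain q t (\<lambda>j. (\<lambda>x. x - c) -` B j) k (Suc i) (c + y) = kernel_chain q t B k (Suc i) y" for y
    using Suc.prems by (intro Suc.IH) auto
  note [measurable] = m B vim[OF B]
  show ?case
    using t by (simp add: nn_integral_q add.assoc IH indicator_def)
qed simp

lemma all_le_0: "(\<forall>j\<le>(0::nat). P j) \<longleftrightarrow> P 0"
  by auto

text \<open>Let r tend to 0. This will show that no particle is dead from the start.\<close>

lemma zero_by_exp_bound:
  fixes x :: ennreal
  assumes "\<And>r. r > 0 \<Longrightarrow> x \<le> ennreal (1 - exp (- \<theta> * r))"
  shows "x = 0"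
proof -
  have "(\<lambda>n. ennreal (1 - exp (- \<theta> * inverse (real (Suc n))))) \<longlonglongrightarrow> ennreal (1 - exp (- \<theta> * 0))"
    by (intro tendsto_ennrealI tendsto_intros LIMSEQ_inverse_real_of_nat)
  then have "x \<le> ennreal (1 - exp (- \<theta> * 0))"
  proof (rule LIMSEQ_le_const)
    show "\<exists>N. \<forall>n\<ge>N. x \<le> ennreal (1 - exp (- \<theta> * inverse (real (Suc n))))"
      by (rule exI[of _ 0], intro allI impI, rule assms) simp
  qed
  then show ?thesis by simp
qed

text \<open>Distribution functions determine the law on a finite product. Levels may be \<infinity>,
  so that a condition on one coordinate and the whole space are events of the same form.\<close>

lemma distr_finite_dim_eqI:
  fixes X :: "real \<Rightarrow> 'v \<Rightarrow> ereal" and Y :: "real \<Rightarrow> 'w \<Rightarrow> ereal"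
  assumes M: "prob_space M" "prob_space N" and J: "finite J"
    and X: "\<And>t. X t \<in> borel_measurable M" and Y: "\<And>t. Y t \<in> borel_measurable N"
    and eq: "\<And>y. emeasure M {\<omega>\<in>space M. \<forall>t\<in>J. X t \<omega> \<le> y t} = emeasure N {\<omega>\<in>space N. \<forall>t\<in>J. Y t \<omega> \<le> y t}"
  shows "distr M (path_alg J) (\<lambda>\<omega>. \<lambda>t\<in>J. X t \<omega>) = distr N (path_alg J) (\<lambda>\<omega>. \<lambda>t\<in>J. Y t \<omega>)"
proof -
  interpret M: prob_space M by fact
  have mX: "(\<lambda>\<omega>. \<lambda>t\<in>J. X t \<omega>) \<in> M \<rightarrow>\<^sub>M path_alg J" by (intro measurable_restrict X)
  have mY: "(\<lambda>\<omega>. \<lambda>t\<in>J. Y t \<omega>) \<in> N \<rightarrow>\<^sub>M path_alg J" by (intro measurable_restrict Y)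
  define Z :: "(real \<Rightarrow> ereal) set" where "Z = space (path_alg J)"
  define G :: "(real \<Rightarrow> ereal) \<Rightarrow> (real \<Rightarrow> ereal) set" where "G y = {f \<in> Z. \<forall>t\<in>J. f t \<le> y t}" for y
  define E where "E = range G"
  have Gm: "G y \<in> sets (path_alg J)" for y
    unfolding G_def Z_def
  proof (rule sets.sets_Collect_finite_All[OF _ J])
    fix t assume "t \<in> J"
    then have "(\<lambda>f. f t) \<in> borel_measurable (path_alg J)" by (rule measurable_component_singleton)
    from measurable_sets[OF this, of "{..y t}"] show "{f \<in> space (path_alg J). f t \<le> y t} \<in> sets (path_alg J)"
      by (simp add: vimage_def Int_def conj_commute)
  qed
  have EZ: "E \<subseteq> Pow Z" by (auto simp: E_def G_def)
  let ?S = "sigma Z E"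
  have sS: "sets ?S = sigma_sets Z E" "space ?S = Z" using EZ by (auto simp: space_measure_of)
  have "(\<lambda>f. f) \<in> ?S \<rightarrow>\<^sub>M path_alg J"
  proof (rule measurable_PiM_single')
    fix t assume t: "t \<in> J"
    show "(\<lambda>f. f t) \<in> borel_measurable ?S"
    proof (rule borel_measurableI_le)
      fix a
      have "{f \<in> space ?S. f t \<le> a} = G ((\<lambda>_. \<infinity>)(t := a))" using t unfolding sS(2) by (auto simp: G_def)
      also have "\<dots> \<in> sets ?S" unfolding sS(1) by (rule sigma_sets.Basic) (simp add: E_def)
      finally show "{f \<in> space ?S. f t \<le> a} \<in> sets ?S" .
    qed
  next
    show "(\<lambda>f. f) \<in> space ?S \<rightarrow> (\<Pi>\<^sub>E i\<in>J. space borel)" unfolding sS(2) unfolding Z_def by (simp add: space_PiM)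
  qed
  then have "A \<in> sigma_sets Z E" if "A \<in> sets (path_alg J)" for A
    using measurable_sets[of "\<lambda>f. f" ?S "path_alg J" A] that sets.sets_into_space[OF that]
    unfolding sS by (simp add: Z_def Int_absorb2)
  moreover have "sigma_sets Z E \<subseteq> sets (path_alg J)"
    unfolding Z_def using Gm by (intro sets.sigma_sets_subset) (auto simp: E_def)
  ultimately have gen: "sets (path_alg J) = sigma_sets Z E" by blast
  show ?thesis
  proof (rule measure_eqI_generator_eq[where E=E and \<Omega>=Z and A="\<lambda>_. Z"])
    show "Int_stable E"
    proof (rule Int_stableI)
      fix a b assume "a \<in> E" "b \<in> E"
      then obtain y y' where "a = G y" "b = G y'" by (auto simp: E_def)
      then have "a \<inter> b = G (\<lambda>t. min (y t) (y' t))" by (auto simp: G_def)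
      then show "a \<inter> b \<in> E" by (auto simp: E_def)
    qed
    have "Z = G (\<lambda>_. \<infinity>)" by (auto simp: G_def)
    then show "range (\<lambda>_. Z) \<subseteq> E" by (auto simp: E_def)
    show "emeasure (distr M (path_alg J) (\<lambda>\<omega>. \<lambda>t\<in>J. X t \<omega>)) A = emeasure (distr N (path_alg J) (\<lambda>\<omega>. \<lambda>t\<in>J. Y t \<omega>)) A" if "A \<in> E" for A
    proof -
      obtain y where y: "A = G y" using \<open>A \<in> E\<close> by (auto simp: E_def)
      have "(\<lambda>\<omega>. \<lambda>t\<in>J. X t \<omega>) -` A \<inter> space M = {\<omega>\<in>space M. \<forall>t\<in>J. X t \<omega> \<le> y t}"
        "(\<lambda>\<omega>. \<lambda>t\<in>J. Y t \<omega>) -` A \<inter> space N = {\<omega>\<in>space N. \<forall>t\<in>J. Y t \<omega> \<le> y t}"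
        unfolding y by (auto simp: G_def Z_def space_PiM)
      then show ?thesis using Gm eq by (simp add: emeasure_distr[OF mX] emeasure_distr[OF mY] y)
    qed
    show "emeasure (distr M (path_alg J) (\<lambda>\<omega>. \<lambda>t\<in>J. X t \<omega>)) Z \<noteq> \<infinity>" for i :: nat
      using prob_space.emeasure_le_1[OF M.prob_space_distr[OF mX], of Z] by (auto simp: top_unique)
  qed (use EZ gen in auto)
qed

section \<open>Mass of the dead path and invariance of the intensity\<close>

context particle_system
begin

lemma mark_avg_disjoint:
  assumes "A \<in> sets Dbar" "A' \<in> sets Dbar" "A \<inter> A' = {}"
  shows "mark_avg k (indicator A) p + mark_avg k (indicator A') p \<le> 1"
proof -
  have m: "(\<lambda>\<omega>. path k p (driver k \<omega>)) \<in> \<Omega> \<rightarrow>\<^sub>M Dbar"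
    by (rule measurable_compose[OF measurable_gen[OF driver_measurable[where A=UNIV]] path_fixed_measurable]) simp
  have "mark_avg k (indicator A) p + mark_avg k (indicator A') p =
    (\<integral>\<^sup>+\<omega>. indicator A (path k p (driver k \<omega>)) + indicator A' (path k p (driver k \<omega>)) \<partial>\<Omega>)"
    unfolding mark_avg_def
    by (intro nn_integral_add[symmetric] measurable_compose[OF m borel_measurable_indicator] assms)
  also have "\<dots> \<le> (\<integral>\<^sup>+\<omega>. 1 \<partial>\<Omega>)"
    using assms(3) by (intro nn_integral_mono) (auto simp: indicator_def)
  finally show ?thesis by (simp add: emeasure_space_1)
qed

text \<open>A trajectory alive at q is not the dead path, and some q make it alive with probability
  e^(-\<theta> r), which tends to 1 as r decreases to 0.\<close>

lemma mark_bottom: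
  assumes avg: "\<And>r. r > 0 \<Longrightarrow> \<exists>q. mark_avg k (indicator {f \<in> space Dbar. \<forall>j\<le>(0::nat). f q \<in> ereal ` UNIV}) p = ennreal (exp (- \<theta> * r))"
  shows "mark_avg k (indicator bottom) p = 0"
proof (rule zero_by_exp_bound[where \<theta>=\<theta>])
  fix r :: real assume "r > 0"
  then obtain q where q: "mark_avg k (indicator {f \<in> space Dbar. \<forall>j\<le>(0::nat). f q \<in> ereal ` UNIV}) p = ennreal (exp (- \<theta> * r))"
    using avg by blast
  have "mark_avg k (indicator bottom) p + ennreal (exp (- \<theta> * r)) \<le> 1"
    unfolding q[symmetric]
  proof (rule mark_avg_disjoint[OF bottom_measurable])
    show "{f \<in> space Dbar. \<forall>j\<le>(0::nat). f q \<in> ereal ` UNIV} \<in> sets Dbar"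
      by (rule finite_marginal_measurable[where t="\<lambda>_. q" and B="\<lambda>_. UNIV"]) simp
  qed (auto simp: bottom_def)
  then have "mark_avg k (indicator bottom) p \<le> 1 - ennreal (exp (- \<theta> * r))"
    by (metis ennreal_minus_mono order_refl ennreal_add_diff_cancel_right ennreal_neq_top)
  also have "\<dots> = ennreal (1 - exp (- \<theta> * r))" by (simp add: ennreal_minus flip: ennreal_1)
  finally show "mark_avg k (indicator bottom) p \<le> ennreal (1 - exp (- \<theta> * r))" .
qed

lemma killed_law_alive:
  assumes "r \<ge> 0"
  shows "emeasure (killed_law M \<xi> \<theta>m) {f \<in> space (path_alg {0..}). \<forall>j\<le>(0::nat). ereal u + f r \<in> ereal ` UNIV} = ennreal (exp (- \<theta>m * r))"
    "emeasure (killed_law M' \<xi>' \<theta>p) {f \<in> space (path_alg {0..}). \<forall>j\<le>(0::nat). ereal u + f r \<in> ereal ` UNIV} = ennreal (exp (- \<theta>p * r))"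
  using p.killed_law_chain[of "\<lambda>_. r" 0 "\<lambda>_. UNIV" u] m.killed_law_chain[of "\<lambda>_. r" 0 "\<lambda>_. UNIV" u] p.q_mass[OF assms] m.q_mass[OF assms] assms
  by (simp_all only: kernel_chain.simps indicator_UNIV mult_1_right mult_1_left) simp_all

text \<open>Every particle is almost surely alive close to its starting time: just after it for the
  forward kind, just before it for the backward kind. A central one is tested at positive times,
  where its forward half decides.\<close>

lemma bottom_null: "emeasure \<mu> bottom = 0"
proof -
  have c: "mark_avg (Central 0) (indicator bottom) (0, u) = 0" for u
  proof (rule mark_bottom[where \<theta>=\<theta>m])
    fix r :: real assume r: "r > 0"
    have s: "{j :: nat. j \<le> 0 \<and> r \<ge> 0} = {j. j \<le> 0}" "{j :: nat. j \<le> 0 \<and> r < 0} = {}" using r by auto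
    have "emeasure (killed_law M' \<xi>' \<theta>p) (space (path_alg {0..})) = 1"
      using prob_space.emeasure_space_1[OF m.prob_space_killed_law] by (simp add: space_killed)
    then show "\<exists>q. mark_avg (Central 0) (indicator {f \<in> space Dbar. \<forall>j\<le>(0::nat). f q \<in> ereal ` UNIV}) (0, u) = ennreal (exp (- \<theta>m * r))"
      using central_avg[of 0 "\<lambda>_. r" "\<lambda>_. UNIV" u] killed_law_alive(1)[of r u] r unfolding s
      by (intro exI[of _ r]) simp
  qed
  have p: "mark_avg (Plus 0) (indicator bottom) x = 0" for x
  proof (rule mark_bottom[where \<theta>=\<theta>m])
    fix r :: real assume r: "r > 0"
    show "\<exists>q. mark_avg (Plus 0) (indicator {f \<in> space Dbar. \<forall>j\<le>(0::nat). f q \<in> ereal ` UNIV}) x = ennreal (exp (- \<theta>m * r))"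
      using plus_avg[of 0 "\<lambda>_. fst x + r" "\<lambda>_. UNIV" "fst x" "snd x"] killed_law_alive(1)[of r "snd x"] r
      by (intro exI[of _ "fst x + r"]) simp
  qed
  have m: "mark_avg (Minus 0) (indicator bottom) x = 0" for x
  proof (rule mark_bottom[where \<theta>=\<theta>p])
    fix r :: real assume r: "r > 0"
    show "\<exists>q. mark_avg (Minus 0) (indicator {f \<in> space Dbar. \<forall>j\<le>(0::nat). f q \<in> ereal ` UNIV}) x = ennreal (exp (- \<theta>p * r))"
      using minus_avg[of 0 "\<lambda>_. fst x - r" "\<lambda>_. UNIV" "fst x" "snd x"] killed_law_alive(2)[of r "snd x"] r
      by (intro exI[of _ "fst x - r"]) simp
  qed
  have "emeasure \<mu> bottom = (\<integral>\<^sup>+f. indicator bottom f \<partial>\<mu>)"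
    by (rule nn_integral_indicator[symmetric]) (simp only: sets_\<mu> bottom_measurable)
  also have "\<dots> = 0"
  proof -
    have "mark_avg (Plus 0) (indicator bottom) = (\<lambda>_. 0)" "mark_avg (Minus 0) (indicator bottom) = (\<lambda>_. 0)"
      by (rule ext, rule p, rule ext, rule m)
    then show ?thesis
      by (subst nn_integral_\<mu>[OF borel_measurable_indicator[OF bottom_measurable]]) (simp add: c)
  qed
  finally show ?thesis .
qed

text \<open>The marginal at a single time, integrated above a. Its finiteness gives a
  \<sigma>-finite cover, and its value becomes the exponent of the Gumbel distribution.\<close>

lemma \<mu>_above: "emeasure \<mu> (cylinder {q} (\<lambda>_. {a<..})) = ennreal (exp (- a))"
proof -
  have "cylinder {q} (\<lambda>_. {a<..}) = {f \<in> space Dbar. \<forall>j\<le>(0::nat). f ((\<lambda>_. q) j) \<in> ereal ` ((\<lambda>_. {a<..}) j)}"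
    unfolding cylinder_def all_le_0 by simp
  also have "emeasure \<mu> \<dots> = (\<integral>\<^sup>+x\<in>{a<..}. ennreal (exp (- x)) * kernel_chain p.q (\<lambda>_. q) (\<lambda>_. {a<..}) 0 0 x \<partial>lborel)"
    by (rule fdd_formula) simp_all
  also have "\<dots> = ennreal (exp (- a))" unfolding kernel_chain.simps mult_1_right by (rule nn_integral_exp_tail)
  finally show ?thesis .
qed

lemma sigma_finite_\<mu>: "sigma_finite_measure \<mu>"
proof
  let ?A = "insert bottom ((\<lambda>(q, m). cylinder {q} (\<lambda>_. {- real m<..})) ` (\<rat> \<times> (UNIV :: nat set)))"
  have c: "f \<in> \<Union>?A" if f: "f \<in> space Dbar" for f
  proof (cases "f \<in> bottom")
    case False
    then obtain q where q: "q \<in> \<rat>" "f q \<noteq> -\<infinity>" using f by (auto simp: bottom_rational)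
    then obtain r where r: "f q = ereal r" using Dbar_not_infty[OF f, of q] by (cases "f q") auto
    obtain m :: nat where "- r < real m" using reals_Archimedean2 by blast
    then have "f \<in> cylinder {q} (\<lambda>_. {- real m<..})" using f r by (auto simp: cylinder_def)
    then show ?thesis using q by auto
  qed auto
  have s: "\<Union>?A \<subseteq> space Dbar" by (auto simp: bottom_def cylinder_def)
  have U: "\<Union>?A = space \<mu>" unfolding space_\<mu> by (rule subset_antisym[OF s subsetI[OF c]])
  show "\<exists>A. countable A \<and> A \<subseteq> sets \<mu> \<and> \<Union>A = space \<mu> \<and> (\<forall>a\<in>A. emeasure \<mu> a \<noteq> \<infinity>)"
  proof (intro exI[of _ ?A] conjI U)
    show "countable ?A" by (auto simp: countable_rat)
    show "?A \<subseteq> sets \<mu>" by (auto intro!: cylinder_measurable bottom_measurable)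
    show "\<forall>a\<in>?A. emeasure \<mu> a \<noteq> \<infinity>" by (auto simp: \<mu>_above bottom_null)
  qed
qed

lemma \<mu>_eqI:
  assumes sets: "sets M2 = sets Dbar" and bot: "emeasure M2 bottom = 0"
    and eq: "\<And>(t :: nat \<Rightarrow> real) (B :: nat \<Rightarrow> real set) n :: nat. (\<And>i. i < n \<Longrightarrow> t i < t (Suc i)) \<Longrightarrow> (\<And>i. i \<le> n \<Longrightarrow> B i \<in> sets borel) \<Longrightarrow>
      (\<integral>\<^sup>+x\<in>B 0. ennreal (exp (- x)) * kernel_chain p.q t B n 0 x \<partial>lborel) = emeasure M2 {f \<in> space Dbar. \<forall>i\<le>n. f (t i) \<in> ereal ` B i}"
  shows "\<mu> = M2"
proof (rule Dbar_measure_eqI[OF sets_\<mu> sets bottom_null bot])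
  show "emeasure \<mu> (cylinder {q} (\<lambda>_. {- real m<..})) \<noteq> \<infinity>" for q m by (simp add: \<mu>_above)
  fix t :: "nat \<Rightarrow> real" and B :: "nat \<Rightarrow> real set" and n :: nat assume t: "\<And>i. i < n \<Longrightarrow> t i < t (Suc i)" and B: "\<And>i. i \<le> n \<Longrightarrow> B i \<in> sets borel"
  have "emeasure \<mu> {f \<in> space Dbar. \<forall>i\<le>n. f (t i) \<in> ereal ` B i} = (\<integral>\<^sup>+x\<in>B 0. ennreal (exp (- x)) * kernel_chain p.q t B n 0 x \<partial>lborel)"
    by (rule fdd_formula) (use less_imp_le[OF t] B in auto)
  then show "emeasure \<mu> {f \<in> space Dbar. \<forall>i\<le>n. f (t i) \<in> ereal ` B i} = emeasure M2 {f \<in> space Dbar. \<forall>i\<le>n. f (t i) \<in> ereal ` B i}"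
    using eq[of n t B] t B by simp
qed

lemma measurable_\<mu>: "f \<in> Dbar \<rightarrow>\<^sub>M S \<Longrightarrow> f \<in> \<mu> \<rightarrow>\<^sub>M S"
  by (subst measurable_cong_sets[OF sets_\<mu> refl])

lemma \<mu>_shift: "distr \<mu> Dbar (time_shift h) = \<mu>"
proof (rule \<mu>_eqI[symmetric])
  note m = measurable_\<mu>[OF measurable_time_shift[of h]]
  have "time_shift h -` bottom \<inter> space \<mu> = bottom"
  proof (intro set_eqI iffI)
    fix f assume f: "f \<in> time_shift h -` bottom \<inter> space \<mu>"
    then have "time_shift h f (s + h) = -\<infinity>" for s by (auto simp: bottom_def)
    then show "f \<in> bottom" using f by (simp add: bottom_def time_shift_def)
  next
    fix f assume f: "f \<in> bottom"
    then have "time_shift h f \<in> space Dbar" using measurable_space[OF measurable_time_shift] by (auto simp: bottom_def)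
    then show "f \<in> time_shift h -` bottom \<inter> space \<mu>" using f by (simp add: bottom_def time_shift_def)
  qed
  then show "emeasure (distr \<mu> Dbar (time_shift h)) bottom = 0"
    by (simp add: emeasure_distr[OF m bottom_measurable] bottom_null)
  fix t :: "nat \<Rightarrow> real" and B :: "nat \<Rightarrow> real set" and n :: nat assume t: "\<And>i. i < n \<Longrightarrow> t i < t (Suc i)" and B: "\<And>i. i \<le> n \<Longrightarrow> B i \<in> sets borel"
  let ?S = "{f \<in> space Dbar. \<forall>i\<le>n. f (t i) \<in> ereal ` B i}"
  have "time_shift h -` ?S \<inter> space \<mu> = {f \<in> space Dbar. \<forall>i\<le>n. f (t i - h) \<in> ereal ` B i}"
    using measurable_space[OF measurable_time_shift[of h]] by (auto simp: time_shift_def)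
  then have "emeasure (distr \<mu> Dbar (time_shift h)) ?S = emeasure \<mu> {f \<in> space Dbar. \<forall>i\<le>n. f (t i - h) \<in> ereal ` B i}"
    by (simp only: emeasure_distr[OF m finite_marginal_measurable[OF B]])
  also have "\<dots> = (\<integral>\<^sup>+x\<in>B 0. ennreal (exp (- x)) * kernel_chain p.q (\<lambda>i. t i - h) B n 0 x \<partial>lborel)"
    by (rule fdd_formula) (use less_imp_le[OF t] B in auto)
  also have "(\<lambda>x. kernel_chain p.q (\<lambda>i. t i - h) B n 0 x) = (\<lambda>x. kernel_chain p.q t B n 0 x)"
    using kernel_chain_shift[of p.q t 0 h B n 0] by (simp only: add_0_right)
  finally show "(\<integral>\<^sup>+x\<in>B 0. ennreal (exp (- x)) * kernel_chain p.q t B n 0 x \<partial>lborel) = emeasure (distr \<mu> Dbar (time_shift h)) ?S"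
    by simp
qed simp

lemma measurable_translate: "central_path u \<in> Dbar \<rightarrow>\<^sub>M Dbar"
proof (rule measurable_DbarI)
  show "cadlag_on UNIV (central_path u f)" if "f \<in> space Dbar" for f
    using that by (auto simp: space_Dbar intro: cadlag_central_path)
  show "(\<lambda>f. central_path u f t) \<in> borel_measurable Dbar" for t
    unfolding central_path_def by (intro borel_measurable_ereal_add measurable_Dbar_eval borel_measurable_const)
qed

text \<open>Substituting c + x for x multiplies the density e^(-x) by e^(-c) and leaves the kernels
  unchanged, so lowering all paths by c scales \<mu> by e^(-c).\<close>

lemma \<mu>_translate: "scale_measure (ennreal (exp c)) (distr \<mu> Dbar (central_path (- c))) = \<mu>"
proof (rule \<mu>_eqI[symmetric])
  note m = measurable_\<mu>[OF measurable_translate[of "- c"]]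
  have e: "ereal (- c) + x = -\<infinity> \<longleftrightarrow> x = -\<infinity>" for x by (cases x) auto
  have "central_path (- c) -` bottom \<inter> space \<mu> = bottom"
    using measurable_space[OF measurable_translate[of "- c"]] by (auto simp: bottom_def central_path_def e)
  then show "emeasure (scale_measure (ennreal (exp c)) (distr \<mu> Dbar (central_path (- c)))) bottom = 0"
    by (simp add: emeasure_distr[OF m bottom_measurable] bottom_null)
  fix t :: "nat \<Rightarrow> real" and B :: "nat \<Rightarrow> real set" and n :: nat assume t: "\<And>i. i < n \<Longrightarrow> t i < t (Suc i)" and B: "\<And>i. i \<le> n \<Longrightarrow> B i \<in> sets borel"
  let ?S = "{f \<in> space Dbar. \<forall>i\<le>n. f (t i) \<in> ereal ` B i}"
  \<comment> \<open>The set B i raised by c, which is its preimage under the lowering of the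
    paths.\<close>
  define B' where "B' i = (\<lambda>x. x - c) -` B i" for i
  have B': "B' i \<in> sets borel" if "i \<le> n" for i
    using measurable_sets[of "\<lambda>x. x - c" borel borel "B i"] B[OF that] by (simp add: B'_def)
  have im: "ereal (- c) + x \<in> ereal ` B i \<longleftrightarrow> x \<in> ereal ` B' i" for x i
    by (cases x) (auto simp: B'_def image_iff)
  have "central_path (- c) -` ?S \<inter> space \<mu> = {f \<in> space Dbar. \<forall>i\<le>n. f (t i) \<in> ereal ` B' i}"
    using measurable_space[OF measurable_translate[of "- c"]] by (auto simp: central_path_def im)
  then have "emeasure (distr \<mu> Dbar (central_path (- c))) ?S = emeasure \<mu> {f \<in> space Dbar. \<forall>i\<le>n. f (t i) \<in> ereal ` B' i}"
    by (simp only: emeasure_distr[OF m finite_marginal_measurable[OF B]])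
  also have "\<dots> = (\<integral>\<^sup>+x\<in>B' 0. ennreal (exp (- x)) * kernel_chain p.q t B' n 0 x \<partial>lborel)"
    by (rule fdd_formula) (use less_imp_le[OF t] B' in auto)
  also have "\<dots> = (\<integral>\<^sup>+x. ennreal (exp (- (c + x))) * kernel_chain p.q t B' n 0 (c + x) * indicator (B' 0) (c + x) \<partial>lborel)"
  proof -
    have [measurable]: "B' 0 \<in> sets borel" "(\<lambda>x. kernel_chain p.q t B' n 0 x) \<in> borel_measurable borel"
      using B' less_imp_le[OF t] by (auto intro!: p.kernel_chain_measurable)
    show ?thesis by (subst nn_integral_real_affine[where t=c and c=1]) simp_all
  qed
  also have "\<dots> = (\<integral>\<^sup>+x. ennreal (exp (- c)) * (ennreal (exp (- x)) * kernel_chain p.q t B n 0 x * indicator (B 0) x) \<partial>lborel)"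
  proof (rule nn_integral_cong)
    fix x :: real
    have "kernel_chain p.q t B' n 0 (c + x) = kernel_chain p.q t B n 0 x"
      unfolding B'_def by (rule p.kernel_chain_translate) (use less_imp_le[OF t] B in auto)
    moreover have "indicator (B' 0) (c + x) = (indicator (B 0) x :: ennreal)" by (simp add: B'_def indicator_def)
    moreover have "ennreal (exp (- (c + x))) = ennreal (exp (- c)) * ennreal (exp (- x))"
      by (simp add: mult_exp_exp flip: ennreal_mult)
    ultimately show "ennreal (exp (- (c + x))) * kernel_chain p.q t B' n 0 (c + x) * indicator (B' 0) (c + x) =
      ennreal (exp (- c)) * (ennreal (exp (- x)) * kernel_chain p.q t B n 0 x * indicator (B 0) x)"
      by (simp only: mult.assoc)
  qed
  also have "\<dots> = ennreal (exp (- c)) * (\<integral>\<^sup>+x\<in>B 0. ennreal (exp (- x)) * kernel_chain p.q t B n 0 x \<partial>lborel)"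
  proof -
    have [measurable]: "B 0 \<in> sets borel" "(\<lambda>x. kernel_chain p.q t B n 0 x) \<in> borel_measurable borel"
      using B less_imp_le[OF t] by (auto intro!: p.kernel_chain_measurable)
    show ?thesis by (intro nn_integral_cmult) measurable
  qed
  finally have "emeasure (distr \<mu> Dbar (central_path (- c))) ?S =
    ennreal (exp (- c)) * (\<integral>\<^sup>+x\<in>B 0. ennreal (exp (- x)) * kernel_chain p.q t B n 0 x \<partial>lborel)" .
  moreover have "ennreal (exp c) * (ennreal (exp (- c)) * z) = z" for z
    by (simp add: mult.assoc[symmetric] exp_minus flip: ennreal_mult)
  ultimately show "(\<integral>\<^sup>+x\<in>B 0. ennreal (exp (- x)) * kernel_chain p.q t B n 0 x \<partial>lborel) =
    emeasure (scale_measure (ennreal (exp c)) (distr \<mu> Dbar (central_path (- c)))) ?S"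
    by (simp only: emeasure_scale_measure)
qed simp

lemma measure_algebra_\<mu>: "measure_algebra \<mu> = measure_algebra Dbar"
  by (rule measure_algebra_cong) simp

lemma counting_\<mu>: "counting \<Omega> \<mu> N"
  using counting_N by (simp add: counting_def)

theorem poisson_N: "poisson_point_process \<Omega> \<mu> N"
  by (rule laplace_imp_poisson[OF prob_space_axioms sigma_finite_\<mu> _ counting_\<mu> laplace_N])
     (simp add: measure_algebra_\<mu> N_measurable)

text \<open>The shifted process has the Laplace functional belonging to the image of \<mu> under the
  shift, which is \<mu> again, and the functional determines the law.\<close>

theorem N_shift: "distr \<Omega> (measure_algebra Dbar) (\<lambda>\<omega>. distr (N \<omega>) Dbar (time_shift h)) = distr \<Omega> (measure_algebra Dbar) N"
proof -
  let ?N = "\<lambda>\<omega>. distr (N \<omega>) Dbar (time_shift h)"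
  have sN: "sets (N \<omega>) = sets Dbar" for \<omega> by (simp add: N_def)
  have tN: "time_shift h \<in> N \<omega> \<rightarrow>\<^sub>M Dbar" for \<omega>
    by (subst measurable_cong_sets[OF sN refl]) (rule measurable_time_shift)
  have pre: "time_shift h -` B \<inter> space Dbar \<in> sets Dbar" if "B \<in> sets Dbar" for B
    using measurable_sets[OF measurable_time_shift that] .
  have em: "emeasure (?N \<omega>) B = emeasure (N \<omega>) (time_shift h -` B \<inter> space Dbar)" if "B \<in> sets Dbar" for \<omega> B
    using emeasure_distr[OF tN that] sets_eq_imp_space_eq[OF sN] by simp
  have Nm: "?N \<in> \<Omega> \<rightarrow>\<^sub>M measure_algebra \<mu>"
    unfolding measure_algebra_\<mu>
    by (rule measurable_measure_algebraI) (simp_all add: em pre measurable_emeasure_point_process[OF N_measurable])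
  have cnt: "counting \<Omega> \<mu> ?N"
    using counting_N by (auto simp: counting_def em pre)
  have lap: "laplace_functional \<Omega> \<mu> ?N"
    unfolding laplace_functional_def
  proof
    fix f :: "(real \<Rightarrow> ereal) \<Rightarrow> ennreal" assume "f \<in> borel_measurable \<mu>"
    then have f: "f \<in> borel_measurable Dbar" by (simp cong: measurable_cong_sets)
    have fs: "(\<lambda>x. f (time_shift h x)) \<in> borel_measurable \<mu>"
      by (rule measurable_\<mu>[OF measurable_compose[OF measurable_time_shift f]])
    have "(\<integral>\<^sup>+\<omega>. lexp (\<integral>\<^sup>+x. f x \<partial>?N \<omega>) \<partial>\<Omega>) = (\<integral>\<^sup>+\<omega>. lexp (\<integral>\<^sup>+x. f (time_shift h x) \<partial>N \<omega>) \<partial>\<Omega>)"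
      by (intro nn_integral_cong arg_cong[of _ _ lexp] nn_integral_distr[OF tN]) (simp add: f)
    also have "\<dots> = lexp (\<integral>\<^sup>+x. 1 - lexp (f (time_shift h x)) \<partial>\<mu>)"
      using laplace_N fs unfolding laplace_functional_def by (rule bspec)
    also have "(\<integral>\<^sup>+x. 1 - lexp (f (time_shift h x)) \<partial>\<mu>) = (\<integral>\<^sup>+x. 1 - lexp (f x) \<partial>distr \<mu> Dbar (time_shift h))"
      using f by (intro nn_integral_distr[symmetric] measurable_\<mu>[OF measurable_time_shift]) simp
    finally show "(\<integral>\<^sup>+\<omega>. lexp (\<integral>\<^sup>+x. f x \<partial>?N \<omega>) \<partial>\<Omega>) = lexp (\<integral>\<^sup>+x. 1 - lexp (f x) \<partial>\<mu>)"
      by (simp only: \<mu>_shift)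
  qed
  show ?thesis
    using laplace_law_unique[OF prob_space_axioms prob_space_axioms Nm _ cnt counting_\<mu> lap laplace_N]
    by (simp add: measure_algebra_\<mu> N_measurable)
qed

text \<open>The paths above the level -m at time 0 already have mass e^m.\<close>

lemma \<mu>_infinite: "emeasure \<mu> (space Dbar) = \<infinity>"
proof -
  have "ennreal (exp (real m)) \<le> emeasure \<mu> (space Dbar)" for m :: nat
    using emeasure_mono[of "cylinder {0} (\<lambda>_. {- real m<..})" "space Dbar" \<mu>] \<mu>_above[of 0 "- real m"]
    by (auto simp: cylinder_def)
  moreover have "of_nat m \<le> ennreal (exp (real m))" for m :: nat
  proof -
    have "real m \<le> exp (real m)" using exp_ge_add_one_self[of "real m"] by linarith
    then show ?thesis unfolding ennreal_of_nat_eq_real_of_nat by (rule ennreal_leI)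
  qed
  ultimately have "of_nat m \<le> emeasure \<mu> (space Dbar)" for m :: nat by (rule order_trans[rotated])
  then show ?thesis
    by (metis ennreal_Ex_less_of_nat infinity_ennreal_def leD less_top)
qed

section \<open>The maximum process\<close>

text \<open>A supremum, defined for every outcome; \<open>\<eta>_attained\<close> shows that at each
  time it is almost surely a maximum.\<close>

definition \<eta> :: "real \<Rightarrow> 'w \<Rightarrow> ereal" where
  "\<eta> t \<omega> = (SUP k\<in>K. X k \<omega> t)"

lemma \<eta>_measurable: "\<eta> t \<in> borel_measurable \<Omega>"
  unfolding \<eta>_def[abs_def]
  by (intro borel_measurable_SUP countable_particles measurable_compose[OF X_measurable measurable_Dbar_eval])

definition exceed :: "real set \<Rightarrow> (real \<Rightarrow> ereal) \<Rightarrow> (real \<Rightarrow> ereal) set" where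
  "exceed J y = {f \<in> space Dbar. \<exists>t\<in>J. y t < f t}"

lemma exceed_measurable: "finite J \<Longrightarrow> exceed J y \<in> sets Dbar"
  unfolding exceed_def
proof (rule sets.sets_Collect_finite_Ex)
  fix t
  from measurable_sets[OF measurable_Dbar_eval, of "{y t<..}" t]
  show "{f \<in> space Dbar. y t < f t} \<in> sets Dbar" by (simp add: vimage_def Int_def conj_commute)
qed

text \<open>A void probability: no point of the process lies in the set of exceeding paths.\<close>
lemma \<eta>_cdf:
  assumes J: "finite J"
  shows "emeasure \<Omega> {\<omega>\<in>space \<Omega>. \<forall>t\<in>J. \<eta> t \<omega> \<le> y t} = lexp (emeasure \<mu> (exceed J y))"
proof -
  let ?A = "exceed J y" and ?E = "{\<omega>\<in>space \<Omega>. \<forall>t\<in>J. \<eta> t \<omega> \<le> y t}"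
  note A = exceed_measurable[OF J, of y]
  have E: "?E \<in> events"
  proof (rule sets.sets_Collect_finite_All[OF _ J])
    fix t
    from measurable_sets[OF \<eta>_measurable, of "{..y t}" t]
    show "{\<omega> \<in> space \<Omega>. \<eta> t \<omega> \<le> y t} \<in> events" by (simp add: vimage_def Int_def conj_commute)
  qed
  \<comment> \<open>The integral of this test function against the point process is 0 or
    \<infinity>, so \<open>lexp\<close> of it is the indicator that no point lies in the
    set.\<close>
  have f: "(\<lambda>x. \<top> * indicator ?A x :: ennreal) \<in> borel_measurable \<mu>" using A by (intro measurable_\<mu>) simp
  have void: "lexp (\<integral>\<^sup>+x. \<top> * indicator ?A x \<partial>N \<omega>) = indicator ?E \<omega>" if w: "\<omega> \<in> space \<Omega>" for \<omega>
  proof -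
    have "emeasure (N \<omega>) ?A = emeasure (count_space K) ((\<lambda>k. X k \<omega>) -` ?A \<inter> K)"
      unfolding N_def using X_space[OF _ w] A by (intro emeasure_dirac_sum)
    also have "\<dots> = 0 \<longleftrightarrow> (\<lambda>k. X k \<omega>) -` ?A \<inter> K = {}"
      by (subst emeasure_count_space_eq_0) auto
    also have "\<dots> \<longleftrightarrow> (\<forall>t\<in>J. \<eta> t \<omega> \<le> y t)"
    proof -
      have "(\<lambda>k. X k \<omega>) -` ?A \<inter> K = {k \<in> K. \<exists>t\<in>J. y t < X k \<omega> t}"
        using X_space[OF _ w] by (auto simp: exceed_def)
      moreover have "{k \<in> K. \<exists>t\<in>J. y t < X k \<omega> t} = {} \<longleftrightarrow> (\<forall>t\<in>J. \<forall>k\<in>K. X k \<omega> t \<le> y t)"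
        unfolding not_less[symmetric] by blast
      ultimately show ?thesis by (simp only: \<eta>_def SUP_le_iff)
    qed
    finally have "emeasure (N \<omega>) ?A = 0 \<longleftrightarrow> \<omega> \<in> ?E" using w by simp
    moreover have "(\<integral>\<^sup>+x. \<top> * indicator ?A x \<partial>N \<omega>) = \<top> * emeasure (N \<omega>) ?A"
      using A by (intro nn_integral_cmult_indicator) (simp add: N_def)
    ultimately show ?thesis by (cases "\<omega> \<in> ?E") (simp_all add: ennreal_top_mult)
  qed
  have "emeasure \<Omega> ?E = (\<integral>\<^sup>+\<omega>. lexp (\<integral>\<^sup>+x. \<top> * indicator ?A x \<partial>N \<omega>) \<partial>\<Omega>)"
    using E by (simp add: void cong: nn_integral_cong)
  also have "\<dots> = lexp (\<integral>\<^sup>+x. 1 - lexp (\<top> * indicator ?A x) \<partial>\<mu>)"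
    using laplace_N f unfolding laplace_functional_def by (rule bspec)
  also have "(\<integral>\<^sup>+x. 1 - lexp (\<top> * indicator ?A x) \<partial>\<mu>) = (\<integral>\<^sup>+x. indicator ?A x \<partial>\<mu>)"
    by (intro nn_integral_cong) (simp add: indicator_def)
  also have "\<dots> = emeasure \<mu> ?A" using A by (intro nn_integral_indicator) simp
  finally show ?thesis .
qed

text \<open>Above the level -m at time t the expected number of particles is e^m, so almost surely
  these numbers are finite for all m at once, and a supremum above -\<infinity> is taken over
  finitely many particles. If all particles are at -\<infinity>, any of them attains it.\<close>

theorem \<eta>_attained: "AE \<omega> in \<Omega>. \<exists>k\<in>K. X k \<omega> t = \<eta> t \<omega>"
proof -
  let ?C = "\<lambda>m :: nat. cylinder {t} (\<lambda>_. {- real m<..})"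
  have C: "?C m \<in> sets Dbar" for m by (rule cylinder_measurable) auto
  have "AE \<omega> in \<Omega>. emeasure (N \<omega>) (?C m) \<noteq> \<infinity>" for m
  proof (rule nn_integral_PInf_AE)
    show "(\<lambda>\<omega>. emeasure (N \<omega>) (?C m)) \<in> borel_measurable \<Omega>" by (rule measurable_emeasure_point_process[OF N_measurable C])
    have "(\<integral>\<^sup>+\<omega>. emeasure (N \<omega>) (?C m) \<partial>\<Omega>) = emeasure \<mu> (?C m)"
      unfolding \<mu>_def by (rule emeasure_intensity_measure[OF N_measurable C, symmetric])
    then show "(\<integral>\<^sup>+\<omega>. emeasure (N \<omega>) (?C m) \<partial>\<Omega>) \<noteq> \<infinity>" by (simp add: \<mu>_above)
  qed
  then have "AE \<omega> in \<Omega>. \<forall>m. emeasure (N \<omega>) (?C m) \<noteq> \<infinity>" by (subst AE_all_countable) blast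
  then show ?thesis using AE_space
  proof eventually_elim
    case (elim \<omega>)
    have K0: "Central 0 \<in> K" by (auto simp: particles_def)
    show ?case
    proof (cases "\<forall>k\<in>K. X k \<omega> t = -\<infinity>")
      case True
      then have "\<eta> t \<omega> = -\<infinity>" unfolding \<eta>_def
        by (intro antisym SUP_least) simp_all
      then show ?thesis using True K0 by auto
    next
      case False
      then obtain k0 where k0: "k0 \<in> K" "X k0 \<omega> t \<noteq> -\<infinity>" by auto
      then obtain r where r: "X k0 \<omega> t = ereal r"
        using Dbar_not_infty[OF X_space[OF k0(1) elim(2)], of t] by (cases "X k0 \<omega> t") auto
      obtain m :: nat where m: "- r < real m" using reals_Archimedean2 by blast
      \<comment> \<open>The particles above -m. The level lies below the value of k0, so F is
        nonempty, and particles outside F stay below its maximum.\<close>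
      define F where "F = (\<lambda>k. X k \<omega>) -` ?C m \<inter> K"
      have "emeasure (N \<omega>) (?C m) = emeasure (count_space K) F"
        unfolding N_def F_def using X_space[OF _ elim(2)] C by (intro emeasure_dirac_sum)
      then have "finite F" using elim(1) by (cases "finite F") (auto simp: F_def emeasure_count_space)
      have k0F: "k0 \<in> F" using k0 r m X_space[OF k0(1) elim(2)] by (auto simp: F_def cylinder_def)
      have "Max ((\<lambda>k. X k \<omega> t) ` F) \<in> (\<lambda>k. X k \<omega> t) ` F"
        using \<open>finite F\<close> k0F by (intro Max_in) auto
      then obtain k where k: "k \<in> F" and max: "Max ((\<lambda>k. X k \<omega> t) ` F) = X k \<omega> t" by blast
      have ge: "X k' \<omega> t \<le> X k \<omega> t" if "k' \<in> F" for k'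
        using that \<open>finite F\<close> unfolding max[symmetric] by (intro Max_ge) auto
      have kK: "k \<in> K" using k by (simp add: F_def)
      have gt: "ereal (- real m) < X k \<omega> t" using k by (auto simp: F_def cylinder_def)
      have "X k' \<omega> t \<le> X k \<omega> t" if k': "k' \<in> K" for k'
      proof (cases "k' \<in> F")
        case False
        then have "X k' \<omega> t \<notin> ereal ` {- real m<..}"
          using k' X_space[OF k' elim(2)] by (auto simp: F_def cylinder_def)
        then have "X k' \<omega> t \<le> ereal (- real m)"
          using Dbar_not_infty[OF X_space[OF k' elim(2)], of t] by (cases "X k' \<omega> t") auto
        then show ?thesis using gt by simp
      qed (rule ge)
      then have "\<eta> t \<omega> = X k \<omega> t"
        unfolding \<eta>_def using kK by (intro antisym SUP_least SUP_upper)
      then show ?thesis using kK by auto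
    qed
  qed
qed

text \<open>Exceeding levels at the times t + h amounts to exceeding them at the times t after a
  shift by -h, under which \<mu> is invariant; so the void probabilities agree.\<close>

theorem \<eta>_stationary: "stationary \<Omega> \<eta>"
  unfolding stationary_def same_fdd_def
proof (intro allI conjI impI \<eta>_measurable)
  fix h and J :: "real set" assume J: "finite J"
  show "distr \<Omega> (path_alg J) (\<lambda>\<omega>. \<lambda>t\<in>J. \<eta> (t + h) \<omega>) = distr \<Omega> (path_alg J) (\<lambda>\<omega>. \<lambda>t\<in>J. \<eta> t \<omega>)"
  proof (rule distr_finite_dim_eqI[OF prob_space_axioms prob_space_axioms J \<eta>_measurable \<eta>_measurable])
    fix y :: "real \<Rightarrow> ereal"
    let ?J = "(\<lambda>t. t + h) ` J" and ?y = "\<lambda>s. y (s - h)"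
    have "time_shift (- h) -` exceed J y \<inter> space \<mu> = exceed ?J ?y"
      using measurable_space[OF measurable_time_shift[of "- h"]] by (auto simp: exceed_def time_shift_def)
    moreover have "emeasure \<mu> (exceed J y) = emeasure (distr \<mu> Dbar (time_shift (- h))) (exceed J y)"
      by (simp only: \<mu>_shift)
    ultimately have "emeasure \<mu> (exceed J y) = emeasure \<mu> (exceed ?J ?y)"
      by (simp only: emeasure_distr[OF measurable_\<mu>[OF measurable_time_shift] exceed_measurable[OF J]])
    moreover have "{\<omega>\<in>space \<Omega>. \<forall>t\<in>J. \<eta> (t + h) \<omega> \<le> y t} = {\<omega>\<in>space \<Omega>. \<forall>t\<in>?J. \<eta> t \<omega> \<le> ?y t}" by auto
    ultimately show "emeasure \<Omega> {\<omega>\<in>space \<Omega>. \<forall>t\<in>J. \<eta> (t + h) \<omega> \<le> y t} = emeasure \<Omega> {\<omega>\<in>space \<Omega>. \<forall>t\<in>J. \<eta> t \<omega> \<le> y t}"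
      using J by (simp only: \<eta>_cdf finite_imageI)
  qed
qed

text \<open>Taking n independent copies raises a void probability to the power n and so multiplies
  its exponent by n = e^(ln n). Lowering the paths by ln n absorbs exactly this factor, by
  \<open>\<mu>_translate\<close>.\<close>

theorem \<eta>_max_stable: "max_stable \<Omega> \<eta>"
  unfolding max_stable_def
proof (intro conjI allI impI)
  fix t x
  have "exceed {t} (\<lambda>_. ereal x) = cylinder {t} (\<lambda>_. {x<..})"
  proof (intro set_eqI)
    fix f
    have "f \<in> space Dbar \<Longrightarrow> ereal x < f t \<longleftrightarrow> f t \<in> ereal ` {x<..}"
      using Dbar_not_infty[of f t] by (cases "f t") auto
    then show "f \<in> exceed {t} (\<lambda>_. ereal x) \<longleftrightarrow> f \<in> cylinder {t} (\<lambda>_. {x<..})"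
      by (auto simp: exceed_def cylinder_def)
  qed
  then have "emeasure \<Omega> {\<omega>\<in>space \<Omega>. \<eta> t \<omega> \<le> ereal x} = ennreal (exp (- exp (- x)))"
    using \<eta>_cdf[of "{t}" "\<lambda>_. ereal x"] by (simp add: \<mu>_above lexp_ennreal)
  then show "prob {\<omega>\<in>space \<Omega>. \<eta> t \<omega> \<le> ereal x} = exp (- exp (- x))" by (simp add: measure_def)
next
  fix n :: nat assume n: "1 \<le> n"
  let ?P = "\<Pi>\<^sub>M i\<in>{..<n}. \<Omega>"
  let ?Y = "\<lambda>t w. (MAX i\<in>{..<n}. \<eta> t (w i)) - ereal (ln (real n))"
  interpret P: product_prob_space "\<lambda>_. \<Omega>" "{..<n}" by unfold_locales
  have "0 \<in> {..<n}" using n by simp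
  then have ne: "{..<n} \<noteq> {}" by blast
  have le: "x - ereal c \<le> z \<longleftrightarrow> x \<le> z + ereal c" for x z :: ereal and c by (cases x; cases z) auto
  have Y: "?Y t \<in> borel_measurable ?P" for t
  proof -
    have "(\<lambda>w. \<eta> t (w i)) \<in> borel_measurable ?P" if "i \<in> {..<n}" for i
      using measurable_component_singleton[OF that] \<eta>_measurable by (rule measurable_compose)
    then show ?thesis
      by (intro borel_measurable_ereal_diff borel_measurable_Max borel_measurable_const) auto
  qed
  show "same_fdd ?P ?Y \<Omega> \<eta>"
    unfolding same_fdd_def
  proof (intro conjI allI impI Y \<eta>_measurable)
    fix J :: "real set" assume J: "finite J"
    show "distr ?P (path_alg J) (\<lambda>w. \<lambda>t\<in>J. ?Y t w) = distr \<Omega> (path_alg J) (\<lambda>\<omega>. \<lambda>t\<in>J. \<eta> t \<omega>)"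
    proof (rule distr_finite_dim_eqI[OF P.prob_space_axioms prob_space_axioms J Y \<eta>_measurable])
      fix y :: "real \<Rightarrow> ereal"
      let ?c = "ln (real n)" and ?y = "\<lambda>t. y t + ereal (ln (real n))"
      let ?E = "{\<omega>\<in>space \<Omega>. \<forall>t\<in>J. \<eta> t \<omega> \<le> ?y t}"
      have E: "?E \<in> events"
      proof (rule sets.sets_Collect_finite_All[OF _ J])
        fix t
        from measurable_sets[OF \<eta>_measurable, of "{..?y t}" t]
        show "{\<omega> \<in> space \<Omega>. \<eta> t \<omega> \<le> ?y t} \<in> events" by (simp add: vimage_def Int_def conj_commute)
      qed
      have "{w\<in>space ?P. \<forall>t\<in>J. ?Y t w \<le> y t} = (\<Pi>\<^sub>E i\<in>{..<n}. ?E)"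
        using ne by (auto simp: le Max_le_iff space_PiM PiE_def Pi_def)
      then have "emeasure ?P {w\<in>space ?P. \<forall>t\<in>J. ?Y t w \<le> y t} = (\<Prod>i\<in>{..<n}. emeasure \<Omega> ?E)"
        using E by (simp only: P.emeasure_PiM[of "{..<n}" "\<lambda>_. ?E"] finite_lessThan)
      also have "\<dots> = (\<Prod>i\<in>{..<n}. lexp (emeasure \<mu> (exceed J ?y)))" by (simp only: \<eta>_cdf[OF J])
      also have "\<dots> = lexp (\<Sum>i\<in>{..<n}. emeasure \<mu> (exceed J ?y))" by (rule lexp_sum[symmetric]) simp
      also have "(\<Sum>i\<in>{..<n}. emeasure \<mu> (exceed J ?y)) = ennreal (exp ?c) * emeasure \<mu> (exceed J ?y)"
        using n by (simp add: ennreal_of_nat_eq_real_of_nat)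
      also have "exceed J ?y = central_path (- ?c) -` exceed J y \<inter> space \<mu>"
      proof -
        have "y t + ereal ?c < z \<longleftrightarrow> y t < ereal (- ?c) + z" for t z by (cases "y t"; cases z) auto
        then show ?thesis
          using measurable_space[OF measurable_translate[of "- ?c"]] by (auto simp: exceed_def central_path_def)
      qed
      also have "ennreal (exp ?c) * emeasure \<mu> (central_path (- ?c) -` exceed J y \<inter> space \<mu>) =
          emeasure (scale_measure (ennreal (exp ?c)) (distr \<mu> Dbar (central_path (- ?c)))) (exceed J y)"
        by (simp only: emeasure_scale_measure emeasure_distr[OF measurable_\<mu>[OF measurable_translate] exceed_measurable[OF J]])
      also have "\<dots> = emeasure \<mu> (exceed J y)" by (simp only: \<mu>_translate)
      finally show "emeasure ?P {w\<in>space ?P. \<forall>t\<in>J. ?Y t w \<le> y t} = emeasure \<Omega> {\<omega>\<in>space \<Omega>. \<forall>t\<in>J. \<eta> t \<omega> \<le> y t}"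
        by (simp only: \<eta>_cdf[OF J])
    qed
  qed
qed

end

theorem theorem1p5:
  fixes M :: "'a measure" and \<xi> :: "real \<Rightarrow> 'a \<Rightarrow> real"
    and M' :: "'b measure" and \<xi>' :: "real \<Rightarrow> 'b \<Rightarrow> real"
    and \<theta>p \<theta>m :: real
    and qp qm :: "real \<Rightarrow> real \<Rightarrow> real measure"
    and law_Lp law_Lm :: "(real \<Rightarrow> ereal) measure"
    and \<Omega> :: "'w measure"
    and U Tp Up Tm Um :: "nat \<Rightarrow> 'w \<Rightarrow> real"
    and L Lp Lm :: "nat \<Rightarrow> 'w \<Rightarrow> real \<Rightarrow> ereal"
    and V Vp Vm :: "nat \<Rightarrow> 'w \<Rightarrow> real \<Rightarrow> ereal"
    and X :: "particle \<Rightarrow> 'w \<Rightarrow> real \<Rightarrow> ereal"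
    and N :: "'w \<Rightarrow> (real \<Rightarrow> ereal) measure"
    and \<mu> :: "(real \<Rightarrow> ereal) measure"
    and \<eta> :: "real \<Rightarrow> 'w \<Rightarrow> ereal"
  assumes levy: "levy_process M \<xi>"
    and psi_finite: "integrable M (\<lambda>\<omega>. exp (\<xi> 1 \<omega>))"
    and rates: "\<theta>p \<ge> 0" "\<theta>m \<ge> 0"
    and psi: "ln (\<integral>\<omega>. exp (\<xi> 1 \<omega>) \<partial>M) = \<theta>m - \<theta>p"
    \<comment> \<open>the processes \<open>L\<^sup>+\<close>, \<open>L\<^sup>-\<close> and their kernels\<close>
    and qp_def: "qp = killed_kernel M \<xi> \<theta>m"
    and levy': "levy_process M' \<xi>'"
    and qm_def: "qm = killed_kernel M' \<xi>' \<theta>p"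
    and dual: "\<And>t. t \<ge> 0 \<Longrightarrow> exp_dual (qm t) (qp t)"
    and law_Lp_def: "law_Lp = killed_law M \<xi> \<theta>m"
    and law_Lm_def: "law_Lm = killed_law M' \<xi>' \<theta>p"
    \<comment> \<open>the Poisson point processes\<close>
    and prob: "prob_space \<Omega>"
    and ppp0: "poisson_points \<Omega> exp_intensity UNIV U"
    and ppp_plus: "poisson_points \<Omega> (rate_intensity {0<..} \<theta>p)
                     (point_indices \<theta>p) (\<lambda>i \<omega>. (Tp i \<omega>, Up i \<omega>))"
    and ppp_minus: "poisson_points \<Omega> (rate_intensity {..<0} \<theta>m)
                     (point_indices \<theta>m) (\<lambda>i \<omega>. (Tm i \<omega>, Um i \<omega>))"
    \<comment> \<open>the copies of \<open>L\<close>, \<open>L\<^sup>+\<close>, \<open>L\<^sup>-\<close>\<close>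
    and L_rv: "\<And>i. L i \<in> \<Omega> \<rightarrow>\<^sub>M Dbar"
    and L_law: "\<And>i. distr \<Omega> (path_alg UNIV) (L i) = two_sided_law law_Lp law_Lm"
    and Lp_rv: "\<And>i. Lp i \<in> \<Omega> \<rightarrow>\<^sub>M cadlag_space {0..}"
    and Lp_law: "\<And>i. distr \<Omega> (path_alg {0..}) (Lp i) = law_Lp"
    and Lm_rv: "\<And>i. Lm i \<in> \<Omega> \<rightarrow>\<^sub>M caglad_space {0..}"
    and Lm_law: "\<And>i. distr \<Omega> (path_alg {0..}) (Lm i) = law_Lm"
    and indep: "prob_space.indep_sets \<Omega> (\<lambda>s. case s of
        Points0 \<Rightarrow> generated \<Omega> (\<Pi>\<^sub>M i\<in>UNIV. borel) (\<lambda>\<omega> i. U i \<omega>)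
      | PointsPlus \<Rightarrow> generated \<Omega> (\<Pi>\<^sub>M i\<in>point_indices \<theta>p. borel)
                        (\<lambda>\<omega>. \<lambda>i\<in>point_indices \<theta>p. (Tp i \<omega>, Up i \<omega>))
      | PointsMinus \<Rightarrow> generated \<Omega> (\<Pi>\<^sub>M i\<in>point_indices \<theta>m. borel)
                        (\<lambda>\<omega>. \<lambda>i\<in>point_indices \<theta>m. (Tm i \<omega>, Um i \<omega>))
      | Driver (Central i) \<Rightarrow> generated \<Omega> (path_alg UNIV) (L i)
      | Driver (Plus i) \<Rightarrow> generated \<Omega> (path_alg {0..}) (Lp i)
      | Driver (Minus i) \<Rightarrow> generated \<Omega> (path_alg {0..}) (Lm i)) UNIV"
    \<comment> \<open>the particle trajectories, the point process \<open>\<Pi>\<close>, its intensity, and \<open>\<eta>\<close>\<close>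
    and V_def: "\<And>i \<omega>. V i \<omega> = central_path (U i \<omega>) (L i \<omega>)"
    and Vp_def: "\<And>i \<omega>. Vp i \<omega> = plus_path (Tp i \<omega>) (Up i \<omega>) (Lp i \<omega>)"
    and Vm_def: "\<And>i \<omega>. Vm i \<omega> = minus_path (Tm i \<omega>) (Um i \<omega>) (Lm i \<omega>)"
    and X_def: "\<And>k. X k = (case k of Central i \<Rightarrow> V i | Plus i \<Rightarrow> Vp i | Minus i \<Rightarrow> Vm i)"
    and N_def: "\<And>\<omega>. N \<omega> = dirac_sum Dbar (particles \<theta>p \<theta>m) (\<lambda>k. X k \<omega>)"
    and mu_def: "\<mu> = intensity_measure \<Omega> Dbar N"
    and eta_def: "\<And>t \<omega>. \<eta> t \<omega> = (SUP k\<in>particles \<theta>p \<theta>m. X k \<omega> t)"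
  shows "(\<forall>k\<in>particles \<theta>p \<theta>m. X k \<in> \<Omega> \<rightarrow>\<^sub>M Dbar)
    \<and> poisson_point_process \<Omega> \<mu> N
    \<and> (\<forall>t. distr \<Omega> (measure_algebra Dbar) (\<lambda>\<omega>. distr (N \<omega>) Dbar (time_shift t)) =
             distr \<Omega> (measure_algebra Dbar) N)
    \<and> emeasure \<mu> (space Dbar) = \<infinity>
    \<and> (\<forall>(t :: nat \<Rightarrow> real) (B :: nat \<Rightarrow> real set) n.
         (\<forall>i<n. t i < t (Suc i)) \<and> (\<forall>i\<le>n. B i \<in> sets borel) \<longrightarrow>
         emeasure \<mu> {f\<in>space Dbar. \<forall>i\<le>n. f (t i) \<in> ereal ` B i} =
         (\<integral>\<^sup>+x\<in>B 0. ennreal (exp (- x)) * kernel_chain qp t B n 0 x \<partial>lborel))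
    \<and> (\<forall>t. AE \<omega> in \<Omega>. \<exists>k\<in>particles \<theta>p \<theta>m. X k \<omega> t = \<eta> t \<omega>)
    \<and> max_stable \<Omega> \<eta>
    \<and> stationary \<Omega> \<eta>"
proof -
  interpret prob_space \<Omega> by (rule prob)
  interpret S: particle_system M \<xi> M' \<xi>' \<theta>p \<theta>m \<Omega> U Tp Up Tm Um L Lp Lm
  proof unfold_locales
    fix t :: real assume "t \<ge> 0"
    then show "exp_dual (killed_kernel M' \<xi>' \<theta>p t) (killed_kernel M \<xi> \<theta>m t)"
      using dual by (simp add: qp_def qm_def)
  qed (use levy levy' rates ppp0 ppp_plus ppp_minus L_rv L_law Lp_rv Lp_law Lm_rv Lm_law indep
      in \<open>simp_all only: law_Lp_def law_Lm_def\<close>)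
  have X: "X = S.X"
  proof (intro ext)
    fix k \<omega> t
    show "X k \<omega> t = S.X k \<omega> t"
      by (cases k) (simp_all add: X_def V_def Vp_def Vm_def S.X_def)
  qed
  have N: "N = S.N" by (rule ext) (simp only: N_def S.N_def X)
  have mu: "\<mu> = S.\<mu>" by (simp only: mu_def S.\<mu>_def N)
  have eta: "\<eta> = S.\<eta>" by (intro ext) (simp only: eta_def S.\<eta>_def X)
  \<comment> \<open>The marginal formula holds for weakly increasing times; strictly increasing ones
    are a special case.\<close>
  have fdd: "emeasure S.\<mu> {f\<in>space Dbar. \<forall>i\<le>n. f (t i) \<in> ereal ` B i} =
      (\<integral>\<^sup>+x\<in>B 0. ennreal (exp (- x)) * kernel_chain qp t B n 0 x \<partial>lborel)"
    if "\<forall>i<n. t i < t (Suc i)" "\<forall>i\<le>n. B i \<in> sets borel" for t :: "nat \<Rightarrow> real" and B :: "nat \<Rightarrow> real set" and n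
    unfolding qp_def by (rule S.fdd_formula) (use that in \<open>auto intro: less_imp_le\<close>)
  show ?thesis
    unfolding X N mu eta
    by (intro conjI ballI allI impI S.X_measurable S.poisson_N S.N_shift S.\<mu>_infinite fdd
        S.\<eta>_attained S.\<eta>_max_stable S.\<eta>_stationary) blast+
qed

end
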